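(* Let $D\subset\mathbb{R}^3$ be the open unit ball and let $\gamma\in L^\infty(D)$ be real-valued with $C^{-1}\le\gamma\le C$ for some constant $C>0$. Suppose $\gamma$ is spherically symmetric, i.e. $\gamma(x)$ depends only on $|x|$. Then the eigenfunctions of the Dirichlet-to-Neumann map $\Lambda_\gamma$ are the spherical harmonics: for every $l\ge 0$ and $-l\le m\le l$, $Y_l^m$ is an eigenfunction of $\Lambda_\gamma$.
   Context: The Dirichlet-to-Neumann map is $\Lambda_\gamma f=\gamma\,\partial u/\partial\nu|_{\partial D}$, where $u$ solves $\nabla\cdot(\gamma\nabla u)=0$ in $D$, $u|_{\partial D}=f$, and $\nu$ is the outward unit normal. In general this is understood weakly: $\Lambda_\gamma:H^{1/2}(\partial D)\to H^{-1/2}(\partial D)$ with $\langle\Lambda_\gamma f,w|_{\partial D}\rangle=\int_D\gamma\nabla u\cdot\nabla w\,dx$ for all $w\in H^1(D)$, where $u\in H^1(D)$ is the weak solution. $Y_l^m$ ($l\ge0$, $-l\le m\le l$) are the standard normalized spherical harmonics on the unit sphere $\partial D$, $Y_l^m(\theta,\phi)=N_l^mP_l^m(\cos\theta)e^{im\phi}$, with $P_l^m$ the associated Legendre functions and $N_l^m$ normalization factors. *)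

theory Defs
  imports "HOL-Analysis.Analysis" "HOL-Computational_Algebra.Polynomial"
begin

section \<open>Domain and surface measure\<close>

abbreviation unit_ball :: "(real^3) set" where
  "unit_ball \<equiv> ball 0 1"

abbreviation ball_measure :: "(real^3) measure" where
  "ball_measure \<equiv> lebesgue_on unit_ball"

(* Surface measure of the unit sphere, as in polar coordinates on R^n (here n = 3):
   sigma(E) = n * vol {r * w | 0 < r < 1, w : E}.  Its total mass is 3 * (4/3 * pi) = 4 * pi. *)
definition surface_measure :: "(real^3) measure" where
  "surface_measure = scale_measure 3
     (distr (restrict_space lborel (unit_ball - {0})) (restrict_space borel (sphere 0 1))
        (\<lambda>x. x /\<^sub>R norm x))"

section \<open>The Sobolev space \<open>H\<^sup>1\<close> and traces\<close>

definition L2 :: "'a measure \<Rightarrow> ('a \<Rightarrow> 'b::euclidean_space) \<Rightarrow> bool" where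
  "L2 M f \<longleftrightarrow> f \<in> borel_measurable M \<and> integrable M (\<lambda>x. (norm (f x))\<^sup>2)"

definition L2_converges ::
    "'a measure \<Rightarrow> (nat \<Rightarrow> 'a \<Rightarrow> 'b::euclidean_space) \<Rightarrow> ('a \<Rightarrow> 'b) \<Rightarrow> bool" where
  "L2_converges M F f \<longleftrightarrow> (\<forall>n. L2 M (\<lambda>x. F n x - f x)) \<and>
     (\<lambda>n. \<integral>x. (norm (F n x - f x))\<^sup>2 \<partial>M) \<longlonglongrightarrow> 0"

definition partial_deriv ::
    "3 \<Rightarrow> (real^3 \<Rightarrow> 'b::real_normed_vector) \<Rightarrow> real^3 \<Rightarrow> 'b" where
  "partial_deriv i f x = frechet_derivative f (at x) (axis i 1)"

primrec Ck :: "nat \<Rightarrow> (real^3 \<Rightarrow> 'b::real_normed_vector) \<Rightarrow> bool" where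
  "Ck 0 f \<longleftrightarrow> continuous_on UNIV f"
| "Ck (Suc k) f \<longleftrightarrow> (\<forall>x. f differentiable (at x)) \<and> (\<forall>i. Ck k (partial_deriv i f))"

definition smooth :: "(real^3 \<Rightarrow> 'b::real_normed_vector) \<Rightarrow> bool" where
  "smooth f \<longleftrightarrow> (\<forall>k. Ck k f)"

definition test_function :: "(real^3 \<Rightarrow> real) \<Rightarrow> bool" where
  "test_function \<phi> \<longleftrightarrow> smooth \<phi> \<and>
     compact (closure {x. \<phi> x \<noteq> 0}) \<and> closure {x. \<phi> x \<noteq> 0} \<subseteq> unit_ball"

(* u belongs to H^1(D) and has weak gradient G.  Functions are complex-valued, since the
   spherical harmonics are; real test functions suffice by linearity.  G is unique up to
   null sets. *)
definition H1 :: "(real^3 \<Rightarrow> complex) \<Rightarrow> (real^3 \<Rightarrow> complex^3) \<Rightarrow> bool" where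
  "H1 u G \<longleftrightarrow> L2 ball_measure u \<and> L2 ball_measure G \<and>
     (\<forall>\<phi> i. test_function \<phi> \<longrightarrow>
        (\<integral>x. partial_deriv i \<phi> x *\<^sub>R u x \<partial>ball_measure)
          = - (\<integral>x. \<phi> x *\<^sub>R (G x $ i) \<partial>ball_measure))"

(* f is the trace on the sphere of u, where u is in H^1(D) with weak gradient G: the trace
   operator is the continuous extension to H^1(D) of the restriction of functions that are
   smooth up to the boundary. *)
definition has_trace ::
    "(real^3 \<Rightarrow> complex) \<Rightarrow> (real^3 \<Rightarrow> complex^3) \<Rightarrow> (real^3 \<Rightarrow> complex) \<Rightarrow> bool" where
  "has_trace u G f \<longleftrightarrow> H1 u G \<and> L2 surface_measure f \<and>
     (\<exists>F :: nat \<Rightarrow> real^3 \<Rightarrow> complex. (\<forall>n. smooth (F n)) \<and>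
        L2_converges ball_measure F u \<and>
        L2_converges ball_measure (\<lambda>n x. \<chi> i. partial_deriv i (F n) x) G \<and>
        L2_converges surface_measure F f)"

definition H_half :: "(real^3 \<Rightarrow> complex) set" where
  "H_half = {f. \<exists>u G. has_trace u G f}"

section \<open>The Dirichlet-to-Neumann map\<close>

(* The complex-bilinear (not sesquilinear) form: the integral of gamma * (grad u . grad w). *)
definition energy ::
    "(real^3 \<Rightarrow> real) \<Rightarrow> (real^3 \<Rightarrow> complex^3) \<Rightarrow> (real^3 \<Rightarrow> complex^3) \<Rightarrow> complex" where
  "energy \<gamma> G H = (\<integral>x. \<gamma> x *\<^sub>R (\<Sum>i\<in>UNIV. G x $ i * H x $ i) \<partial>ball_measure)"

(* The test space H^1_0(D) is the kernel of the trace. *)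
definition weak_solution ::
    "(real^3 \<Rightarrow> real) \<Rightarrow> (real^3 \<Rightarrow> complex) \<Rightarrow> (real^3 \<Rightarrow> complex) \<Rightarrow> (real^3 \<Rightarrow> complex^3) \<Rightarrow> bool" where
  "weak_solution \<gamma> f u G \<longleftrightarrow> has_trace u G f \<and>
     (\<forall>v H. has_trace v H (\<lambda>_. 0) \<longrightarrow> energy \<gamma> G H = 0)"

(* dn_map gamma f h is the pairing of the element Lambda_gamma f of H^{-1/2} with h in H^{1/2}. *)
definition dn_map ::
    "(real^3 \<Rightarrow> real) \<Rightarrow> (real^3 \<Rightarrow> complex) \<Rightarrow> (real^3 \<Rightarrow> complex) \<Rightarrow> complex" where
  "dn_map \<gamma> f h = (THE c. \<exists>u G w H.
     weak_solution \<gamma> f u G \<and> has_trace w H h \<and> c = energy \<gamma> G H)"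

(* A function f on the sphere is regarded as the element h |-> (integral of f * h) of
   H^{-1/2}, so the last conjunct says Lambda_gamma f = ev * f in H^{-1/2}. *)
definition dn_eigenfunction :: "(real^3 \<Rightarrow> real) \<Rightarrow> (real^3 \<Rightarrow> complex) \<Rightarrow> bool" where
  "dn_eigenfunction \<gamma> f \<longleftrightarrow> f \<in> H_half \<and> \<not> (AE x in surface_measure. f x = 0) \<and>
     (\<exists>ev. \<forall>h\<in>H_half. dn_map \<gamma> f h = ev * (\<integral>x. f x * h x \<partial>surface_measure))"

section \<open>Spherical harmonics\<close>

(* Rodrigues' formula, with the Condon-Shortley phase. *)
definition assoc_legendre_nonneg :: "nat \<Rightarrow> nat \<Rightarrow> real \<Rightarrow> real" where
  "assoc_legendre_nonneg l m x =
     (-1) ^ m / (2 ^ l * fact l) * sqrt (1 - x\<^sup>2) ^ m *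
     poly ((pderiv ^^ (l + m)) ([:-1, 0, 1:] ^ l)) x"

definition assoc_legendre :: "nat \<Rightarrow> int \<Rightarrow> real \<Rightarrow> real" where
  "assoc_legendre l m x =
     (if m \<ge> 0 then assoc_legendre_nonneg l (nat m) x
      else (-1) ^ nat (-m) * fact (l - nat (-m)) / fact (l + nat (-m))
             * assoc_legendre_nonneg l (nat (-m)) x)"

definition sph_norm :: "nat \<Rightarrow> int \<Rightarrow> real" where
  "sph_norm l m =
     sqrt ((2 * real l + 1) / (4 * pi) * fact (nat (int l - m)) / fact (nat (int l + m)))"

definition sph_harm_angles :: "nat \<Rightarrow> int \<Rightarrow> real \<Rightarrow> real \<Rightarrow> complex" where
  "sph_harm_angles l m \<theta> \<phi> =
     of_real (sph_norm l m * assoc_legendre l m (cos \<theta>)) * exp (\<i> * of_int m * of_real \<phi>)"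

(* theta is the polar angle from the third axis; at the poles, where the azimuth phi is
   immaterial, Arg 0 = 0. *)
definition sph_harm :: "nat \<Rightarrow> int \<Rightarrow> real^3 \<Rightarrow> complex" where
  "sph_harm l m x = sph_harm_angles l m (arccos (x $ 3)) (Arg (Complex (x $ 1) (x $ 2)))"

end

theory Submission
  imports Defs
begin

text \<open>
  Let \<open>p\<close> be the solid harmonic extending \<open>Y\<^sub>l\<^sup>m\<close>, so that \<open>p\<close> is harmonic and homogeneous of degree \<open>l\<close>.
  The solution with boundary values \<open>Y\<^sub>l\<^sup>m\<close> is sought in the form \<open>s(|x|\<^sup>2) p(x)\<close>.  For smooth \<open>F\<close> put
  \<open>W(r) = \<integral> p(\<omega>) F(r\<omega>) d\<omega>\<close> and \<open>R(r) = r\<^sup>l s(r\<^sup>2)\<close>.  Since \<open>p\<close> is harmonic, Green's identity on balls gives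
  \<open>\<integral> \<gamma> \<nabla>(s p) \<cdot> \<nabla>F dx = \<integral>\<^sub>0\<^sup>1 g (r\<^sup>2 R' W' + l (l + 1) R W) dr\<close>, where \<open>\<gamma>(x) = g(|x|)\<close>.
  For \<open>l > 0\<close>, polynomials \<open>s\<close> with \<open>s(1) = 1\<close> that minimize this one-dimensional form give functions converging in
  \<open>H\<^sup>1\<close>.  Their limit annihilates every \<open>W\<close> with \<open>W(1) = 0\<close>, because such \<open>W\<close> are limits of \<open>r\<^sup>l t(r\<^sup>2)\<close> with
  polynomials \<open>t\<close>, \<open>t(1) = 0\<close>.  Hence its energy against \<open>F\<close> is a fixed multiple of \<open>W(1) = \<integral> Y\<^sub>l\<^sup>m F\<close>, and
  coercivity and density of smooth functions turn this into the eigenvalue equation in \<open>H\<^bsup>-1/2\<^esup>\<close>.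
\<close>

section \<open>Square-integrable functions\<close>

text \<open>Since \<gamma> is merely bounded and measurable, the radial equation (r^2 g R')' = l (l
  + 1) g R need not have a classical solution, which is why the profile comes from minimization.
  Taking s to be a polynomial in |x|^2 makes every approximant a polynomial on all of space, hence
  smooth at the origin and directly usable as an approximating sequence in the definition of a
  trace; s(1) = 1 makes its boundary values exact. The form evaluated at the minimizing sequence and
  the constant polynomial 1 converges, and its limit is the eigenvalue. The term l (l + 1) R W also
  controls the L^2 norm, in place of a Poincare inequality; for l = 0 it is absent, but then the
  solution is constant and the eigenvalue is 0. Green's identity is obtained without boundary
  integrals: the divergence of a compactly supported C^1 field has integral zero, the field carries
  the weight (t^2 - |x|^2)^2 on the ball of radius t, and varying t recovers the identity on each
  sphere. The energy form is bilinear, so positivity is used by pairing a gradient with its complex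
  conjugate.\<close>

lemma norm_add_power2_le: "(norm (a + b))\<^sup>2 \<le> 2 * (norm a)\<^sup>2 + 2 * (norm (b::'a::real_normed_vector))\<^sup>2"
proof -
  have "(norm (a + b))\<^sup>2 \<le> (norm a + norm b)\<^sup>2"
    by (intro power_mono norm_triangle_ineq norm_ge_zero)
  also have "\<dots> \<le> 2 * (norm a)\<^sup>2 + 2 * (norm b)\<^sup>2"
    using sum_squares_bound[of "norm a" "norm b"] by (simp add: power2_sum)
  finally show ?thesis .
qed

lemma L2_measurable: "L2 M f \<Longrightarrow> f \<in> borel_measurable M"
  and L2_integrable: "L2 M f \<Longrightarrow> integrable M (\<lambda>x. (norm (f x))\<^sup>2)"
  by (simp_all add: L2_def)

lemma L2_dominated:
  assumes "f \<in> borel_measurable M" "integrable M g" "AE x in M. (norm (f x))\<^sup>2 \<le> g x"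
  shows "L2 M f"
  unfolding L2_def
proof
  show "integrable M (\<lambda>x. (norm (f x))\<^sup>2)"
    by (rule Bochner_Integration.integrable_bound[OF assms(2)])
       (use assms in \<open>auto elim!: eventually_mono\<close>)
qed fact

lemma L2_add: "L2 M f \<Longrightarrow> L2 M g \<Longrightarrow> L2 M (\<lambda>x. f x + g x)"
  by (rule L2_dominated[where g = "\<lambda>x. 2 * (norm (f x))\<^sup>2 + 2 * (norm (g x))\<^sup>2"])
     (auto simp: L2_def norm_add_power2_le)

lemma L2_minus: "L2 M f \<Longrightarrow> L2 M (\<lambda>x. - f x)"
  by (simp add: L2_def)

lemma L2_diff: "L2 M f \<Longrightarrow> L2 M g \<Longrightarrow> L2 M (\<lambda>x. f x - g x)"
  using L2_add[of M f "\<lambda>x. - g x"] L2_minus[of M g] by simp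

lemma L2_zero: "L2 M (\<lambda>_. 0)"
  by (simp add: L2_def)

text \<open>Optimizing the weight \<open>e\<close> turns the weighted arithmetic-geometric bound
  into Cauchy-Schwarz. The minimizer is \<open>sqrt B / sqrt A\<close>; if \<open>A\<close> or
  \<open>B\<close> is zero, a large or small \<open>e\<close> pushes the bound below every
  \<open>d > 0\<close>.\<close>

lemma le_sqrt_mult_sqrt_if_le_weighted:
  fixes x A B :: real
  assumes "A \<ge> 0" "B \<ge> 0" and le: "\<And>e. e > 0 \<Longrightarrow> x \<le> (e * A + B / e) / 2"
  shows "x \<le> sqrt A * sqrt B"
proof (cases "A = 0 \<or> B = 0")
  case False
  then have pos: "sqrt A > 0" "sqrt B > 0" using assms by auto
  have eA: "sqrt B / sqrt A * A = sqrt A * sqrt B"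
    using pos real_sqrt_mult_self[of A] assms(1) by (simp add: field_simps)
  have eB: "B / (sqrt B / sqrt A) = sqrt A * sqrt B"
    using pos real_sqrt_mult_self[of B] assms(2) by (simp add: field_simps)
  show ?thesis using le[of "sqrt B / sqrt A"] pos unfolding eA eB by simp
next
  case True
  have "x \<le> 0"
  proof (rule field_le_epsilon)
    fix d :: real assume d: "d > 0"
    show "x \<le> 0 + d"
    proof (cases "A = 0")
      case True
      \<comment> \<open>The weight \<open>e = (B + 1) / d\<close> makes \<open>B / e\<close> at most
        \<open>d\<close>; the \<open>+ 1\<close> keeps \<open>e\<close> positive when
        \<open>B = 0\<close>.\<close>
      define t where "t = B / ((B + 1) / d)"
      have "t \<le> d" using d assms(2) by (simp add: t_def field_simps)
      moreover have "0 \<le> t" "x \<le> t / 2" using d assms(2) le[of "(B + 1) / d"] True by (auto simp: t_def)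
      ultimately show ?thesis by linarith
    next
      case False
      then have "B = 0" using \<open>A = 0 \<or> B = 0\<close> by simp
      moreover have "d / A * A = d" using False by simp
      ultimately show ?thesis using le[of "d / A"] d False assms(1) by simp
    qed
  qed
  then show ?thesis using True by auto
qed

text \<open>Cauchy-Schwarz for any integrand dominated by a product, so that one statement serves
  scalar multiples, complex products and the weighted dot product of gradients, with
  \<open>K\<close> absorbing the bound on \<gamma>.\<close>

lemma L2_product:
  fixes h :: "'a \<Rightarrow> 'd::{banach, second_countable_topology}"
  assumes f: "L2 M f" and g: "L2 M g" and h: "h \<in> borel_measurable M"
    and K: "K \<ge> 0" and bd: "AE x in M. norm (h x) \<le> K * (norm (f x) * norm (g x))"
  shows "integrable M h"
    and "norm (\<integral>x. h x \<partial>M) \<le> K * (sqrt (\<integral>x. (norm (f x))\<^sup>2 \<partial>M) * sqrt (\<integral>x. (norm (g x))\<^sup>2 \<partial>M))"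
proof -
  have amgm: "norm (f x) * norm (g x) \<le> (e * (norm (f x))\<^sup>2 + (norm (g x))\<^sup>2 / e) / 2" if "e > 0" for e x
  proof -
    have "0 \<le> (e * norm (f x) - norm (g x))\<^sup>2 / e" using that by simp
    also have "\<dots> = e * (norm (f x))\<^sup>2 + (norm (g x))\<^sup>2 / e - 2 * (norm (f x) * norm (g x))"
      using that by (simp add: power2_eq_square field_simps)
    finally show ?thesis by simp
  qed
  note [simp] = L2_integrable[OF f] L2_integrable[OF g]
  note [measurable] = L2_measurable[OF f] L2_measurable[OF g]
  have int: "integrable M (\<lambda>x. norm (f x) * norm (g x))"
    by (rule Bochner_Integration.integrable_bound[where f = "\<lambda>x. (1 * (norm (f x))\<^sup>2 + (norm (g x))\<^sup>2 / 1) / 2"])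
       (use amgm[of 1] in auto)
  show "integrable M h"
    by (rule Bochner_Integration.integrable_bound[where f = "\<lambda>x. K * (norm (f x) * norm (g x))"])
       (use int h bd K in \<open>auto elim!: eventually_mono\<close>)
  have "(\<integral>x. norm (f x) * norm (g x) \<partial>M)
      \<le> sqrt (\<integral>x. (norm (f x))\<^sup>2 \<partial>M) * sqrt (\<integral>x. (norm (g x))\<^sup>2 \<partial>M)"
  proof (rule le_sqrt_mult_sqrt_if_le_weighted)
    fix e :: real assume e: "e > 0"
    have "(\<integral>x. norm (f x) * norm (g x) \<partial>M) \<le> (\<integral>x. (e * (norm (f x))\<^sup>2 + (norm (g x))\<^sup>2 / e) / 2 \<partial>M)"
      by (rule integral_mono) (use int amgm[OF e] in auto)
    then show "(\<integral>x. norm (f x) * norm (g x) \<partial>M)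
        \<le> (e * (\<integral>x. (norm (f x))\<^sup>2 \<partial>M) + (\<integral>x. (norm (g x))\<^sup>2 \<partial>M) / e) / 2" by simp
  qed auto
  moreover have "norm (\<integral>x. h x \<partial>M) \<le> (\<integral>x. K * (norm (f x) * norm (g x)) \<partial>M)"
    by (rule order_trans[OF integral_norm_bound integral_mono_AE]) (use int bd \<open>integrable M h\<close> in auto)
  ultimately show "norm (\<integral>x. h x \<partial>M)
      \<le> K * (sqrt (\<integral>x. (norm (f x))\<^sup>2 \<partial>M) * sqrt (\<integral>x. (norm (g x))\<^sup>2 \<partial>M))"
    using K by (auto intro: order_trans mult_left_mono)
qed

section \<open>Convergence in L^2 and completeness\<close>

lemma L2_converges_L2: "L2_converges M F f \<Longrightarrow> L2 M f \<Longrightarrow> L2 M (F n)"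
  using L2_add[of M "\<lambda>x. F n x - f x" f] by (simp add: L2_converges_def)

lemma L2_converges_limit_L2: "L2_converges M F f \<Longrightarrow> L2 M (F n) \<Longrightarrow> L2 M f"
  using L2_diff[of M "F n" "\<lambda>x. F n x - f x"] by (simp add: L2_converges_def)

lemma L2_converges_const: "L2_converges M (\<lambda>_. f) f"
  by (simp add: L2_converges_def L2_zero)

lemma L2_converges_diff:
  assumes "L2_converges M F f" "L2_converges M G g"
  shows "L2_converges M (\<lambda>n x. F n x - G n x) (\<lambda>x. f x - g x)"
proof -
  have d: "F n x - G n x - (f x - g x) = (F n x - f x) - (G n x - g x)" for n x
    by (simp add: algebra_simps)
  have L: "L2 M (\<lambda>x. F n x - f x)" "L2 M (\<lambda>x. G n x - g x)" for n
    using assms by (auto simp: L2_converges_def)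
  note LD = L2_diff[OF L]
  show ?thesis
    unfolding L2_converges_def d
  proof (intro conjI allI)
    show "(\<lambda>n. \<integral>x. (norm ((F n x - f x) - (G n x - g x)))\<^sup>2 \<partial>M) \<longlonglongrightarrow> 0"
    proof (rule tendsto_sandwich[OF _ _ tendsto_const])
      show "(\<lambda>n. 2 * (\<integral>x. (norm (F n x - f x))\<^sup>2 \<partial>M) + 2 * (\<integral>x. (norm (G n x - g x))\<^sup>2 \<partial>M)) \<longlonglongrightarrow> 0"
        using assms by (auto simp: L2_converges_def intro!: tendsto_eq_intros)
      have "(\<integral>x. (norm ((F n x - f x) - (G n x - g x)))\<^sup>2 \<partial>M)
         \<le> (\<integral>x. 2 * (norm (F n x - f x))\<^sup>2 + 2 * (norm (G n x - g x))\<^sup>2 \<partial>M)" for n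
      proof (rule integral_mono)
        show "(norm ((F n x - f x) - (G n x - g x)))\<^sup>2 \<le> 2 * (norm (F n x - f x))\<^sup>2 + 2 * (norm (G n x - g x))\<^sup>2" for x
          using norm_add_power2_le[of "F n x - f x" "- (G n x - g x)"] by (simp only: norm_minus_cancel diff_conv_add_uminus)
      qed (use L2_integrable[OF LD[of n]] L2_integrable[OF L(1)[of n]] L2_integrable[OF L(2)[of n]] in simp_all)
      then show "\<forall>\<^sub>F n in sequentially. (\<integral>x. (norm ((F n x - f x) - (G n x - g x)))\<^sup>2 \<partial>M)
         \<le> 2 * (\<integral>x. (norm (F n x - f x))\<^sup>2 \<partial>M) + 2 * (\<integral>x. (norm (G n x - g x))\<^sup>2 \<partial>M)"
        using L2_integrable[OF L(1)] L2_integrable[OF L(2)] by simp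
    qed auto
  qed (rule LD)
qed

text \<open>Cauchy-Schwarz is applied to \<open>H n - h\<close>: the fixed factor contributes a
  constant, the converging one tends to zero. Weak derivatives, energies and surface pairings all
  pass to the limit through this lemma.\<close>

lemma L2_converges_product:
  fixes H :: "nat \<Rightarrow> 'a \<Rightarrow> 'd::{banach, second_countable_topology}"
  assumes conv: "L2_converges M F f" and g: "L2 M g" and K: "K \<ge> 0"
    and H: "\<And>n. integrable M (H n)" and h: "integrable M h"
    and bd: "\<And>n. AE x in M. norm (H n x - h x) \<le> K * (norm (F n x - f x) * norm (g x))"
  shows "(\<lambda>n. \<integral>x. H n x \<partial>M) \<longlonglongrightarrow> (\<integral>x. h x \<partial>M)"
proof -
  have L: "L2 M (\<lambda>x. F n x - f x)" for n using conv by (auto simp: L2_converges_def)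
  have lim: "(\<lambda>n. K * (sqrt (\<integral>x. (norm (F n x - f x))\<^sup>2 \<partial>M) * sqrt (\<integral>x. (norm (g x))\<^sup>2 \<partial>M))) \<longlonglongrightarrow> 0"
    using conv by (auto simp: L2_converges_def intro!: tendsto_eq_intros)
  show ?thesis
  proof (rule LIM_zero_cancel, rule Lim_null_comparison[OF _ lim], intro always_eventually allI)
    fix n
    have m: "(\<lambda>x. H n x - h x) \<in> borel_measurable M" using H[of n] h by measurable
    show "norm ((\<integral>x. H n x \<partial>M) - (\<integral>x. h x \<partial>M))
      \<le> K * (sqrt (\<integral>x. (norm (F n x - f x))\<^sup>2 \<partial>M) * sqrt (\<integral>x. (norm (g x))\<^sup>2 \<partial>M))"
      using L2_product(2)[OF L g m K bd] H[of n] h by simp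
  qed
qed

text \<open>
  Along a subsequence with \<open>\<parallel>F\<^bsub>k(i+1)\<^esub> - F\<^bsub>k(i)\<^esub>\<parallel>\<^sup>2 < 4\<^bsup>-i\<^esup>\<close> the bound \<open>a \<le> 2\<^bsup>-i\<^esup> + 2\<^sup>i a\<^sup>2\<close> makes the increments
  summable almost everywhere; the limit is then controlled by Fatou's lemma.
\<close>
lemma L2_Cauchy_convergent:
  fixes F :: "nat \<Rightarrow> 'a \<Rightarrow> 'b::euclidean_space"
  assumes F: "\<And>n. L2 M (F n)"
    and Cauchy: "\<And>e. e > 0 \<Longrightarrow> \<exists>N. \<forall>m\<ge>N. \<forall>n\<ge>N. (\<integral>x. (norm (F m x - F n x))\<^sup>2 \<partial>M) < e"
  shows "\<exists>f. L2 M f \<and> L2_converges M F f"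
proof -
  have Fd: "L2 M (\<lambda>x. F m x - F n x)" for m n by (intro L2_diff F)
  note [measurable] = L2_measurable[OF F]
  have "\<exists>N. \<forall>m\<ge>N. \<forall>n\<ge>N. (\<integral>x. (norm (F m x - F n x))\<^sup>2 \<partial>M) < (1/4)^k" for k :: nat
    by (rule Cauchy) simp
  then obtain N where N: "\<And>k m n. m \<ge> N k \<Longrightarrow> n \<ge> N k \<Longrightarrow> (\<integral>x. (norm (F m x - F n x))\<^sup>2 \<partial>M) < (1/4)^k"
    by metis
  \<comment> \<open>\<open>Suc r\<close> makes \<open>k\<close> strictly increasing, and
    \<open>N (Suc i)\<close> puts \<open>k (Suc i)\<close> in the range where squared distances are
    below \<open>(1/4) ^ Suc i\<close>.\<close>
  define k where "k = rec_nat (N 0) (\<lambda>i r. max (Suc r) (N (Suc i)))"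
  have kN: "k i \<ge> N i" for i by (cases i) (auto simp: k_def)
  have kmono: "strict_mono k" by (auto simp: k_def strict_mono_Suc_iff less_max_iff_disj)
  define d where "d i x = F (k (Suc i)) x - F (k i) x" for i x
  have dL: "L2 M (d i)" for i unfolding d_def by (rule Fd)
  note [measurable] = L2_measurable[OF dL]
  have dint: "(\<integral>x. (norm (d i x))\<^sup>2 \<partial>M) < (1/4)^i" for i
    unfolding d_def using kN[of i] kmono by (intro N) (auto simp: strict_mono_Suc_iff intro: order_trans less_imp_le)
  have nn: "(\<integral>\<^sup>+x. ennreal ((norm (d i x))\<^sup>2) \<partial>M) \<le> ennreal ((1/4)^i)" for i
    using dint[of i] L2_integrable[OF dL[of i]] by (subst nn_integral_eq_integral) (auto simp: ennreal_leI)
  have "(\<integral>\<^sup>+x. (\<Sum>i. ennreal (2^i * (norm (d i x))\<^sup>2)) \<partial>M) = (\<Sum>i. \<integral>\<^sup>+x. ennreal (2^i * (norm (d i x))\<^sup>2) \<partial>M)"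
    by (rule nn_integral_suminf) simp
  also have "\<dots> \<le> (\<Sum>i. ennreal ((1/2)^i))"
  proof (rule suminf_le)
    fix i
    have "(\<integral>\<^sup>+x. ennreal (2^i * (norm (d i x))\<^sup>2) \<partial>M) = ennreal (2^i) * (\<integral>\<^sup>+x. ennreal ((norm (d i x))\<^sup>2) \<partial>M)"
      by (subst nn_integral_cmult[symmetric]) (auto simp: ennreal_mult)
    also have "\<dots> \<le> ennreal (2^i) * ennreal ((1/4)^i)" by (intro mult_left_mono nn) auto
    also have "\<dots> = ennreal ((1/2)^i)"
      by (subst ennreal_mult[symmetric]) (auto simp: power_mult_distrib[symmetric])
    finally show "(\<integral>\<^sup>+x. ennreal (2^i * (norm (d i x))\<^sup>2) \<partial>M) \<le> ennreal ((1/2)^i)" .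
  qed auto
  also have "\<dots> = ennreal (\<Sum>i. (1/2)^i)" by (rule suminf_ennreal2) auto
  finally have "(\<integral>\<^sup>+x. (\<Sum>i. ennreal (2^i * (norm (d i x))\<^sup>2)) \<partial>M) < \<infinity>"
    using le_less_trans by fastforce
  then have AEfin: "AE x in M. (\<Sum>i. ennreal (2^i * (norm (d i x))\<^sup>2)) \<noteq> \<infinity>"
    by (intro nn_integral_noteq_infinite) auto
  have conv: "convergent (\<lambda>i. F (k i) x)" if "(\<Sum>i. ennreal (2^i * (norm (d i x))\<^sup>2)) \<noteq> \<infinity>" for x
  proof -
    have s1: "summable (\<lambda>i. 2^i * (norm (d i x))\<^sup>2)"
      using that by (intro summable_suminf_not_top) auto
    have "summable (\<lambda>i. (1/2)^i + 2^i * (norm (d i x))\<^sup>2)" by (intro summable_add s1) simp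
    then have "summable (\<lambda>i. d i x)"
    proof (rule summable_comparison_test'[where N = 0])
      fix i :: nat
      have "0 \<le> (2^i * norm (d i x) - 1/2)\<^sup>2 / 2^i" by simp
      also have "\<dots> = 2^i * (norm (d i x))\<^sup>2 - norm (d i x) + 1/4 * (1/2)^i"
        by (simp add: power2_eq_square field_simps)
      also have "\<dots> \<le> 2^i * (norm (d i x))\<^sup>2 - norm (d i x) + (1/2)^i" by simp
      finally show "norm (d i x) \<le> (1/2)^i + 2^i * (norm (d i x))\<^sup>2" by simp
    qed
    then have "convergent (\<lambda>n. \<Sum>i<n. d i x)" by (simp add: summable_iff_convergent)
    moreover have "(\<Sum>i<n. d i x) = F (k n) x - F (k 0) x" for n
      unfolding d_def by (rule sum_lessThan_telescope)
    ultimately have "convergent (\<lambda>n. F (k n) x - F (k 0) x)" by simp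
    then show ?thesis using convergent_add[OF _ convergent_const[of "F (k 0) x"]] by fastforce
  qed
  define f where "f x = lim (\<lambda>i. F (k i) x)" for x
  have fm[measurable]: "f \<in> borel_measurable M"
    unfolding f_def by (rule borel_measurable_lim_metric) simp
  have AElim: "AE x in M. (\<lambda>i. F (k i) x) \<longlonglongrightarrow> f x"
    using AEfin conv by (auto simp: f_def convergent_LIMSEQ_iff)
  have bound: "L2 M (\<lambda>x. F m x - f x) \<and> (\<integral>x. (norm (F m x - f x))\<^sup>2 \<partial>M) \<le> (1/4)^j" if "m \<ge> N j" for m j
  proof -
    have "(\<integral>\<^sup>+x. ennreal ((norm (F m x - f x))\<^sup>2) \<partial>M)
       = (\<integral>\<^sup>+x. liminf (\<lambda>i. ennreal ((norm (F m x - F (k i) x))\<^sup>2)) \<partial>M)"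
    proof (rule nn_integral_cong_AE)
      show "AE x in M. ennreal ((norm (F m x - f x))\<^sup>2) = liminf (\<lambda>i. ennreal ((norm (F m x - F (k i) x))\<^sup>2))"
        using AElim
      proof eventually_elim
        case (elim x)
        have "(\<lambda>i. ennreal ((norm (F m x - F (k i) x))\<^sup>2)) \<longlonglongrightarrow> ennreal ((norm (F m x - f x))\<^sup>2)"
          by (intro tendsto_intros elim)
        from lim_imp_Liminf[OF trivial_limit_sequentially this] show ?case ..
      qed
    qed
    also have "\<dots> \<le> liminf (\<lambda>i. \<integral>\<^sup>+x. ennreal ((norm (F m x - F (k i) x))\<^sup>2) \<partial>M)"
      by (rule nn_integral_liminf) simp
    also have "\<dots> \<le> limsup (\<lambda>i. \<integral>\<^sup>+x. ennreal ((norm (F m x - F (k i) x))\<^sup>2) \<partial>M)"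
      by (rule Liminf_le_Limsup) simp
    also have "\<dots> \<le> ennreal ((1/4)^j)"
    proof (rule Limsup_bounded, rule eventually_sequentiallyI[of "N j"])
      fix i assume "i \<ge> N j"
      then have "k i \<ge> N j" using seq_suble[OF kmono, of i] by simp
      then show "(\<integral>\<^sup>+x. ennreal ((norm (F m x - F (k i) x))\<^sup>2) \<partial>M) \<le> ennreal ((1/4)^j)"
        using N[of j m "k i"] that L2_integrable[OF Fd[of m "k i"]]
        by (subst nn_integral_eq_integral) (auto simp: ennreal_leI)
    qed
    finally have le: "(\<integral>\<^sup>+x. ennreal ((norm (F m x - f x))\<^sup>2) \<partial>M) \<le> ennreal ((1/4)^j)" .
    then have int: "integrable M (\<lambda>x. (norm (F m x - f x))\<^sup>2)"
      by (intro integrableI_nonneg) (auto simp: le_less_trans)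
    moreover have "(\<integral>x. (norm (F m x - f x))\<^sup>2 \<partial>M) \<le> (1/4)^j"
      using le int by (subst (asm) nn_integral_eq_integral) auto
    ultimately show ?thesis by (simp add: L2_def)
  qed
  have fL: "L2 M f"
    using L2_diff[OF F[of "N 0"] conjunct1[OF bound[of 0 "N 0"]]] by simp
  have "(\<lambda>m. \<integral>x. (norm (F m x - f x))\<^sup>2 \<partial>M) \<longlonglongrightarrow> 0"
  proof (rule LIMSEQ_I)
    fix r :: real assume "r > 0"
    then obtain j where j: "(1/4::real)^j < r" using real_arch_pow_inv[of r "1/4"] by auto
    show "\<exists>no. \<forall>n\<ge>no. norm ((\<integral>x. (norm (F n x - f x))\<^sup>2 \<partial>M) - 0) < r"
      using bound[of j] j by (intro exI[of _ "N j"]) (fastforce intro: le_less_trans)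
  qed
  then show ?thesis using fL L2_diff[OF F fL] by (auto simp: L2_converges_def)
qed

section \<open>Smooth functions and polynomials on three-space\<close>

lemma partial_deriv_eq: "(f has_derivative D) (at x) \<Longrightarrow> partial_deriv i f x = D (axis i 1)"
  by (simp add: partial_deriv_def frechet_derivative_at[symmetric])

lemma partial_deriv_add:
  assumes "f differentiable at x" "g differentiable at x"
  shows "partial_deriv i (\<lambda>x. f x + g x) x = partial_deriv i f x + partial_deriv i g x"
  using partial_deriv_eq[OF has_derivative_add] assms
  by (simp add: partial_deriv_def frechet_derivative_works)

lemma partial_deriv_linear:
  assumes "bounded_linear L" "f differentiable at x"
  shows "partial_deriv i (\<lambda>x. L (f x)) x = L (partial_deriv i f x)"
proof -
  have "((\<lambda>x. L (f x)) has_derivative (\<lambda>h. L (frechet_derivative f (at x) h))) (at x)"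
    by (rule bounded_linear.has_derivative[OF assms(1)]) (use assms(2) in \<open>simp add: frechet_derivative_works\<close>)
  from partial_deriv_eq[OF this] show ?thesis by (simp add: partial_deriv_def)
qed

lemma partial_deriv_mult:
  fixes f g :: "real^3 \<Rightarrow> 'a::real_normed_algebra"
  assumes "f differentiable at x" "g differentiable at x"
  shows "partial_deriv i (\<lambda>x. f x * g x) x = f x * partial_deriv i g x + partial_deriv i f x * g x"
proof -
  have "((\<lambda>x. f x * g x) has_derivative
      (\<lambda>h. f x * frechet_derivative g (at x) h + frechet_derivative f (at x) h * g x)) (at x)"
    by (rule has_derivative_mult) (use assms in \<open>simp_all add: frechet_derivative_works\<close>)
  from partial_deriv_eq[OF this] show ?thesis by (simp add: partial_deriv_def)
qed

lemma Ck_add: "Ck k f \<Longrightarrow> Ck k g \<Longrightarrow> Ck k (\<lambda>x. f x + g x)"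
proof (induction k arbitrary: f g)
  case (Suc k)
  then have "partial_deriv i (\<lambda>x. f x + g x) = (\<lambda>x. partial_deriv i f x + partial_deriv i g x)" for i
    by (auto simp: partial_deriv_add)
  then show ?case using Suc by auto
qed (auto intro: continuous_intros)

lemma Ck_linear: "bounded_linear L \<Longrightarrow> Ck k f \<Longrightarrow> Ck k (\<lambda>x. L (f x))"
proof (induction k arbitrary: f)
  case (Suc k)
  then have "partial_deriv i (\<lambda>x. L (f x)) = (\<lambda>x. L (partial_deriv i f x))" for i
    by (auto simp: partial_deriv_linear)
  moreover have "(\<lambda>x. L (f x)) differentiable at x" for x
    using Suc unfolding Ck.simps differentiable_def by (blast dest: bounded_linear.has_derivative)
  ultimately show ?case using Suc by auto
qed (auto intro: bounded_linear.continuous_on)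

lemma Ck_diff: "Ck k f \<Longrightarrow> Ck k g \<Longrightarrow> Ck k (\<lambda>x. f x - g x)"
  using Ck_add[of k f "\<lambda>x. - g x"] Ck_linear[OF bounded_linear_minus[OF bounded_linear_ident], of k g]
  by simp

lemma smooth_diff: "smooth f \<Longrightarrow> smooth g \<Longrightarrow> smooth (\<lambda>x. f x - g x)"
  by (simp add: smooth_def Ck_diff)

lemma smooth_linear: "bounded_linear L \<Longrightarrow> smooth f \<Longrightarrow> smooth (\<lambda>x. L (f x))"
  by (simp add: smooth_def Ck_linear)

lemma smooth_differentiable: "smooth f \<Longrightarrow> f differentiable at x"
  using smooth_def[of f] Ck.simps(2)[of 0 f] by blast

lemma smooth_continuous_partial: "smooth f \<Longrightarrow> continuous_on A (partial_deriv i f)"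
  using smooth_def[of f] Ck.simps(2)[of 0 f] Ck.simps(1)[of "partial_deriv i f"]
  by (blast intro: continuous_on_subset)

lemma smooth_continuous: "smooth f \<Longrightarrow> continuous_on A f"
  using smooth_def[of f] Ck.simps(1)[of f] by (blast intro: continuous_on_subset)

lemma partial_deriv_diff:
  assumes "f differentiable at x" "g differentiable at x"
  shows "partial_deriv i (\<lambda>x. f x - g x) x = partial_deriv i f x - partial_deriv i g x"
  using partial_deriv_eq[OF has_derivative_diff] assms
  by (simp add: partial_deriv_def frechet_derivative_works)

lemma partial_deriv_const [simp]: "partial_deriv i (\<lambda>_. c) = (\<lambda>_. 0)"
  by (simp add: partial_deriv_def fun_eq_iff)

lemma partial_deriv_component: "partial_deriv i (\<lambda>x. x $ j) x = (if i = j then 1 else 0)"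
proof -
  have "((\<lambda>x::real^3. x $ j) has_derivative (\<lambda>h. h $ j)) (at x)"
    by (rule bounded_linear_imp_has_derivative) (rule bounded_linear_vec_nth)
  from partial_deriv_eq[OF this] show ?thesis by (auto simp: axis_def)
qed

lemma component_differentiable: "(\<lambda>x::real^3. x $ j) differentiable at x"
  by (rule bounded_linear_imp_differentiable) (rule bounded_linear_vec_nth)

text \<open>Complex polynomials in the three coordinates, given by closure rules instead of
  coefficients: the class is visibly closed under partial derivatives, so smoothness follows by
  induction on the order.\<close>

inductive poly3 :: "(real^3 \<Rightarrow> complex) \<Rightarrow> bool" where
  const: "poly3 (\<lambda>_. c)"
| coord: "poly3 (\<lambda>x. of_real (x $ i))"
| add: "poly3 f \<Longrightarrow> poly3 g \<Longrightarrow> poly3 (\<lambda>x. f x + g x)"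
| mult: "poly3 f \<Longrightarrow> poly3 g \<Longrightarrow> poly3 (\<lambda>x. f x * g x)"

lemma partial_deriv_coord: "partial_deriv i (\<lambda>x. of_real (x $ j) :: complex) x = (if i = j then 1 else 0)"
  by (subst partial_deriv_linear[OF bounded_linear_of_real component_differentiable])
     (simp add: partial_deriv_component)

lemma poly3_differentiable: "poly3 f \<Longrightarrow> f differentiable at x"
proof (induction rule: poly3.induct)
  case (coord i)
  then show ?case
    by (rule bounded_linear_imp_differentiable)
       (rule bounded_linear_compose[OF bounded_linear_of_real bounded_linear_vec_nth])
qed auto

lemma poly3_partial_deriv: "poly3 f \<Longrightarrow> poly3 (partial_deriv i f)"
proof (induction rule: poly3.induct)
  case (coord j)
  have "partial_deriv i (\<lambda>x. of_real (x $ j) :: complex) = (\<lambda>x. if i = j then 1 else 0)"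
    by (simp add: fun_eq_iff partial_deriv_coord)
  then show ?case by (simp add: poly3.const)
next
  case (add f g)
  then have "partial_deriv i (\<lambda>x. f x + g x) = (\<lambda>x. partial_deriv i f x + partial_deriv i g x)"
    by (simp add: fun_eq_iff partial_deriv_add poly3_differentiable)
  then show ?case using add by (simp add: poly3.add)
next
  case (mult f g)
  then have "partial_deriv i (\<lambda>x. f x * g x) = (\<lambda>x. f x * partial_deriv i g x + partial_deriv i f x * g x)"
    by (simp add: fun_eq_iff partial_deriv_mult poly3_differentiable)
  then show ?case using mult by (simp add: poly3.add poly3.mult)
qed (simp add: poly3.const)

lemma poly3_Ck: "poly3 f \<Longrightarrow> Ck k f"
proof (induction k arbitrary: f)
  case 0
  then show ?case
    by (simp add: continuous_at_imp_continuous_on differentiable_imp_continuous_within poly3_differentiable)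
qed (simp add: poly3_differentiable poly3_partial_deriv)

lemma poly3_smooth: "poly3 f \<Longrightarrow> smooth f"
  by (simp add: smooth_def poly3_Ck)

lemma poly3_power: "poly3 f \<Longrightarrow> poly3 (\<lambda>x. f x ^ n)"
  by (induction n) (auto intro: poly3.intros)

lemma poly3_sum: "(\<And>i. i \<in> A \<Longrightarrow> poly3 (f i)) \<Longrightarrow> poly3 (\<lambda>x. \<Sum>i\<in>A. f i x)"
  by (induction A rule: infinite_finite_induct) (auto intro: poly3.intros)

lemma partial_deriv_power:
  fixes f :: "real^3 \<Rightarrow> 'a::{real_normed_field}"
  assumes "f differentiable at x"
  shows "partial_deriv i (\<lambda>x. f x ^ n) x = of_nat n * f x ^ (n - 1) * partial_deriv i f x"
proof -
  have "((\<lambda>x. f x ^ n) has_derivative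
      (\<lambda>h. of_nat n * frechet_derivative f (at x) h * f x ^ (n - 1))) (at x)"
    by (rule has_derivative_power) (use assms in \<open>simp_all add: frechet_derivative_works\<close>)
  from partial_deriv_eq[OF this] show ?thesis by (simp add: partial_deriv_def)
qed

lemma partial_deriv_sum:
  assumes "finite A" "\<And>j. j \<in> A \<Longrightarrow> f j differentiable at x"
  shows "partial_deriv i (\<lambda>x. \<Sum>j\<in>A. f j x) x = (\<Sum>j\<in>A. partial_deriv i (f j) x)"
  using assms
proof (induction rule: finite_induct)
  case (insert a A)
  then show ?case by (simp add: partial_deriv_add)
qed simp

section \<open>Polar coordinates\<close>

abbreviation sphere_space :: "(real^3) measure" where
  "sphere_space \<equiv> restrict_space borel (sphere 0 1)"

abbreviation punctured_ball :: "(real^3) measure" where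
  "punctured_ball \<equiv> restrict_space lborel (unit_ball - {0})"

lemma measurable_normalize: "(\<lambda>x. x /\<^sub>R norm x) \<in> punctured_ball \<rightarrow>\<^sub>M sphere_space"
  by (rule measurable_restrict_space2) (auto simp: space_restrict_space intro!: measurable_restrict_space1)

lemma sets_surface_measure [measurable_cong]: "sets surface_measure = sets sphere_space"
  by (simp add: surface_measure_def)

lemma space_surface_measure: "space surface_measure = sphere 0 1"
  by (simp add: surface_measure_def space_scale_measure space_restrict_space)

lemma emeasure_surface_measure:
  assumes "E \<in> sets sphere_space"
  shows "emeasure surface_measure E = 3 * emeasure lborel {x \<in> unit_ball - {0}. x /\<^sub>R norm x \<in> E}"
proof -
  have "emeasure surface_measure E = 3 * emeasure punctured_ball ((\<lambda>x. x /\<^sub>R norm x) -` E \<inter> space punctured_ball)"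
    unfolding surface_measure_def using assms measurable_normalize by (simp add: emeasure_distr)
  also have "(\<lambda>x. x /\<^sub>R norm x) -` E \<inter> space punctured_ball = {x \<in> unit_ball - {0}. x /\<^sub>R norm x \<in> E}"
    by (auto simp: space_restrict_space)
  also have "emeasure punctured_ball \<dots> = emeasure lborel \<dots>"
    by (rule emeasure_restrict_space) auto
  finally show ?thesis .
qed

lemma finite_surface_measure: "finite_measure surface_measure"
proof
  have "emeasure lborel {x::real^3 \<in> unit_ball - {0}. x /\<^sub>R norm x \<in> sphere 0 1} \<le> emeasure lborel unit_ball"
    by (intro emeasure_mono) auto
  also have "\<dots> < \<infinity>" by (rule emeasure_lborel_ball_finite)
  finally show "emeasure surface_measure (space surface_measure) \<noteq> \<infinity>"
    unfolding space_surface_measure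
    by (subst emeasure_surface_measure) (auto simp: sets_restrict_space_iff ennreal_mult_eq_top_iff)
qed

lemma emeasure_lborel_scale:
  fixes A :: "(real^3) set"
  assumes "t > 0" "A \<in> sets borel"
  shows "emeasure lborel {x. x /\<^sub>R t \<in> A} = ennreal (t ^ 3) * emeasure lborel A"
proof -
  have "emeasure lborel {x::real^3. x /\<^sub>R t \<in> A}
      = emeasure (density (distr lborel borel (\<lambda>x. 0 + t *\<^sub>R x)) (\<lambda>_. \<bar>t\<bar> ^ DIM(real^3))) {x. x /\<^sub>R t \<in> A}"
    using lborel_affine[of t "0::real^3"] assms by simp
  also have "\<dots> = ennreal (t^3) * emeasure (distr lborel borel (\<lambda>x::real^3. 0 + t *\<^sub>R x)) {x. x /\<^sub>R t \<in> A}"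
    using assms by (subst emeasure_density_const) auto
  also have "emeasure (distr lborel borel (\<lambda>x::real^3. 0 + t *\<^sub>R x)) {x. x /\<^sub>R t \<in> A} = emeasure lborel A"
    using assms by (subst emeasure_distr) (auto intro!: arg_cong[where f = "emeasure lborel"])
  finally show ?thesis .
qed

text \<open>The truncated cone is the dilate by \<open>t\<close> of the full cone, whose volume is
  by definition a third of the surface measure of \<open>E\<close>. The factor t^3 / 3 is the
  integral of r^2 over (0, t).\<close>

lemma emeasure_cone:
  assumes E: "E \<in> sets sphere_space" and t: "0 < t" "t \<le> 1"
  shows "emeasure lborel {x \<in> unit_ball - {0}. norm x < t \<and> x /\<^sub>R norm x \<in> E}
     = emeasure surface_measure E * ennreal (t^3 / 3)"
proof -
  let ?A = "{x \<in> unit_ball - {0}. x /\<^sub>R norm x \<in> E}"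
  have "?A \<in> sets lborel"
    using measurable_sets[OF measurable_normalize E]
    by (auto simp: sets_restrict_space_iff space_restrict_space vimage_def Int_def conj_commute)
  then have A: "?A \<in> sets borel" by simp
  have "{x \<in> unit_ball - {0}. norm x < t \<and> x /\<^sub>R norm x \<in> E} = {x. x /\<^sub>R t \<in> ?A}"
    using t by (auto simp: field_simps)
  moreover have "ennreal (t^3) = 3 * ennreal (t^3 / 3)"
    using t ennreal_mult[of 3 "t^3/3"] by simp
  ultimately show ?thesis
    using emeasure_lborel_scale[OF t(1) A] by (simp add: emeasure_surface_measure[OF E] ac_simps)
qed

text \<open>Used to identify the distribution of the norm on a cone, which is computed on half-lines
  only.\<close>

lemma measure_eqI_Iio:
  fixes M N :: "real measure"
  assumes sets: "sets M = sets borel" "sets N = sets borel"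
    and fin: "\<And>x. emeasure M {..<x} < \<infinity>"
    and eq: "\<And>x. emeasure M {..<x} = emeasure N {..<x}"
  shows "M = N"
proof (rule measure_eqI_generator_eq_countable)
  let ?E = "range (lessThan :: real \<Rightarrow> real set)"
  show "Int_stable ?E"
    by (auto simp: Int_stable_def lessThan_def Int_def min_less_iff_conj[symmetric] simp del: min_less_iff_conj)
  show "?E \<subseteq> Pow UNIV" "sets M = sigma_sets UNIV ?E" "sets N = sigma_sets UNIV ?E"
    unfolding sets borel_Iio by auto
  show "lessThan ` \<rat> \<subseteq> ?E" "(\<Union>i\<in>\<rat>. {..<i}) = (UNIV :: real set)"
    "\<And>a. a \<in> lessThan ` \<rat> \<Longrightarrow> emeasure M a \<noteq> \<infinity>"
    using fin by (auto intro: Rats_no_top_le simp: less_top)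
       (metis Rats_of_nat reals_Archimedean2)
qed (auto intro: eq countable_rat)

text \<open>The factor r^2 dr of Lebesgue measure in polar coordinates. As a density on the whole
  line it has all Borel sets as its sets, with no restriction to (0, 1).\<close>

definition radial_measure :: "real measure" where
  "radial_measure = density lborel (\<lambda>r. ennreal (indicator {0<..<1} r * r\<^sup>2))"

lemma sets_radial_measure [measurable_cong, simp]: "sets radial_measure = sets borel"
  by (simp add: radial_measure_def)

lemma emeasure_radial_measure_lessThan:
  "emeasure radial_measure {..<t} = ennreal ((min 1 (max 0 t))^3 / 3)"
proof -
  let ?t = "min 1 (max 0 t)"
  have "emeasure radial_measure {..<t} = (\<integral>\<^sup>+r. ennreal (indicator {0<..<1} r * r\<^sup>2) * indicator {..<t} r \<partial>lborel)"
    unfolding radial_measure_def by (rule emeasure_density) auto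
  also have "\<dots> = (\<integral>\<^sup>+r. ennreal (r\<^sup>2) * indicator {0..?t} r \<partial>lborel)"
  proof (rule nn_integral_cong_AE)
    have "AE r in lborel. r \<noteq> 0 \<and> r \<noteq> 1 \<and> r \<noteq> t"
      by (intro AE_conjI AE_lborel_singleton)
    then show "AE r in lborel. ennreal (indicator {0<..<1} r * r\<^sup>2) * indicator {..<t} r
        = ennreal (r\<^sup>2) * indicator {0..?t} r"
      by eventually_elim (auto simp: indicator_def)
  qed
  also have "\<dots> = ennreal (?t^3 / 3 - 0^3 / 3)"
    by (rule nn_integral_FTC_Icc) (auto intro!: derivative_eq_intros)
  finally show ?thesis by simp
qed

lemma finite_radial_measure: "finite_measure radial_measure"
proof
  have "emeasure radial_measure UNIV = emeasure radial_measure (\<Union>n. {..<real n})"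
    by (rule arg_cong[where f = "emeasure _"]) (use reals_Archimedean2 in auto)
  also have "\<dots> = (SUP n. emeasure radial_measure {..<real n})"
    by (rule SUP_emeasure_incseq[symmetric]) (auto simp: incseq_def)
  also have "\<dots> \<le> 1"
  proof (rule SUP_least)
    show "emeasure radial_measure {..<real n} \<le> 1" for n
      using power_le_one[of "min 1 (real n)" 3] by (auto simp: emeasure_radial_measure_lessThan)
  qed
  finally show "emeasure radial_measure (space radial_measure) \<noteq> \<infinity>"
    by (simp add: radial_measure_def) (metis ennreal_one_less_top le_less_trans less_irrefl)
qed

lemma measurable_polar: "(\<lambda>x. (norm x, x /\<^sub>R norm x)) \<in> punctured_ball \<rightarrow>\<^sub>M radial_measure \<Otimes>\<^sub>M surface_measure"
proof (rule measurable_Pair)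
  show "norm \<in> punctured_ball \<rightarrow>\<^sub>M radial_measure"
    by (simp add: measurable_cong_sets[OF refl sets_radial_measure] measurable_restrict_space1)
  show "(\<lambda>x. x /\<^sub>R norm x) \<in> punctured_ball \<rightarrow>\<^sub>M surface_measure"
    using measurable_normalize by (simp add: measurable_cong_sets[OF refl sets_surface_measure])
qed

text \<open>Both sides are compared on rectangles \<open>A \<times> E\<close>. For fixed
  \<open>E\<close> the two resulting measures in \<open>A\<close> agree on half-lines by the volume
  of cones, hence everywhere. The origin is removed because it has no direction.\<close>

lemma polar_product: "radial_measure \<Otimes>\<^sub>M surface_measure
    = distr punctured_ball (radial_measure \<Otimes>\<^sub>M surface_measure) (\<lambda>x. (norm x, x /\<^sub>R norm x))"
proof (rule pair_measure_eqI)
  interpret R: finite_measure radial_measure by (rule finite_radial_measure)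
  interpret S: finite_measure surface_measure by (rule finite_surface_measure)
  show "sigma_finite_measure radial_measure" "sigma_finite_measure surface_measure" by unfold_locales
  fix A E assume A: "A \<in> sets radial_measure" and E: "E \<in> sets surface_measure"
  have E': "E \<in> sets sphere_space" using E by (simp add: sets_surface_measure)
  \<comment> \<open>Lebesgue measure on the full cone over \<open>E\<close>; its image under
    \<open>norm\<close> has to be the radial measure times the surface measure of
    \<open>E\<close>.\<close>
  define P where "P = restrict_space punctured_ball {x \<in> unit_ball - {0}. x /\<^sub>R norm x \<in> E}"
  have PE: "{x \<in> unit_ball - {0}. x /\<^sub>R norm x \<in> E} \<in> sets punctured_ball"
    using measurable_sets[OF measurable_normalize E']
    by (auto simp: space_restrict_space vimage_def Int_def conj_commute)
  have eP: "emeasure P B = emeasure lborel B" if "B \<subseteq> {x \<in> unit_ball - {0}. x /\<^sub>R norm x \<in> E}" for B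
  proof -
    have "{x \<in> unit_ball - {0}. x /\<^sub>R norm x \<in> E} \<inter> space punctured_ball \<in> sets punctured_ball"
      unfolding sets.Int_space_eq2[OF PE] by (rule PE)
    then have "emeasure P B = emeasure punctured_ball B"
      unfolding P_def using that by (rule emeasure_restrict_space)
    also have "\<dots> = emeasure lborel B"
      using that by (intro emeasure_restrict_space) auto
    finally show ?thesis .
  qed
  have nm: "norm \<in> P \<rightarrow>\<^sub>M borel" unfolding P_def by (intro measurable_restrict_space1) simp
  have sP: "space P = {x \<in> unit_ball - {0}. x /\<^sub>R norm x \<in> E}"
    by (auto simp: P_def space_restrict_space)
  have *: "emeasure (distr P borel norm) {..<t} = emeasure lborel {x \<in> unit_ball - {0}. norm x < t \<and> x /\<^sub>R norm x \<in> E}" for t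
    using nm by (subst emeasure_distr) (auto simp: sP intro!: eP[THEN trans] arg_cong[where f = "emeasure lborel"])
  have eq: "distr P borel norm = scale_measure (emeasure surface_measure E) radial_measure"
  proof (rule measure_eqI_Iio)
    have le: "emeasure (distr P borel norm) {..<t} = emeasure surface_measure E * ennreal ((min 1 (max 0 t))^3 / 3)" for t
    proof (cases "t \<le> 0")
      case True
      then have "{x \<in> unit_ball - {0::real^3}. norm x < t \<and> x /\<^sub>R norm x \<in> E} = {}"
        by (auto simp: not_less intro: order_trans[OF _ norm_ge_zero])
      then have "emeasure (distr P borel norm) {..<t} = 0" unfolding * by (simp only: emeasure_empty)
      with True show ?thesis by simp
    next
      case False
      have "{x \<in> unit_ball - {0::real^3}. norm x < t \<and> x /\<^sub>R norm x \<in> E}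
         = {x \<in> unit_ball - {0::real^3}. norm x < min 1 (max 0 t) \<and> x /\<^sub>R norm x \<in> E}"
        using False by auto
      then show ?thesis unfolding * using emeasure_cone[OF E', of "min 1 (max 0 t)"] False by simp
    qed
    show "emeasure (distr P borel norm) {..<t} = emeasure (scale_measure (emeasure surface_measure E) radial_measure) {..<t}" for t
      unfolding le by (simp add: emeasure_radial_measure_lessThan)
    show "emeasure (distr P borel norm) {..<t} < \<infinity>" for t
      unfolding le using S.emeasure_finite[of E] by (simp add: ennreal_mult_eq_top_iff less_top[symmetric])
  qed simp_all
  have "emeasure (distr punctured_ball (radial_measure \<Otimes>\<^sub>M surface_measure) (\<lambda>x. (norm x, x /\<^sub>R norm x))) (A \<times> E)
      = emeasure punctured_ball ((\<lambda>x. (norm x, x /\<^sub>R norm x)) -` (A \<times> E) \<inter> space punctured_ball)"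
    using A E by (intro emeasure_distr measurable_polar) auto
  also have "\<dots> = emeasure lborel {x \<in> unit_ball - {0}. norm x \<in> A \<and> x /\<^sub>R norm x \<in> E}"
    by (subst emeasure_restrict_space) (auto simp: space_restrict_space intro!: arg_cong[where f = "emeasure lborel"])
  also have "\<dots> = emeasure P (norm -` A \<inter> space P)"
    by (subst eP) (auto simp: sP intro!: arg_cong[where f = "emeasure lborel"])
  also have "\<dots> = emeasure (distr P borel norm) A"
    using nm A by (subst emeasure_distr) auto
  finally show "emeasure radial_measure A * emeasure surface_measure E
      = emeasure (distr punctured_ball (radial_measure \<Otimes>\<^sub>M surface_measure) (\<lambda>x. (norm x, x /\<^sub>R norm x))) (A \<times> E)"
    unfolding eq by (simp add: ac_simps)
qed simp

lemma pair_sigma_finite_polar: "pair_sigma_finite radial_measure surface_measure"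
  using finite_radial_measure finite_surface_measure
  by (intro pair_sigma_finite.intro finite_measure.axioms) (auto simp: finite_measure_def)

lemma measurable_polar_coordinates:
  "(\<lambda>(r, \<omega>). r *\<^sub>R \<omega>) \<in> radial_measure \<Otimes>\<^sub>M surface_measure \<rightarrow>\<^sub>M (borel :: (real^3) measure)"
proof -
  have [measurable]: "(\<lambda>x. x) \<in> surface_measure \<rightarrow>\<^sub>M (borel :: (real^3) measure)"
    by (simp add: measurable_cong_sets[OF sets_surface_measure refl] measurable_restrict_space1)
  show ?thesis by measurable
qed

text \<open>Norms and energies are integrals for completed Lebesgue measure on the ball, whereas
  polar coordinates use Borel measure without the origin. For Borel integrands neither the
  completion nor a single point makes a difference.\<close>

lemma punctured_ball_integral:
  fixes f :: "real^3 \<Rightarrow> 'b::{banach, second_countable_topology}"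
  assumes "f \<in> borel_measurable borel"
  shows "integrable punctured_ball f \<longleftrightarrow> integrable ball_measure f"
    and "integral\<^sup>L punctured_ball f = integral\<^sup>L ball_measure f"
proof -
  have ms: "(\<lambda>x. indicator A x *\<^sub>R f x) \<in> borel_measurable lborel" if "A \<in> sets borel" for A
    using assms that by simp
  have AE: "AE x in lborel. indicator (unit_ball - {0::real^3}) x *\<^sub>R f x = indicator unit_ball x *\<^sub>R f x"
    using AE_lborel_singleton[of "0::real^3"] by eventually_elim (auto simp: indicator_def)
  have "integrable punctured_ball f \<longleftrightarrow> integrable lborel (\<lambda>x. indicator (unit_ball - {0}) x *\<^sub>R f x)"
    by (rule integrable_restrict_space) auto
  also have "\<dots> \<longleftrightarrow> integrable lborel (\<lambda>x. indicator unit_ball x *\<^sub>R f x)"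
    by (intro integrable_cong_AE[OF ms ms AE]) simp_all
  also have "\<dots> \<longleftrightarrow> integrable lebesgue (\<lambda>x. indicator unit_ball x *\<^sub>R f x)"
    using ms[of unit_ball] by (intro integrable_completion[symmetric]) auto
  also have "\<dots> \<longleftrightarrow> integrable ball_measure f"
    by (rule integrable_restrict_space[symmetric]) auto
  finally show "integrable punctured_ball f \<longleftrightarrow> integrable ball_measure f" .
  have "integral\<^sup>L punctured_ball f = (\<integral>x. indicator (unit_ball - {0}) x *\<^sub>R f x \<partial>lborel)"
    by (rule integral_restrict_space) auto
  also have "\<dots> = (\<integral>x. indicator unit_ball x *\<^sub>R f x \<partial>lborel)"
    by (intro integral_cong_AE ms AE) auto
  also have "\<dots> = (\<integral>x. indicator unit_ball x *\<^sub>R f x \<partial>lebesgue)"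
    using ms[of unit_ball] by (intro integral_completion[symmetric]) auto
  also have "\<dots> = integral\<^sup>L ball_measure f"
    by (rule integral_restrict_space[symmetric]) auto
  finally show "integral\<^sup>L punctured_ball f = integral\<^sup>L ball_measure f" .
qed

lemma polar_integral:
  fixes f :: "real^3 \<Rightarrow> 'b::{banach, second_countable_topology}"
  assumes m: "f \<in> borel_measurable borel" and int: "integrable ball_measure f"
  shows "(\<integral>x. f x \<partial>ball_measure) = (\<integral>r. \<integral>\<omega>. f (r *\<^sub>R \<omega>) \<partial>surface_measure \<partial>radial_measure)"
    and "integrable radial_measure (\<lambda>r. \<integral>\<omega>. f (r *\<^sub>R \<omega>) \<partial>surface_measure)"
proof -
  interpret pair_sigma_finite radial_measure surface_measure by (rule pair_sigma_finite_polar)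
  let ?g = "\<lambda>(r, \<omega>). f (r *\<^sub>R \<omega>)"
  have g: "?g \<in> borel_measurable (radial_measure \<Otimes>\<^sub>M surface_measure)"
    using measurable_compose[OF measurable_polar_coordinates m] by (simp add: case_prod_beta)
  have eq: "?g (norm x, x /\<^sub>R norm x) = f x" if "x \<in> space punctured_ball" for x
    using that by (simp add: space_restrict_space)
  have "integrable punctured_ball (\<lambda>x. ?g (norm x, x /\<^sub>R norm x))"
    using int punctured_ball_integral(1)[OF m] by (subst Bochner_Integration.integrable_cong[OF refl eq]) auto
  then have ig: "integrable (radial_measure \<Otimes>\<^sub>M surface_measure) ?g"
    by (subst polar_product, subst integrable_distr_eq) (use measurable_polar g in auto)
  have "(\<integral>x. f x \<partial>ball_measure) = (\<integral>x. ?g (norm x, x /\<^sub>R norm x) \<partial>punctured_ball)"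
    unfolding punctured_ball_integral(2)[OF m, symmetric]
    by (intro Bochner_Integration.integral_cong[OF refl] eq[symmetric])
  also have "\<dots> = integral\<^sup>L (radial_measure \<Otimes>\<^sub>M surface_measure) ?g"
    by (subst integral_distr[symmetric, OF measurable_polar g]) (simp flip: polar_product)
  also have "\<dots> = (\<integral>r. \<integral>\<omega>. f (r *\<^sub>R \<omega>) \<partial>surface_measure \<partial>radial_measure)"
    using integral_fst'[OF ig] by simp
  finally show "(\<integral>x. f x \<partial>ball_measure) = (\<integral>r. \<integral>\<omega>. f (r *\<^sub>R \<omega>) \<partial>surface_measure \<partial>radial_measure)" .
  show "integrable radial_measure (\<lambda>r. \<integral>\<omega>. f (r *\<^sub>R \<omega>) \<partial>surface_measure)"
    using integrable_fst'[OF ig] by simp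
qed

section \<open>Null sets in polar coordinates\<close>

lemma AE_surface_imp_AE_ball:
  assumes "AE \<omega> in surface_measure. P \<omega>"
  shows "AE x in lborel. x \<in> unit_ball - {0} \<longrightarrow> P (x /\<^sub>R norm x)"
proof -
  obtain N where N: "N \<in> sets surface_measure" "emeasure surface_measure N = 0"
    "{\<omega> \<in> space surface_measure. \<not> P \<omega>} \<subseteq> N" using assms by (auto elim!: AE_E)
  then have N': "N \<in> sets sphere_space" by (simp add: sets_surface_measure)
  let ?A = "{x \<in> unit_ball - {0}. x /\<^sub>R norm x \<in> N}"
  have "?A \<in> sets lborel"
    using measurable_sets[OF measurable_normalize N']
    by (auto simp: sets_restrict_space_iff space_restrict_space vimage_def Int_def conj_commute)
  moreover have "emeasure lborel ?A = 0" using N emeasure_surface_measure[OF N'] by simp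
  ultimately have "?A \<in> null_sets lborel" by blast
  then show ?thesis
    by (rule AE_I') (use N in \<open>auto simp: space_surface_measure\<close>)
qed

lemma AE_polar:
  assumes m: "Measurable.pred borel P" and "AE x in lborel. x \<in> unit_ball \<longrightarrow> P x"
  shows "AE r in radial_measure. AE \<omega> in surface_measure. P (r *\<^sub>R \<omega>)"
proof -
  interpret pair_sigma_finite radial_measure surface_measure by (rule pair_sigma_finite_polar)
  have pm: "Measurable.pred (radial_measure \<Otimes>\<^sub>M surface_measure) (\<lambda>(r, \<omega>). P (r *\<^sub>R \<omega>))"
    using measurable_compose[OF measurable_polar_coordinates m] by (simp add: case_prod_beta)
  have "AE x in punctured_ball. P x"
    using assms(2) by (subst AE_restrict_space_iff) (auto elim!: eventually_mono)
  then have "AE x in punctured_ball. case (norm x, x /\<^sub>R norm x) of (r, \<omega>) \<Rightarrow> P (r *\<^sub>R \<omega>)"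
    using AE_space by eventually_elim (simp add: space_restrict_space)
  then have "AE x in radial_measure \<Otimes>\<^sub>M surface_measure. case x of (r, \<omega>) \<Rightarrow> P (r *\<^sub>R \<omega>)"
    by (subst polar_product, subst AE_distr_iff) (use measurable_polar pm in \<open>auto simp: pred_def\<close>)
  from AE_pair[OF this] show ?thesis by simp
qed

text \<open>A null set of radii times the sphere is null, and polar coordinates pull it back to a
  null set. \<open>P\<close> will be a statement about almost all points of the sphere of radius
  \<open>r\<close>, so an explicit null set containing its exceptions is taken.\<close>

lemma AE_radial_imp_AE_ball:
  assumes "AE r in radial_measure. P r"
  shows "AE x in lborel. x \<in> unit_ball - {0::real^3} \<longrightarrow> P (norm x)"
proof -
  interpret pair_sigma_finite radial_measure surface_measure by (rule pair_sigma_finite_polar)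
  obtain N where N: "N \<in> null_sets radial_measure" "{r. \<not> P r} \<subseteq> N"
    using assms by (auto elim!: AE_E simp: radial_measure_def null_sets_def)
  have "N \<times> space surface_measure \<in> null_sets (radial_measure \<Otimes>\<^sub>M surface_measure)"
    using N M2.emeasure_pair_measure_Times[of N radial_measure "space surface_measure"] by (auto simp: null_sets_def)
  then have "AE x in radial_measure \<Otimes>\<^sub>M surface_measure. x \<notin> N \<times> space surface_measure"
    by (rule AE_not_in)
  then have "AE x in punctured_ball. (norm x, x /\<^sub>R norm x) \<notin> N \<times> space surface_measure"
    by (subst (asm) polar_product, intro AE_distrD[OF measurable_polar])
  then have "AE x in punctured_ball. P (norm x)"
    using AE_space by eventually_elim (use N in \<open>auto simp: space_surface_measure space_restrict_space\<close>)
  then show ?thesis by (subst (asm) AE_restrict_space_iff) auto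
qed

section \<open>Traces\<close>

lemma continuous_integrable_ball:
  fixes f :: "real^3 \<Rightarrow> 'b::euclidean_space"
  assumes "continuous_on UNIV f"
  shows "integrable ball_measure f"
proof -
  interpret finite_measure ball_measure
    by (rule finite_measure_lebesgue_on) (rule lmeasurable_ball)
  have "bounded (f ` cball 0 1)"
    by (intro compact_imp_bounded compact_continuous_image continuous_on_subset[OF assms]) auto
  then obtain B where B: "\<forall>x \<in> cball 0 1. norm (f x) \<le> B" by (auto simp: bounded_iff)
  have "f \<in> borel_measurable ball_measure"
    by (intro continuous_imp_measurable_on_sets_lebesgue continuous_on_subset[OF assms]) auto
  then show ?thesis
    using B by (intro integrable_const_bound[where B = B] AE_I2) (auto simp: space_restrict_space)
qed

lemma continuous_integrable_surface:
  fixes f :: "real^3 \<Rightarrow> 'b::euclidean_space"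
  assumes "continuous_on UNIV f"
  shows "integrable surface_measure f"
proof -
  interpret finite_measure surface_measure by (rule finite_surface_measure)
  have "bounded (f ` sphere 0 1)"
    by (intro compact_imp_bounded compact_continuous_image continuous_on_subset[OF assms]) auto
  then obtain B where B: "\<forall>x \<in> sphere 0 1. norm (f x) \<le> B" by (auto simp: bounded_iff)
  have "f \<in> borel_measurable surface_measure"
    using borel_measurable_continuous_onI[OF assms]
    by (simp add: measurable_cong_sets[OF sets_surface_measure refl] measurable_restrict_space1)
  then show ?thesis
    using B by (intro integrable_const_bound[where B = B] AE_I2) (auto simp: space_surface_measure)
qed

lemma continuous_L2:
  fixes f :: "real^3 \<Rightarrow> 'b::euclidean_space"
  assumes "continuous_on UNIV f"
  shows continuous_L2_ball: "L2 ball_measure f" and continuous_L2_surface: "L2 surface_measure f"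
proof -
  have c: "continuous_on UNIV (\<lambda>x. (norm (f x))\<^sup>2)" by (intro continuous_intros assms)
  show "L2 ball_measure f" "L2 surface_measure f"
    unfolding L2_def
    using continuous_integrable_ball[OF assms] continuous_integrable_ball[OF c]
      continuous_integrable_surface[OF assms] continuous_integrable_surface[OF c] by auto
qed

section \<open>Weak derivatives of smooth functions\<close>

lemma has_vector_derivative_partial:
  assumes "f differentiable at (x + s *\<^sub>R axis i 1)"
  shows "((\<lambda>s. f (x + s *\<^sub>R axis i 1)) has_vector_derivative partial_deriv i f (x + s *\<^sub>R axis i 1)) (at s within S)"
proof -
  have "((\<lambda>s. x + s *\<^sub>R axis i 1) has_derivative (\<lambda>t. t *\<^sub>R axis i 1)) (at s within S)"
    by (auto intro!: derivative_eq_intros)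
  from has_derivative_compose[OF this] assms
  have "((\<lambda>s. f (x + s *\<^sub>R axis i 1)) has_derivative
      (\<lambda>t. frechet_derivative f (at (x + s *\<^sub>R axis i 1)) (t *\<^sub>R axis i 1))) (at s within S)"
    by (simp add: frechet_derivative_works)
  moreover have "frechet_derivative f (at (x + s *\<^sub>R axis i 1)) (t *\<^sub>R axis i 1)
      = t *\<^sub>R partial_deriv i f (x + s *\<^sub>R axis i 1)" for t
    using linear_scale[OF linear_frechet_derivative[OF assms]] by (simp add: partial_deriv_def)
  ultimately show ?thesis by (simp add: has_vector_derivative_def)
qed

text \<open>Translation invariance of Lebesgue measure makes the integral of every difference quotient vanish.\<close>
lemma integral_partial_deriv_zero:
  fixes h :: "real^3 \<Rightarrow> 'b::euclidean_space"
  assumes diff: "\<And>x. h differentiable at x" and cont: "continuous_on UNIV (partial_deriv i h)"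
    and supp: "\<And>x. norm x \<ge> R \<Longrightarrow> h x = 0"
  shows "(\<integral>x. partial_deriv i h x \<partial>lborel) = 0"
proof -
  let ?e = "axis i 1 :: real^3"
  define R' where "R' = max R 0"
  have conth: "continuous_on UNIV h"
    by (simp add: continuous_at_imp_continuous_on differentiable_imp_continuous_within diff)
  have m[measurable]: "h \<in> borel_measurable borel" "partial_deriv i h \<in> borel_measurable borel"
    using conth cont by (auto intro: borel_measurable_continuous_onI)
  \<comment> \<open>With steps of length at most 1, difference quotients vanish outside radius
    \<open>R' + 1\<close>, and the mean value bound inside it sees derivatives up to radius
    \<open>R' + 2\<close>.\<close>
  have "bounded (partial_deriv i h ` cball 0 (R' + 2))"
    by (intro compact_imp_bounded compact_continuous_image continuous_on_subset[OF cont]) auto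
  then obtain K where "\<forall>x \<in> cball 0 (R' + 2). norm (partial_deriv i h x) \<le> K"
    by (auto simp: bounded_iff)
  then have K: "norm (partial_deriv i h x) \<le> K" if "norm x \<le> R' + 2" for x
    using that by simp
  define q where "q n x = real (Suc n) *\<^sub>R (h (x + (1 / real (Suc n)) *\<^sub>R ?e) - h x)" for n x
  have bound: "norm (q n x) \<le> K * indicator (cball 0 (R' + 1)) x" for n x
  proof (cases "norm x \<le> R' + 1")
    case True
    have n1: "norm (x + s *\<^sub>R ?e) \<le> R' + 2" if "0 \<le> s" "s \<le> 1" for s
      using norm_triangle_ineq[of x "s *\<^sub>R ?e"] that True by simp
    have "norm (h (x + (1 / real (Suc n)) *\<^sub>R ?e) - h (x + 0 *\<^sub>R ?e)) \<le> K * norm (1 / real (Suc n) - 0)"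
    proof (rule differentiable_bound[where S = "{0..1}" and f = "\<lambda>s. h (x + s *\<^sub>R ?e)"])
      show "((\<lambda>s. h (x + s *\<^sub>R ?e)) has_derivative (\<lambda>t. t *\<^sub>R partial_deriv i h (x + s *\<^sub>R ?e))) (at s within {0..1})" for s
        using has_vector_derivative_partial[OF diff] by (simp add: has_vector_derivative_def)
      show "onorm (\<lambda>t. t *\<^sub>R partial_deriv i h (x + s *\<^sub>R ?e)) \<le> K" if "s \<in> {0..1}" for s
        using K[OF n1, of s] that by (intro onorm_le) (simp add: mult.commute[of K] mult_left_mono)
    qed auto
    moreover have "norm (q n x) = real (Suc n) * norm (h (x + (1 / real (Suc n)) *\<^sub>R ?e) - h x)"
      by (simp add: q_def del: of_nat_Suc)
    ultimately show ?thesis using True by (simp add: pos_le_divide_eq mult.commute del: of_nat_Suc)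
  next
    case False
    have "norm ((1 / real (Suc n)) *\<^sub>R ?e) \<le> 1" by simp
    then have "norm x - 1 \<le> norm (x + (1 / real (Suc n)) *\<^sub>R ?e)"
      using norm_diff_ineq[of x "(1 / real (Suc n)) *\<^sub>R ?e"] by linarith
    then show ?thesis using False supp by (simp add: q_def R'_def)
  qed
  have inth: "integrable lborel h"
  proof (rule integrable_cong_AE_imp)
    show "integrable lborel (\<lambda>x. indicator (cball 0 R') x *\<^sub>R h x)"
      using borel_integrable_compact[of "cball 0 R'" h] continuous_on_subset[OF conth] by (simp add: indicator_scaleR_eq_if)
    show "AE x in lborel. indicator (cball 0 R') x *\<^sub>R h x = h x"
      using supp by (auto simp: indicator_def R'_def)
  qed auto
  have int_shift: "integrable lborel (\<lambda>x. h (x + c))" "(\<integral>x. h (x + c) \<partial>lborel) = (\<integral>x. h x \<partial>lborel)" for c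
    using integrable_distr_eq[of "(+) c" lborel borel h] integral_distr[of "(+) c" lborel borel h] inth
    by (simp_all add: lborel_distr_plus add.commute)
  have "(\<lambda>n. \<integral>x. q n x \<partial>lborel) \<longlonglongrightarrow> (\<integral>x. partial_deriv i h x \<partial>lborel)"
  proof (rule integral_dominated_convergence)
    show "integrable lborel (\<lambda>x. K * indicator (cball 0 (R' + 1)) x :: real)"
      by (intro integrable_mult_right integrable_real_indicator) (use emeasure_lborel_cball_finite in auto)
    show "AE x in lborel. (\<lambda>n. q n x) \<longlonglongrightarrow> partial_deriv i h x"
    proof (rule AE_I2)
      fix x
      have "((\<lambda>s. h (x + s *\<^sub>R ?e)) has_vector_derivative partial_deriv i h x) (at 0)"
        using has_vector_derivative_partial[where f = h and x = x and s = 0 and i = i and S = UNIV] diff by simp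
      then have quot: "((\<lambda>s. norm (h (x + s *\<^sub>R ?e) - h x - s *\<^sub>R partial_deriv i h x) / \<bar>s\<bar>) \<longlongrightarrow> 0) (at 0)"
        by (simp add: has_vector_derivative_def has_derivative_at)
      have eq: "norm (h (x + s *\<^sub>R ?e) - h x - s *\<^sub>R partial_deriv i h x) / \<bar>s\<bar>
          = norm ((h (x + s *\<^sub>R ?e) - h x) /\<^sub>R s - partial_deriv i h x)" if "s \<noteq> 0" for s
      proof -
        have d: "(h (x + s *\<^sub>R ?e) - h x) /\<^sub>R s - partial_deriv i h x
            = (h (x + s *\<^sub>R ?e) - h x - s *\<^sub>R partial_deriv i h x) /\<^sub>R s"
          using that by (simp add: scaleR_diff_right)
        show ?thesis unfolding d by (simp add: divide_inverse)
      qed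
      have "((\<lambda>s. norm ((h (x + s *\<^sub>R ?e) - h x) /\<^sub>R s - partial_deriv i h x)) \<longlongrightarrow> 0) (at 0)"
        by (rule Lim_transform_eventually[OF quot], unfold eventually_at_filter)
           (intro always_eventually allI impI eq)
      then have lim: "((\<lambda>s. (h (x + s *\<^sub>R ?e) - h x) /\<^sub>R s) \<longlongrightarrow> partial_deriv i h x) (at 0)"
        by (rule LIM_zero_cancel[OF tendsto_norm_zero_cancel])
      have "(\<lambda>n. (h (x + (1 / real (Suc n)) *\<^sub>R ?e) - h x) /\<^sub>R (1 / real (Suc n))) \<longlonglongrightarrow> partial_deriv i h x"
        using LIMSEQ_Suc[OF lim_1_over_n[where 'a = real]]
        by (intro filterlim_compose[OF lim]) (auto simp: filterlim_at)
      then show "(\<lambda>n. q n x) \<longlonglongrightarrow> partial_deriv i h x" by (simp only: q_def inverse_divide div_by_1)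
    qed
    show "AE x in lborel. norm (q n x) \<le> K * indicator (cball 0 (R' + 1)) x" for n
      using bound by auto
  qed (auto simp: q_def)
  moreover have "(\<integral>x. q n x \<partial>lborel) = 0" for n
    unfolding q_def using int_shift inth by simp
  ultimately show ?thesis by (simp add: LIMSEQ_const_iff)
qed

abbreviation grad :: "(real^3 \<Rightarrow> complex) \<Rightarrow> real^3 \<Rightarrow> complex^3" where
  "grad F x \<equiv> \<chi> i. partial_deriv i F x"

lemma smooth_continuous_grad: "smooth F \<Longrightarrow> continuous_on A (grad F)"
  by (intro continuous_on_vec_lambda smooth_continuous_partial)

lemma partial_deriv_zero_outside:
  assumes "x \<notin> closure {x. \<phi> x \<noteq> 0}"
  shows "partial_deriv i \<phi> x = 0"
proof -
  have "(\<phi> has_derivative (\<lambda>_. 0)) (at x)"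
  proof (rule has_derivative_transform_within_open)
    show "((\<lambda>_. 0) has_derivative (\<lambda>_. 0)) (at x)" by simp
    show "open (- closure {x. \<phi> x \<noteq> 0})" "x \<in> - closure {x. \<phi> x \<noteq> 0}" using assms by auto
    show "0 = \<phi> y" if "y \<in> - closure {x. \<phi> x \<noteq> 0}" for y
      using that closure_subset[of "{x. \<phi> x \<noteq> 0}"] by auto
  qed
  from partial_deriv_eq[OF this] show ?thesis .
qed

lemma integral_ball_eq_lborel:
  fixes f :: "real^3 \<Rightarrow> 'b::{banach, second_countable_topology}"
  assumes "f \<in> borel_measurable borel" "\<And>x. norm x \<ge> 1 \<Longrightarrow> f x = 0"
  shows "(\<integral>x. f x \<partial>ball_measure) = (\<integral>x. f x \<partial>lborel)"
proof -
  have "(\<integral>x. f x \<partial>ball_measure) = (\<integral>x. indicator unit_ball x *\<^sub>R f x \<partial>lebesgue)"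
    by (rule integral_restrict_space) auto
  also have "\<dots> = (\<integral>x. f x \<partial>lebesgue)"
    using assms(2) by (intro Bochner_Integration.integral_cong) (auto simp: indicator_def not_less)
  also have "\<dots> = (\<integral>x. f x \<partial>lborel)"
    using assms by (intro integral_completion) auto
  finally show ?thesis .
qed

text \<open>The product of \<phi> and \<open>F\<close> has compact support in the ball, so its
  partial derivative has integral zero; the product rule splits this integral into the two
  sides.\<close>

lemma smooth_weak_derivative:
  assumes F: "smooth F" and \<phi>: "test_function \<phi>"
  shows "(\<integral>x. partial_deriv i \<phi> x *\<^sub>R F x \<partial>ball_measure) = - (\<integral>x. \<phi> x *\<^sub>R (partial_deriv i F x :: complex) \<partial>ball_measure)"
proof -
  have sm: "smooth \<phi>" and sub: "closure {x. \<phi> x \<noteq> 0} \<subseteq> unit_ball"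
    using \<phi> by (auto simp: test_function_def)
  have d: "partial_deriv i (\<lambda>x. \<phi> x *\<^sub>R F x) x = partial_deriv i \<phi> x *\<^sub>R F x + \<phi> x *\<^sub>R partial_deriv i F x" for x
    using partial_deriv_eq[OF has_derivative_scaleR[of \<phi> "frechet_derivative \<phi> (at x)" x UNIV F "frechet_derivative F (at x)"]]
      smooth_differentiable[OF sm] smooth_differentiable[OF F]
    by (simp add: partial_deriv_def frechet_derivative_works)
  have c: "continuous_on UNIV (\<lambda>x. partial_deriv i \<phi> x *\<^sub>R F x)" "continuous_on UNIV (\<lambda>x. \<phi> x *\<^sub>R partial_deriv i F x)"
    by (intro continuous_intros smooth_continuous_partial smooth_continuous sm F)+
  have z: "\<phi> x = 0" "partial_deriv i \<phi> x = 0" if "norm x \<ge> 1" for x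
  proof -
    have "x \<notin> closure {x. \<phi> x \<noteq> 0}" using sub that by auto
    then show "\<phi> x = 0" "partial_deriv i \<phi> x = 0"
      using closure_subset[of "{x. \<phi> x \<noteq> 0}"] by (auto intro: partial_deriv_zero_outside)
  qed
  have "0 = (\<integral>x. partial_deriv i (\<lambda>x. \<phi> x *\<^sub>R F x) x \<partial>lborel)"
  proof (rule integral_partial_deriv_zero[where R = 1, symmetric])
    show "(\<lambda>x. \<phi> x *\<^sub>R F x) differentiable at x" for x
      using smooth_differentiable[OF sm] smooth_differentiable[OF F] by (intro differentiable_scaleR) auto
    show "continuous_on UNIV (partial_deriv i (\<lambda>x. \<phi> x *\<^sub>R F x))"
      unfolding d[abs_def] by (intro continuous_on_add c)
  qed (simp add: z)
  also have "\<dots> = (\<integral>x. partial_deriv i \<phi> x *\<^sub>R F x + \<phi> x *\<^sub>R partial_deriv i F x \<partial>ball_measure)"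
    unfolding d using borel_measurable_continuous_onI[OF c(1)] borel_measurable_continuous_onI[OF c(2)]
    by (intro integral_ball_eq_lborel[symmetric]) (auto simp: z)
  also have "\<dots> = (\<integral>x. partial_deriv i \<phi> x *\<^sub>R F x \<partial>ball_measure) + (\<integral>x. \<phi> x *\<^sub>R partial_deriv i F x \<partial>ball_measure)"
    by (intro Bochner_Integration.integral_add continuous_integrable_ball c)
  finally show ?thesis by (simp add: eq_neg_iff_add_eq_0)
qed

text \<open>An approximating sequence alone suffices: each member satisfies the weak derivative
  identity, and both sides are continuous in L^2 against a fixed test function, so the limit
  inherits membership in H^1.\<close>

lemma has_traceI:
  assumes F: "\<And>n. smooth (F n)" and u: "L2_converges ball_measure F u"
    and G: "L2_converges ball_measure (\<lambda>n. grad (F n)) G" and f: "L2_converges surface_measure F f"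
  shows "has_trace u G f"
proof -
  note L = continuous_L2_ball[OF smooth_continuous[OF F]] continuous_L2_ball[OF smooth_continuous_grad[OF F]]
    continuous_L2_surface[OF smooth_continuous[OF F]]
  have uL: "L2 ball_measure u" and GL: "L2 ball_measure G"
    using L2_converges_limit_L2[OF u L(1)] L2_converges_limit_L2[OF G L(2)] by auto
  have "(\<integral>x. partial_deriv i \<phi> x *\<^sub>R u x \<partial>ball_measure) = - (\<integral>x. \<phi> x *\<^sub>R (G x $ i) \<partial>ball_measure)"
    if \<phi>: "test_function \<phi>" for \<phi> i
  proof -
    have sm: "smooth \<phi>" using \<phi> by (simp add: test_function_def)
    have p1: "L2 ball_measure \<phi>" and p2: "L2 ball_measure (partial_deriv i \<phi>)"
      by (intro continuous_L2_ball smooth_continuous smooth_continuous_partial sm)+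
    note [measurable] = L2_measurable[OF p1] L2_measurable[OF p2] L2_measurable[OF uL] L2_measurable[OF GL]
      L2_measurable[OF L(1)] L2_measurable[OF L(2)]
    have [measurable]: "(\<lambda>x. G x $ i) \<in> borel_measurable ball_measure"
      by (rule measurable_compose[OF L2_measurable[OF GL]]) (intro borel_measurable_continuous_onI continuous_intros)
    have lim1: "(\<lambda>n. \<integral>x. partial_deriv i \<phi> x *\<^sub>R F n x \<partial>ball_measure) \<longlonglongrightarrow> (\<integral>x. partial_deriv i \<phi> x *\<^sub>R u x \<partial>ball_measure)"
    proof (rule L2_converges_product[OF u p2, where K = 1])
      show "integrable ball_measure (\<lambda>x. partial_deriv i \<phi> x *\<^sub>R F n x)" for n
        by (intro continuous_integrable_ball continuous_intros smooth_continuous_partial smooth_continuous sm F)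
      show "integrable ball_measure (\<lambda>x. partial_deriv i \<phi> x *\<^sub>R u x)"
        by (rule L2_product(1)[OF p2 uL, where K = 1]) auto
    qed (auto simp flip: scaleR_diff_right)
    have lim2: "(\<lambda>n. \<integral>x. \<phi> x *\<^sub>R partial_deriv i (F n) x \<partial>ball_measure) \<longlonglongrightarrow> (\<integral>x. \<phi> x *\<^sub>R (G x $ i) \<partial>ball_measure)"
    proof (rule L2_converges_product[OF G p1, where K = 1])
      show "integrable ball_measure (\<lambda>x. \<phi> x *\<^sub>R partial_deriv i (F n) x)" for n
        by (intro continuous_integrable_ball continuous_intros smooth_continuous_partial smooth_continuous sm F)
      show "integrable ball_measure (\<lambda>x. \<phi> x *\<^sub>R (G x $ i))"
        by (rule L2_product(1)[OF p1 GL, where K = 1]) (auto intro!: AE_I2 mult_left_mono Finite_Cartesian_Product.norm_nth_le)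
      have "norm (partial_deriv i (F n) x - G x $ i) \<le> norm (grad (F n) x - G x)" for n x
        using Finite_Cartesian_Product.norm_nth_le[of "grad (F n) x - G x" i] by simp
      then show "AE x in ball_measure. norm (\<phi> x *\<^sub>R partial_deriv i (F n) x - \<phi> x *\<^sub>R (G x $ i))
          \<le> 1 * (norm (grad (F n) x - G x) * norm (\<phi> x))" for n
        by (auto simp: mult.commute mult_left_mono simp flip: scaleR_diff_right)
    qed auto
    show ?thesis
      using LIMSEQ_unique[OF lim1] tendsto_minus[OF lim2] by (simp add: smooth_weak_derivative[OF F \<phi>])
  qed
  then have "H1 u G" using uL GL by (simp add: H1_def)
  then show ?thesis using F u G f L2_converges_limit_L2[OF f L(3)] unfolding has_trace_def by blast
qed

lemma has_traceE:
  assumes "has_trace u G f"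
  obtains F where "\<And>n. smooth (F n)" "L2_converges ball_measure F u"
    "L2_converges ball_measure (\<lambda>n. grad (F n)) G" "L2_converges surface_measure F f"
  using assms unfolding has_trace_def by blast

lemma has_trace_smooth: "smooth F \<Longrightarrow> has_trace F (grad F) F"
  by (rule has_traceI[where F = "\<lambda>_. F"]) (auto intro: L2_converges_const)

lemma has_trace_diff:
  assumes "has_trace u G f" "has_trace v H h"
  shows "has_trace (\<lambda>x. u x - v x) (\<lambda>x. G x - H x) (\<lambda>x. f x - h x)"
proof -
  obtain A where A: "\<And>n. smooth (A n)" "L2_converges ball_measure A u"
    "L2_converges ball_measure (\<lambda>n. grad (A n)) G" "L2_converges surface_measure A f"
    using has_traceE[OF assms(1)] by blast
  obtain B where B: "\<And>n. smooth (B n)" "L2_converges ball_measure B v"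
    "L2_converges ball_measure (\<lambda>n. grad (B n)) H" "L2_converges surface_measure B h"
    using has_traceE[OF assms(2)] by blast
  have "grad (\<lambda>x. A n x - B n x) = (\<lambda>x. grad (A n) x - grad (B n) x)" for n
    by (simp add: vec_eq_iff fun_eq_iff partial_deriv_diff smooth_differentiable A B)
  then show ?thesis
    using A B by (intro has_traceI[where F = "\<lambda>n x. A n x - B n x"]) (auto intro: smooth_diff L2_converges_diff)
qed

lemma L2_converges_isometry:
  assumes "L2_converges M F f" "\<And>a b. norm (T a - T b) = norm (a - b)" "T \<in> borel_measurable borel"
    and m: "\<And>n. F n \<in> borel_measurable M" "f \<in> borel_measurable M"
  shows "L2_converges M (\<lambda>n x. T (F n x)) (\<lambda>x. T (f x))"
  using assms measurable_compose[OF m(1) assms(3)] measurable_compose[OF m(2) assms(3)]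
  by (simp add: L2_converges_def L2_def)

text \<open>Needed because \<open>energy\<close> is bilinear: a weighted squared norm arises only
  when a gradient is paired with its conjugate, which must therefore be an admissible test
  gradient.\<close>

lemma has_trace_cnj:
  assumes "has_trace u G f"
  shows "has_trace (\<lambda>x. cnj (u x)) (\<lambda>x. \<chi> i. cnj (G x $ i)) (\<lambda>x. cnj (f x))"
proof -
  obtain F where F: "\<And>n. smooth (F n)" "L2_converges ball_measure F u"
    "L2_converges ball_measure (\<lambda>n. grad (F n)) G" "L2_converges surface_measure F f"
    using has_traceE[OF assms] by blast
  note L = continuous_L2_ball[OF smooth_continuous[OF F(1)]] continuous_L2_ball[OF smooth_continuous_grad[OF F(1)]]
    continuous_L2_surface[OF smooth_continuous[OF F(1)]]
  note L' = L2_converges_limit_L2[OF F(2) L(1)] L2_converges_limit_L2[OF F(3) L(2)] L2_converges_limit_L2[OF F(4) L(3)]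
  note m = L[THEN L2_measurable] L'[THEN L2_measurable]
  have g: "grad (\<lambda>x. cnj (F n x)) = (\<lambda>x. \<chi> i. cnj (grad (F n) x $ i))" for n
    by (simp add: vec_eq_iff fun_eq_iff partial_deriv_linear[OF bounded_linear_cnj] smooth_differentiable F)
  have nv: "norm ((\<chi> i. cnj (a $ i)) - (\<chi> i. cnj (b $ i))) = norm (a - b)" for a b :: "complex^3"
    by (simp add: norm_vec_def flip: complex_cnj_diff)
  show ?thesis
  proof (rule has_traceI)
    show "smooth (\<lambda>x. cnj (F n x))" for n by (intro smooth_linear[OF bounded_linear_cnj] F)
    show "L2_converges ball_measure (\<lambda>n x. cnj (F n x)) (\<lambda>x. cnj (u x))"
      "L2_converges surface_measure (\<lambda>n x. cnj (F n x)) (\<lambda>x. cnj (f x))"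
      using F m by (auto intro!: L2_converges_isometry[where T = cnj] simp flip: complex_cnj_diff
          intro: borel_measurable_continuous_onI continuous_intros)
    show "L2_converges ball_measure (\<lambda>n. grad (\<lambda>x. cnj (F n x))) (\<lambda>x. \<chi> i. cnj (G x $ i))"
      unfolding g using F m nv by (intro L2_converges_isometry[where T = "\<lambda>v. \<chi> i. cnj (v $ i)"])
         (auto intro!: borel_measurable_continuous_onI continuous_intros)
  qed
qed

section \<open>The energy form and the Dirichlet-to-Neumann map\<close>

lemma dot_bound: "norm (\<Sum>i\<in>UNIV. a $ i * b $ i) \<le> norm a * norm (b::complex^'n)"
proof -
  have "norm (\<Sum>i\<in>UNIV. a $ i * b $ i) \<le> (\<Sum>i\<in>UNIV. \<bar>norm (a $ i)\<bar> * \<bar>norm (b $ i)\<bar>)"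
    by (rule order_trans[OF norm_sum]) (simp add: norm_mult)
  also have "\<dots> \<le> norm a * norm b" unfolding norm_vec_def by (rule L2_set_mult_ineq)
  finally show ?thesis .
qed

lemma dot_cnj: "(\<Sum>i\<in>UNIV. a $ i * cnj (a $ i)) = of_real ((norm (a::complex^'n))\<^sup>2)"
  by (simp add: norm_vec_def L2_set_def sum_nonneg complex_norm_square del: of_real_power)

locale conductivity =
  fixes \<gamma> :: "real^3 \<Rightarrow> real" and C :: real
  assumes C_pos: "C > 0"
    and \<gamma>_measurable [measurable]: "\<gamma> \<in> borel_measurable ball_measure"
    and \<gamma>_bounds: "AE x in ball_measure. inverse C \<le> \<gamma> x \<and> \<gamma> x \<le> C"
begin

lemma \<gamma>_abs_bound: "AE x in ball_measure. \<bar>\<gamma> x\<bar> \<le> C"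
  using \<gamma>_bounds
proof eventually_elim
  case (elim x)
  then show ?case using C_pos positive_imp_inverse_positive[OF C_pos] by linarith
qed

lemma energy_integrand:
  fixes G H :: "real^3 \<Rightarrow> complex^3"
  assumes "L2 ball_measure G" "L2 ball_measure H"
  shows "integrable ball_measure (\<lambda>x. \<gamma> x *\<^sub>R (\<Sum>i\<in>UNIV. G x $ i * H x $ i))"
proof (rule L2_product(1)[OF assms, where K = C])
  have nth: "(\<lambda>x. G x $ i) \<in> borel_measurable ball_measure" "(\<lambda>x. H x $ i) \<in> borel_measurable ball_measure" for i
    by (rule measurable_compose[OF L2_measurable[OF assms(1)]] measurable_compose[OF L2_measurable[OF assms(2)]],
        intro borel_measurable_continuous_onI continuous_intros)+
  show "(\<lambda>x. \<gamma> x *\<^sub>R (\<Sum>i\<in>UNIV. G x $ i * H x $ i)) \<in> borel_measurable ball_measure"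
    by (intro borel_measurable_scaleR borel_measurable_sum borel_measurable_times nth \<gamma>_measurable)
  show "AE x in ball_measure. norm (\<gamma> x *\<^sub>R (\<Sum>i\<in>UNIV. G x $ i * H x $ i)) \<le> C * (norm (G x) * norm (H x))"
    using \<gamma>_abs_bound by eventually_elim (auto intro!: mult_mono dot_bound)
qed (use C_pos in simp)

lemma energy_commute: "energy \<gamma> G H = energy \<gamma> H G"
  by (simp add: energy_def mult.commute)

lemma energy_diff_right:
  assumes "L2 ball_measure G" "L2 ball_measure H" "L2 ball_measure K"
  shows "energy \<gamma> G (\<lambda>x. H x - K x) = energy \<gamma> G H - energy \<gamma> G K"
  unfolding energy_def
  by (subst Bochner_Integration.integral_diff[symmetric])
     (auto simp: energy_integrand assms algebra_simps sum_subtractf scaleR_diff_right)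

lemma energy_diff_left:
  assumes "L2 ball_measure G" "L2 ball_measure H" "L2 ball_measure K"
  shows "energy \<gamma> (\<lambda>x. G x - H x) K = energy \<gamma> G K - energy \<gamma> H K"
  using energy_diff_right[OF assms(3,1,2)] by (simp add: energy_commute)

lemma energy_tendsto:
  assumes conv: "L2_converges ball_measure Gs G" and G: "L2 ball_measure G" and H: "L2 ball_measure H"
  shows "(\<lambda>n. energy \<gamma> (Gs n) H) \<longlonglongrightarrow> energy \<gamma> G H"
  unfolding energy_def
proof (rule L2_converges_product[OF conv H, where K = C])
  show "integrable ball_measure (\<lambda>x. \<gamma> x *\<^sub>R (\<Sum>i\<in>UNIV. Gs n x $ i * H x $ i))" for n
    by (intro energy_integrand L2_converges_L2[OF conv G] H)
  show "AE x in ball_measure. norm (\<gamma> x *\<^sub>R (\<Sum>i\<in>UNIV. Gs n x $ i * H x $ i) - \<gamma> x *\<^sub>R (\<Sum>i\<in>UNIV. G x $ i * H x $ i))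
      \<le> C * (norm (Gs n x - G x) * norm (H x))" for n
    using \<gamma>_abs_bound
  proof eventually_elim
    case (elim x)
    have "\<gamma> x *\<^sub>R (\<Sum>i\<in>UNIV. Gs n x $ i * H x $ i) - \<gamma> x *\<^sub>R (\<Sum>i\<in>UNIV. G x $ i * H x $ i)
       = \<gamma> x *\<^sub>R (\<Sum>i\<in>UNIV. (Gs n x - G x) $ i * H x $ i)"
      by (simp add: scaleR_diff_right sum_subtractf algebra_simps)
    then show ?case using elim dot_bound[of "Gs n x - G x" "H x"] C_pos by (auto intro!: mult_mono)
  qed
qed (use C_pos G H energy_integrand in auto)

text \<open>The pairing is the integral of \<gamma> times the squared norm of \<open>G\<close>, and
  \<gamma> is bounded below by \<open>inverse C > 0\<close>. This coercivity is what makes solutions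
  unique.\<close>

lemma energy_cnj_zero_imp_AE_zero:
  assumes G: "L2 ball_measure G" and zero: "energy \<gamma> G (\<lambda>x. \<chi> i. cnj (G x $ i)) = 0"
  shows "AE x in ball_measure. G x = 0"
proof -
  have "L2 ball_measure (\<lambda>x. \<chi> i. cnj (G x $ i))"
  proof (rule L2_dominated[OF _ L2_integrable[OF G]])
    show "(\<lambda>x. \<chi> i. cnj (G x $ i)) \<in> borel_measurable ball_measure"
      by (rule measurable_compose[OF L2_measurable[OF G]])
         (intro borel_measurable_continuous_onI continuous_intros continuous_on_vec_lambda)
  qed (simp add: norm_vec_def)
  from energy_integrand[OF G this] have int: "integrable ball_measure (\<lambda>x. of_real (\<gamma> x * (norm (G x))\<^sup>2) :: complex)"
    by (simp add: dot_cnj scaleR_conv_of_real)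
  have "of_real (\<integral>x. \<gamma> x * (norm (G x))\<^sup>2 \<partial>ball_measure) = (0::complex)"
    using zero unfolding energy_def by (simp add: dot_cnj scaleR_conv_of_real flip: integral_of_real of_real_mult of_real_power)
  then have "(\<integral>x. \<gamma> x * (norm (G x))\<^sup>2 \<partial>ball_measure) = 0" by simp
  moreover have "integrable ball_measure (\<lambda>x. \<gamma> x * (norm (G x))\<^sup>2)"
    using integrable_Re[OF int] by (simp only: Re_complex_of_real)
  moreover have pos: "AE x in ball_measure. \<gamma> x > 0"
    using \<gamma>_bounds by eventually_elim (use positive_imp_inverse_positive[OF C_pos] in linarith)
  ultimately have "AE x in ball_measure. \<gamma> x * (norm (G x))\<^sup>2 = 0"
    by (subst (asm) integral_nonneg_eq_0_iff_AE) (auto elim: eventually_mono)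
  with pos show ?thesis by eventually_elim auto
qed

text \<open>Both sides are continuous along the smooth sequence that realizes the trace: the left in
  the gradients, the right in the boundary values. An identity for smooth \<open>F\<close> thus
  determines the pairing on all of H^1, and \<open>w\<close> enters only through
  \<open>h\<close>.\<close>

lemma energy_pairing_extends:
  assumes G: "L2 ball_measure G" and Y: "L2 surface_measure Y"
    and eq: "\<And>F. smooth F \<Longrightarrow> energy \<gamma> G (grad F) = ev * (\<integral>x. Y x * F x \<partial>surface_measure)"
    and w: "has_trace w H h"
  shows "energy \<gamma> G H = ev * (\<integral>x. Y x * h x \<partial>surface_measure)"
proof -
  obtain F where F: "\<And>n. smooth (F n)" "L2_converges ball_measure (\<lambda>n. grad (F n)) H" "L2_converges surface_measure F h"
    using has_traceE[OF w] by blast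
  have h: "L2 surface_measure h" and H: "L2 ball_measure H" using w by (auto simp: has_trace_def H1_def)
  have Fs: "L2 surface_measure (F n)" for n by (intro continuous_L2_surface smooth_continuous F)
  note [measurable] = L2_measurable[OF h] L2_measurable[OF Y] L2_measurable[OF Fs]
  have "(\<lambda>n. energy \<gamma> (grad (F n)) G) \<longlonglongrightarrow> energy \<gamma> H G"
    by (rule energy_tendsto[OF F(2) H G])
  then have lim: "(\<lambda>n. ev * (\<integral>x. Y x * F n x \<partial>surface_measure)) \<longlonglongrightarrow> energy \<gamma> G H"
    by (simp add: energy_commute[of _ G] eq F)
  have "(\<lambda>n. \<integral>x. Y x * F n x \<partial>surface_measure) \<longlonglongrightarrow> (\<integral>x. Y x * h x \<partial>surface_measure)"
  proof (rule L2_converges_product[OF F(3) Y, where K = 1])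
    show "integrable surface_measure (\<lambda>x. Y x * F n x)" for n
      by (rule L2_product(1)[OF Y Fs, where K = 1]) (auto simp: norm_mult)
    show "integrable surface_measure (\<lambda>x. Y x * h x)"
      by (rule L2_product(1)[OF Y h, where K = 1]) (auto simp: norm_mult)
  qed (auto simp: norm_mult mult.commute simp flip: right_diff_distrib)
  from LIMSEQ_unique[OF lim tendsto_mult_left[OF this]] show ?thesis .
qed

text \<open>The conjugate of the difference of two solutions has zero trace and is a legitimate test
  function, so coercivity forces the gradients to agree almost everywhere. This is what makes the
  description in \<open>dn_map\<close> independent of the chosen solution.\<close>

lemma weak_solution_pairing_unique:
  assumes s: "weak_solution \<gamma> f u G" "weak_solution \<gamma> f u' G'" and H: "L2 ball_measure H"
  shows "energy \<gamma> G H = energy \<gamma> G' H"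
proof -
  have t: "has_trace u G f" "has_trace u' G' f" using s by (auto simp: weak_solution_def)
  have L: "L2 ball_measure G" "L2 ball_measure G'" using t by (auto simp: has_trace_def H1_def)
  let ?D = "\<lambda>x. G x - G' x"
  have tD: "has_trace (\<lambda>x. cnj (u x - u' x)) (\<lambda>x. \<chi> i. cnj (?D x $ i)) (\<lambda>_. 0)"
    using has_trace_cnj[OF has_trace_diff[OF t]] by simp
  then have LD: "L2 ball_measure (\<lambda>x. \<chi> i. cnj (?D x $ i))" by (simp add: has_trace_def H1_def)
  have "energy \<gamma> ?D (\<lambda>x. \<chi> i. cnj (?D x $ i)) = 0"
    using s tD energy_diff_left[OF L LD] by (simp add: weak_solution_def)
  from energy_cnj_zero_imp_AE_zero[OF L2_diff[OF L] this]
  have ae: "AE x in ball_measure. G x = G' x" by eventually_elim simp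
  show ?thesis
    unfolding energy_def
    by (rule integral_cong_AE[OF borel_measurable_integrable[OF energy_integrand[OF L(1) H]]
          borel_measurable_integrable[OF energy_integrand[OF L(2) H]]])
       (use ae in \<open>auto elim: eventually_mono\<close>)
qed

lemma dn_eigenfunctionI:
  assumes u: "has_trace u G Y" and nz: "\<not> (AE x in surface_measure. Y x = 0)"
    and eq: "\<And>F. smooth F \<Longrightarrow> energy \<gamma> G (grad F) = ev * (\<integral>x. Y x * F x \<partial>surface_measure)"
  shows "dn_eigenfunction \<gamma> Y"
proof -
  have GL: "L2 ball_measure G" and YL: "L2 surface_measure Y" using u by (auto simp: has_trace_def H1_def)
  have pairing: "energy \<gamma> G H = ev * (\<integral>x. Y x * h x \<partial>surface_measure)" if "has_trace w H h" for w H h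
    by (rule energy_pairing_extends[OF GL YL eq that])
  \<comment> \<open>Taking \<open>h = 0\<close> in \<open>pairing\<close> gives the weak equation,
    so one identity yields both the solution property and the eigenvalue.\<close>
  have sol: "weak_solution \<gamma> Y u G"
    unfolding weak_solution_def using u pairing by fastforce
  have "dn_map \<gamma> Y h = ev * (\<integral>x. Y x * h x \<partial>surface_measure)" if "h \<in> H_half" for h
  proof -
    obtain w H where w: "has_trace w H h" using \<open>h \<in> H_half\<close> by (auto simp: H_half_def)
    show ?thesis
      unfolding dn_map_def
    proof (rule the_equality)
      show "\<exists>u G w H. weak_solution \<gamma> Y u G \<and> has_trace w H h \<and> ev * (\<integral>x. Y x * h x \<partial>surface_measure) = energy \<gamma> G H"
        using sol w pairing[OF w] by metis
      \<comment> \<open>For a competing choice, uniqueness replaces \<open>G'\<close> by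
        \<open>G\<close>, and \<open>pairing\<close> shows that the extension \<open>H'\<close>
        enters only through \<open>h\<close>.\<close>
      fix c assume "\<exists>u G w H. weak_solution \<gamma> Y u G \<and> has_trace w H h \<and> c = energy \<gamma> G H"
      then obtain u' G' w' H' where c: "weak_solution \<gamma> Y u' G'" "has_trace w' H' h" "c = energy \<gamma> G' H'" by blast
      then have "c = energy \<gamma> G H'"
        using weak_solution_pairing_unique[OF sol c(1), of H'] by (simp add: has_trace_def H1_def)
      then show "c = ev * (\<integral>x. Y x * h x \<partial>surface_measure)" using pairing[OF c(2)] by simp
    qed
  qed
  then show ?thesis using u nz by (auto simp: dn_eigenfunction_def H_half_def)
qed

end

section \<open>Solid harmonics\<close>

definition laplacian :: "(real^3 \<Rightarrow> complex) \<Rightarrow> real^3 \<Rightarrow> complex" where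
  "laplacian f x = (\<Sum>i\<in>UNIV. partial_deriv i (partial_deriv i f) x)"

definition euler_deriv :: "(real^3 \<Rightarrow> complex) \<Rightarrow> real^3 \<Rightarrow> complex" where
  "euler_deriv f x = (\<Sum>i\<in>UNIV. of_real (x $ i) * partial_deriv i f x)"

section \<open>Product rules for the Laplacian and the Euler operator\<close>

lemma poly3_partial_deriv_mult:
  "poly3 f \<Longrightarrow> poly3 g \<Longrightarrow>
    partial_deriv i (\<lambda>x. f x * g x) = (\<lambda>x. f x * partial_deriv i g x + partial_deriv i f x * g x)"
  by (simp add: fun_eq_iff partial_deriv_mult poly3_differentiable)

lemma poly3_partial_deriv_power:
  "poly3 f \<Longrightarrow> partial_deriv i (\<lambda>x. f x ^ n) = (\<lambda>x. of_nat n * f x ^ (n - 1) * partial_deriv i f x)"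
  by (simp add: fun_eq_iff partial_deriv_power poly3_differentiable)

lemma poly3_partial_deriv_add:
  "poly3 f \<Longrightarrow> poly3 g \<Longrightarrow> partial_deriv i (\<lambda>x. f x + g x) = (\<lambda>x. partial_deriv i f x + partial_deriv i g x)"
  by (simp add: fun_eq_iff partial_deriv_add poly3_differentiable)

lemma poly3_partial_deriv_sum:
  "finite A \<Longrightarrow> (\<And>j. j \<in> A \<Longrightarrow> poly3 (f j)) \<Longrightarrow>
    partial_deriv i (\<lambda>x. \<Sum>j\<in>A. f j x) = (\<lambda>x. \<Sum>j\<in>A. partial_deriv i (f j) x)"
  by (simp add: fun_eq_iff partial_deriv_sum poly3_differentiable)

lemma laplacian_mult:
  assumes "poly3 f" "poly3 g"
  shows "laplacian (\<lambda>x. f x * g x) x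
    = f x * laplacian g x + 2 * (\<Sum>i\<in>UNIV. partial_deriv i f x * partial_deriv i g x) + laplacian f x * g x"
proof -
  have "partial_deriv i (partial_deriv i (\<lambda>x. f x * g x)) x
      = f x * partial_deriv i (partial_deriv i g) x + 2 * (partial_deriv i f x * partial_deriv i g x)
        + partial_deriv i (partial_deriv i f) x * g x" for i
    by (simp add: assms poly3_partial_deriv_mult poly3_partial_deriv_add poly3_partial_deriv poly3.mult algebra_simps)
  then show ?thesis
    by (simp add: laplacian_def sum.distrib sum_distrib_left sum_distrib_right)
qed

lemma laplacian_power:
  assumes "poly3 f"
  shows "laplacian (\<lambda>x. f x ^ n) x = of_nat n * f x ^ (n - 1) * laplacian f x
    + of_nat n * of_nat (n - 1) * f x ^ (n - 2) * (\<Sum>i\<in>UNIV. (partial_deriv i f x)\<^sup>2)"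
proof -
  have "partial_deriv i (partial_deriv i (\<lambda>x. f x ^ n)) x
    = of_nat n * f x ^ (n - 1) * partial_deriv i (partial_deriv i f) x
      + of_nat n * of_nat (n - 1) * f x ^ (n - 2) * (partial_deriv i f x)\<^sup>2" for i
    by (simp add: assms poly3_partial_deriv_power poly3_partial_deriv_mult poly3_partial_deriv poly3.const
        poly3.mult poly3_power power2_eq_square algebra_simps numeral_2_eq_2)
  then show ?thesis
    by (simp add: laplacian_def sum.distrib sum_distrib_left)
qed

lemma laplacian_sum:
  assumes "finite A" "\<And>j. j \<in> A \<Longrightarrow> poly3 (f j)"
  shows "laplacian (\<lambda>x. \<Sum>j\<in>A. f j x) x = (\<Sum>j\<in>A. laplacian (f j) x)"
  using assms by (simp add: laplacian_def poly3_partial_deriv_sum poly3_partial_deriv sum.swap[of _ UNIV A])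

lemma laplacian_cmult:
  "poly3 f \<Longrightarrow> laplacian (\<lambda>x. c * f x) x = c * laplacian f x"
  by (simp add: laplacian_def poly3_partial_deriv_mult poly3.const poly3_partial_deriv sum_distrib_left)

lemma euler_deriv_mult:
  "poly3 f \<Longrightarrow> poly3 g \<Longrightarrow> euler_deriv (\<lambda>x. f x * g x) x = f x * euler_deriv g x + euler_deriv f x * g x"
  by (simp add: euler_deriv_def poly3_partial_deriv_mult sum_distrib_left sum_distrib_right sum.distrib algebra_simps)

lemma euler_deriv_power:
  "poly3 f \<Longrightarrow> euler_deriv (\<lambda>x. f x ^ n) x = of_nat n * f x ^ (n - 1) * euler_deriv f x"
  by (simp add: euler_deriv_def poly3_partial_deriv_power sum_distrib_left algebra_simps)

lemma euler_deriv_sum: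
  assumes "finite A" "\<And>j. j \<in> A \<Longrightarrow> poly3 (f j)"
  shows "euler_deriv (\<lambda>x. \<Sum>j\<in>A. f j x) x = (\<Sum>j\<in>A. euler_deriv (f j) x)"
  using assms by (simp add: euler_deriv_def poly3_partial_deriv_sum sum_distrib_left sum.swap[of _ UNIV A])

lemma euler_deriv_cmult:
  "poly3 f \<Longrightarrow> euler_deriv (\<lambda>x. c * f x) x = c * euler_deriv f x"
  by (simp add: euler_deriv_def poly3_partial_deriv_mult poly3.const sum_distrib_left mult.left_commute)

text \<open>For \<open>s\<close> equal to i or -i this is the complex coordinate whose values on the
  sphere are sin \<theta> times exp(i \<phi>) or exp(-i \<phi>). Any \<open>s\<close> with s^2 = -1
  makes the sum of squares of its gradient vanish, so that all its powers are harmonic.\<close>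

definition axial :: "complex \<Rightarrow> real^3 \<Rightarrow> complex" where
  "axial s x = of_real (x $ 1) + s * of_real (x $ 2)"

text \<open>Spelled out in coordinates so that membership in \<open>poly3\<close> is
  immediate.\<close>

definition radius_sq :: "real^3 \<Rightarrow> complex" where
  "radius_sq x = of_real (x $ 1) * of_real (x $ 1) + of_real (x $ 2) * of_real (x $ 2) + of_real (x $ 3) * of_real (x $ 3)"

lemma radius_sq_eq: "radius_sq x = of_real ((norm x)\<^sup>2)"
  by (simp add: radius_sq_def norm_vec_def L2_set_def sum_nonneg sum_3 power2_eq_square)

lemma poly3_axial: "poly3 (axial s)"
  unfolding axial_def by (intro poly3.intros)

lemma poly3_radius_sq: "poly3 radius_sq"
  unfolding radius_sq_def by (intro poly3.intros)

lemma partial_deriv_coord': "partial_deriv i (\<lambda>x. of_real (x $ j) :: complex) = (\<lambda>x. if i = j then 1 else 0)"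
  by (simp add: fun_eq_iff partial_deriv_coord)

lemma partial_deriv_axial: "partial_deriv i (axial s) = (\<lambda>_. if i = 1 then 1 else if i = 2 then s else 0)"
  unfolding axial_def
  by (auto simp: poly3_partial_deriv_add poly3_partial_deriv_mult poly3.const poly3.coord poly3.mult partial_deriv_coord')

lemma partial_deriv_radius_sq: "partial_deriv i radius_sq = (\<lambda>x. 2 * of_real (x $ i))"
proof -
  have "i = 1 \<or> i = 2 \<or> i = 3" using UNIV_3 by auto
  then show ?thesis
    unfolding radius_sq_def
    by (auto simp: poly3_partial_deriv_add poly3_partial_deriv_mult poly3.add poly3.const poly3.coord poly3.mult partial_deriv_coord' fun_eq_iff)
qed

definition solid_monomial :: "complex \<Rightarrow> nat \<Rightarrow> nat \<Rightarrow> nat \<Rightarrow> real^3 \<Rightarrow> complex" where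
  "solid_monomial s k j e x = axial s x ^ k * of_real (x $ 3) ^ j * radius_sq x ^ e"

lemma poly3_solid_monomial: "poly3 (solid_monomial s k j e)"
  unfolding solid_monomial_def by (intro poly3.intros poly3_power poly3_axial poly3_radius_sq)

lemma euler_deriv_axial_power: 
  "euler_deriv (\<lambda>x. axial s x ^ k * of_real (x $ 3) ^ j) x = of_nat (k + j) * (axial s x ^ k * of_real (x $ 3) ^ j)"
proof -
  have 1: "euler_deriv (axial s) x = axial s x"
    by (simp add: euler_deriv_def partial_deriv_axial sum_3 axial_def)
  have 2: "euler_deriv (\<lambda>x. of_real (x $ 3)) x = of_real (x $ 3)"
    by (simp add: euler_deriv_def partial_deriv_coord' sum_3)
  have "euler_deriv (\<lambda>x. axial s x ^ k) x = of_nat k * axial s x ^ k"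
    by (subst euler_deriv_power[OF poly3_axial], cases k) (simp_all add: 1)
  moreover have "euler_deriv (\<lambda>x. of_real (x $ 3) ^ j) x = of_nat j * of_real (x $ 3) ^ j"
    by (subst euler_deriv_power[OF poly3.coord], cases j) (simp_all add: 2)
  ultimately show ?thesis
    by (subst euler_deriv_mult) (auto intro: poly3.intros poly3_power poly3_axial simp: algebra_simps)
qed

lemma euler_deriv_solid_monomial:
  "euler_deriv (solid_monomial s k j e) x = of_nat (k + j + 2 * e) * solid_monomial s k j e x"
proof -
  have "euler_deriv radius_sq x = 2 * radius_sq x"
    by (simp add: euler_deriv_def partial_deriv_radius_sq sum_3 radius_sq_def algebra_simps)
  then have "euler_deriv (\<lambda>x. radius_sq x ^ e) x = of_nat (2 * e) * radius_sq x ^ e"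
    by (subst euler_deriv_power[OF poly3_radius_sq], cases e) (simp_all add: algebra_simps)
  then show ?thesis
    unfolding solid_monomial_def
    by (subst euler_deriv_mult, intro poly3.intros poly3_power poly3_axial, intro poly3_power poly3_radius_sq)
       (simp add: euler_deriv_axial_power algebra_simps)
qed

text \<open>Powers of \<open>axial\<close> are harmonic because s^2 = -1, and the gradients of
  \<open>axial\<close> and of the third coordinate are orthogonal; only the second derivative in the
  third coordinate and the radial terms survive. The truncated exponents \<open>j - 2\<close> and
  \<open>e - 1\<close> are harmless, as their coefficients vanish when truncation occurs.\<close>

lemma laplacian_solid_monomial:
  assumes s: "s\<^sup>2 = -1"
  shows "laplacian (solid_monomial s k j e) x
    = of_nat (j * (j - 1)) * solid_monomial s k (j - 2) e x
      + of_nat (2 * e * (2 * (k + j) + 2 * e + 1)) * solid_monomial s k j (e - 1) x"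
proof -
  let ?f = "\<lambda>x. axial s x ^ k * of_real (x $ 3) ^ j"
  have pf: "poly3 ?f" by (intro poly3.intros poly3_power poly3_axial)
  have "laplacian (\<lambda>x. axial s x ^ k) x = 0"
    using s by (simp add: laplacian_power[OF poly3_axial] laplacian_def partial_deriv_axial sum_3)
  moreover have "laplacian (\<lambda>x. of_real (x $ 3) ^ j) x = of_nat (j * (j - 1)) * of_real (x $ 3) ^ (j - 2)"
    by (simp add: laplacian_power[OF poly3.coord] laplacian_def partial_deriv_coord' sum_3)
  moreover have "(\<Sum>i\<in>UNIV. partial_deriv i (\<lambda>x. axial s x ^ k) x * partial_deriv i (\<lambda>x. of_real (x $ 3) ^ j) x) = 0"
    by (simp add: poly3_partial_deriv_power poly3_axial poly3.coord partial_deriv_axial partial_deriv_coord' sum_3)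
  ultimately have lf: "laplacian ?f x = of_nat (j * (j - 1)) * (axial s x ^ k * of_real (x $ 3) ^ (j - 2))"
    by (subst laplacian_mult) (auto intro: poly3.intros poly3_power poly3_axial)
  have lr: "laplacian (\<lambda>x. radius_sq x ^ e) x = of_nat (2 * e * (2 * e + 1)) * radius_sq x ^ (e - 1)"
  proof -
    have *: "(\<Sum>i\<in>UNIV. (2 * complex_of_real (x $ i))\<^sup>2) = 4 * radius_sq x"
      by (simp add: sum_3 radius_sq_def power2_eq_square)
    have "laplacian radius_sq x = 6"
      by (simp add: laplacian_def partial_deriv_radius_sq poly3_partial_deriv_mult poly3.const poly3.coord
          partial_deriv_coord')
    moreover have "of_nat e * of_nat (e - 1) * radius_sq x ^ (e - 2) * (4 * radius_sq x)
        = 4 * of_nat e * of_nat (e - 1) * radius_sq x ^ (e - 1)"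
      by (cases e; cases "e - 1") (auto simp: algebra_simps)
    ultimately show ?thesis
      unfolding laplacian_power[OF poly3_radius_sq] partial_deriv_radius_sq *
      by (cases e) (auto simp: algebra_simps)
  qed
  \<comment> \<open>The gradient of \<open>radius_sq\<close> is 2 x, so the cross term is an Euler
    derivative of the homogeneous factor \<open>?f\<close>.\<close>
  have g: "(\<Sum>i\<in>UNIV. partial_deriv i ?f x * partial_deriv i (\<lambda>x. radius_sq x ^ e) x)
      = of_nat (2 * e) * radius_sq x ^ (e - 1) * (of_nat (k + j) * ?f x)"
    unfolding euler_deriv_axial_power[symmetric] euler_deriv_def
    by (simp add: poly3_partial_deriv_power[OF poly3_radius_sq] partial_deriv_radius_sq sum_distrib_left algebra_simps)
  show ?thesis
    unfolding solid_monomial_def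
    by (subst laplacian_mult[OF pf poly3_power[OF poly3_radius_sq]], simp only: lf lr g)
       (simp add: algebra_simps)
qed

lemma solid_monomial_scale:
  "solid_monomial s k j e (r *\<^sub>R x) = of_real r ^ (k + j + 2 * e) * solid_monomial s k j e x"
proof -
  have "axial s (r *\<^sub>R x) = of_real r * axial s x" by (simp add: axial_def algebra_simps)
  moreover have "radius_sq (r *\<^sub>R x) = of_real r ^ 2 * radius_sq x"
    by (simp add: radius_sq_def algebra_simps power2_eq_square)
  ultimately show ?thesis
    by (simp add: solid_monomial_def power_mult_distrib power_add power_mult[symmetric] mult.commute mult.left_commute)
qed

section \<open>Coefficients of the derivatives of Legendre polynomials\<close>

definition legendre_deriv :: "nat \<Rightarrow> nat \<Rightarrow> real poly" where
  "legendre_deriv l k = (pderiv ^^ (l + k)) ([:-1, 0, 1:] ^ l)"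

lemma coeff_quadratic_mult:
  "coeff ([:-1, 0, 1:] * P) (Suc (Suc i)) = coeff P i - coeff (P :: real poly) (Suc (Suc i))"
  "coeff ([:-1, 0, 1:] * P) (Suc 0) = - coeff P (Suc 0)"
  "coeff ([:-1, 0, 1:] * P) 0 = - coeff P 0"
  by (simp_all add: coeff_pCons)

text \<open>Compare coefficients in (x^2 - 1) W' = 2 l x W, which W = (x^2 - 1)^l satisfies.\<close>

lemma coeff_rodrigues_rec:
  "real (j + 2) * coeff ([:-1, 0, 1:] ^ l) (j + 2) = (real j - 2 * real l) * coeff ([:-1, 0, 1:] ^ l) j"
  and coeff_rodrigues_1: "coeff ([:-1, 0, 1 :: real:] ^ l) 1 = 0"
proof -
  let ?W = "[:-1, 0, 1 :: real:] ^ l"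
  have d: "[:-1, 0, 1:] * pderiv ?W = smult (2 * real l) (pCons 0 ?W)"
  proof (cases l)
    case (Suc n)
    have "pderiv ?W = smult (real l) ([:-1, 0, 1:] ^ n * [:0, 2:])"
      by (simp only: Suc pderiv_power_Suc) (simp add: pderiv_pCons mult.commute)
    also have "[:-1, 0, 1:] * \<dots> = smult (real l) ([:-1, 0, 1:] ^ l * [:0, 2:])"
      by (simp add: Suc)
    also have "\<dots> = smult (2 * real l) (pCons 0 ?W)" by (simp add: mult.commute)
    finally show ?thesis .
  qed (simp add: pderiv_1)
  show "coeff ?W 1 = 0"
    using arg_cong[OF d, of "\<lambda>p. coeff p 0"] unfolding coeff_quadratic_mult by (simp add: coeff_pderiv)
  show "real (j + 2) * coeff ?W (j + 2) = (real j - 2 * real l) * coeff ?W j"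
  proof (cases j)
    case 0
    then show ?thesis
      using arg_cong[OF d, of "\<lambda>p. coeff p (Suc 0)"] unfolding coeff_quadratic_mult
      by (simp add: coeff_pderiv numeral_2_eq_2)
  next
    case (Suc i)
    then show ?thesis
      using arg_cong[OF d, of "\<lambda>p. coeff p (Suc (Suc i))"] unfolding coeff_quadratic_mult
      by (simp add: coeff_pderiv numeral_2_eq_2 algebra_simps)
  qed
qed

lemma coeff_rodrigues_odd: "odd j \<Longrightarrow> coeff ([:-1, 0, 1 :: real:] ^ l) j = 0"
proof (induction j rule: less_induct)
  case (less j)
  show ?case
  proof (cases "j = 1")
    case False
    then have "j - 2 + 2 = j" "odd (j - 2)" "j - 2 < j" using less.prems by (auto elim!: oddE)
    then have "real j * coeff ([:-1, 0, 1 :: real:] ^ l) j = 0"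
      using coeff_rodrigues_rec[of "j - 2" l] less.IH[of "j - 2"] by simp
    then show ?thesis using less.prems by (auto elim: oddE)
  qed (simp add: coeff_rodrigues_1[unfolded One_nat_def])
qed

text \<open>Up to the factor 2^l l!, \<open>legendre_deriv l k\<close> is the k-th derivative of the
  Legendre polynomial of degree \<open>l\<close>. This is its differential equation (1 - x^2) y'' -
  2 (k + 1) x y' + (l (l + 1) - k (k + 1)) y = 0, read coefficientwise.\<close>

lemma coeff_legendre_deriv_rec:
  "real (j + 2) * real (j + 1) * coeff (legendre_deriv l k) (j + 2)
    = (real j + real l + real k + 1) * (real j + real k - real l) * coeff (legendre_deriv l k) j"
proof -
  let ?M = "l + k" let ?w = "coeff ([:-1, 0, 1 :: real:] ^ l)"
  \<comment> \<open>Differentiating \<open>?M\<close> times multiplies a coefficient by a Pochhammer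
    product. Peeling two factors off its front gives the left-hand side; peeling two off its end
    exposes the recurrence for the undifferentiated power.\<close>
  have p1: "pochhammer (real (j + 1)) (?M + 2) = real (j + 1) * real (j + 2) * pochhammer (real (j + 3)) ?M"
    by (simp add: pochhammer_rec algebra_simps numeral_2_eq_2)
  have p2: "pochhammer (real (j + 1)) (?M + 2) = pochhammer (real (j + 1)) ?M * real (j + ?M + 1) * real (j + ?M + 2)"
    by (simp add: pochhammer_rec' algebra_simps numeral_2_eq_2)
  have "real (j + 2) * real (j + 1) * coeff (legendre_deriv l k) (j + 2)
      = pochhammer (real (j + 1)) (?M + 2) * ?w (j + ?M + 2)"
    unfolding p1 by (simp add: legendre_deriv_def coeff_higher_pderiv algebra_simps numeral_2_eq_2 numeral_3_eq_3)
  also have "\<dots> = pochhammer (real (j + 1)) ?M * real (j + ?M + 1) * (real (j + ?M + 2) * ?w (j + ?M + 2))"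
    unfolding p2 by simp
  also have "real (j + ?M + 2) * ?w (j + ?M + 2) = (real (j + ?M) - 2 * real l) * ?w (j + ?M)"
    by (rule coeff_rodrigues_rec)
  finally show ?thesis
    by (simp add: legendre_deriv_def coeff_higher_pderiv algebra_simps)
qed

lemma degree_legendre_deriv: "k \<le> l \<Longrightarrow> degree (legendre_deriv l k) = l - k"
  by (simp add: legendre_deriv_def degree_higher_pderiv degree_power_eq)

lemma legendre_deriv_nonzero: "k \<le> l \<Longrightarrow> legendre_deriv l k \<noteq> 0"
proof -
  assume k: "k \<le> l"
  have "coeff ([:-1, 0, 1 :: real:] ^ l) (l * 2) = 1"
    using lead_coeff_power[of "[:-1, 0, 1 :: real:]" l] by (simp add: degree_power_eq mult_2_right)
  moreover have "pochhammer (real (Suc (l - k))) (l + k) > 0" by (rule pochhammer_pos) simp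
  moreover have "l - k + (l + k) = l * 2" using k by simp
  ultimately have "coeff (legendre_deriv l k) (l - k) \<noteq> 0"
    by (simp only: legendre_deriv_def coeff_higher_pderiv)
  then show ?thesis by auto
qed

lemma coeff_legendre_deriv_odd:
  assumes "k \<le> l" "odd (l - k - j)" "j \<le> l - k"
  shows "coeff (legendre_deriv l k) j = 0"
proof -
  have "odd (j + (l + k))" using assms by presburger
  then show ?thesis by (simp add: legendre_deriv_def coeff_higher_pderiv coeff_rodrigues_odd)
qed

text \<open>The homogenization of \<open>axial s\<close> to the power \<open>k\<close> times the
  polynomial \<open>legendre_deriv l k\<close> in the third coordinate: only exponents of the parity
  of \<open>l - k\<close> occur, and powers of |x|^2 supply the missing degree.\<close>

definition solid_harmonic :: "complex \<Rightarrow> nat \<Rightarrow> nat \<Rightarrow> real^3 \<Rightarrow> complex" where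
  "solid_harmonic s l k x =
     (\<Sum>t\<le>(l - k) div 2. of_real (coeff (legendre_deriv l k) (l - k - 2 * t)) * solid_monomial s k (l - k - 2 * t) t x)"

lemma poly3_solid_harmonic: "poly3 (solid_harmonic s l k)"
  unfolding solid_harmonic_def by (intro poly3_sum poly3.intros poly3_solid_monomial)

lemma euler_deriv_solid_harmonic:
  assumes "k \<le> l"
  shows "euler_deriv (solid_harmonic s l k) x = of_nat l * solid_harmonic s l k x"
proof -
  have "k + (l - k - 2 * t) + 2 * t = l" if "t \<le> (l - k) div 2" for t using that assms by linarith
  then show ?thesis
    unfolding solid_harmonic_def
    by (subst euler_deriv_sum) (auto intro!: poly3.intros poly3_solid_monomial sum.cong
        simp: euler_deriv_cmult poly3_solid_monomial euler_deriv_solid_monomial sum_distrib_left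
        simp del: of_nat_add)
qed

lemma solid_harmonic_scale:
  assumes "k \<le> l"
  shows "solid_harmonic s l k (r *\<^sub>R x) = of_real r ^ l * solid_harmonic s l k x"
proof -
  have "k + (l - k - 2 * t) + 2 * t = l" if "t \<le> (l - k) div 2" for t using that assms by linarith
  then show ?thesis
    unfolding solid_harmonic_def
    by (auto intro!: sum.cong simp: solid_monomial_scale sum_distrib_left)
qed

text \<open>Applied to one summand, the Laplacian gives a part \<open>A\<close> with two powers of
  the third coordinate less and a part \<open>B\<close> with one power of |x|^2 less. Shifting the
  index in \<open>B\<close> aligns the exponents, and each pair cancels by the recurrence for the
  Legendre coefficients.\<close>

lemma laplacian_solid_harmonic:
  assumes s: "s\<^sup>2 = -1" and k: "k \<le> l"
  shows "laplacian (solid_harmonic s l k) x = 0"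
proof -
  define n where "n = l - k"
  define N where "N = n div 2"
  define q where "q j = coeff (legendre_deriv l k) j" for j
  define A where "A t = of_real (q (n - 2 * t)) * (of_nat ((n - 2 * t) * (n - 2 * t - 1)) * solid_monomial s k (n - 2 * t - 2) t x)" for t
  define B where "B t = of_real (q (n - 2 * t)) * (of_nat (2 * t * (2 * (k + (n - 2 * t)) + 2 * t + 1)) * solid_monomial s k (n - 2 * t) (t - 1) x)" for t
  have "laplacian (solid_harmonic s l k) x = (\<Sum>t\<le>N. A t + B t)"
    unfolding solid_harmonic_def n_def[symmetric] N_def[symmetric] q_def[symmetric] A_def B_def
    by (subst laplacian_sum) (auto intro!: poly3.intros poly3_solid_monomial sum.cong
        simp: laplacian_cmult poly3_solid_monomial laplacian_solid_monomial[OF s] distrib_left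
        simp del: of_nat_add of_nat_mult)
  also have "\<dots> = (\<Sum>t\<le>N. A t) + (\<Sum>t\<le>N. B t)" by (rule sum.distrib)
  \<comment> \<open>The top summand contains the third coordinate to the power 0 or 1, so its second
    derivative drops out.\<close>
  also have "(\<Sum>t\<le>N. A t) = (\<Sum>t<N. A t)"
  proof -
    have "n - 2 * N = 0 \<or> n - 2 * N = 1" unfolding N_def by presburger
    then have "A N = 0" by (auto simp: A_def)
    then show ?thesis by (simp add: lessThan_Suc_atMost[symmetric])
  qed
  also have "(\<Sum>t\<le>N. B t) = (\<Sum>t<N. B (Suc t))"
  proof -
    have "B 0 = 0" by (simp add: B_def)
    then show ?thesis
      by (simp add: lessThan_Suc_atMost[symmetric] sum.lessThan_Suc_shift del: sum.lessThan_Suc)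
  qed
  also have "(\<Sum>t<N. A t) + (\<Sum>t<N. B (Suc t)) = (\<Sum>t<N. A t + B (Suc t))" by (rule sum.distrib[symmetric])
  also have "\<dots> = 0"
  proof (rule sum.neutral, safe)
    fix t assume "t < N"
    then have t: "2 * t + 2 \<le> n" unfolding N_def by linarith
    define j where "j = n - 2 * t - 2"
    have j: "n - 2 * t = j + 2" "n - 2 * Suc t = j" "n = j + 2 * t + 2" using t by (auto simp: j_def)
    \<comment> \<open>With this value of \<open>l\<close> the factor (j + l + k + 1) (j + k - l)
      becomes -(2 t + 2) (2 (k + j) + 2 t + 3), the negative of the radial coefficient in
      \<open>B (Suc t)\<close>.\<close>
    have l: "real l = real k + real j + 2 * real t + 2" using k t unfolding n_def j_def by (simp add: n_def of_nat_diff)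
    have "real (j + 2) * real (j + 1) * q (j + 2) = (real j + real l + real k + 1) * (real j + real k - real l) * q j"
      unfolding q_def by (rule coeff_legendre_deriv_rec)
    then have "q (j + 2) * real ((j + 2) * (j + 1)) + q j * real (2 * Suc t * (2 * (k + j) + 2 * Suc t + 1)) = 0"
      unfolding l by (simp add: algebra_simps)
    then have "complex_of_real (q (j + 2) * real ((j + 2) * (j + 1)) + q j * real (2 * Suc t * (2 * (k + j) + 2 * Suc t + 1))) = 0"
      by (simp only: of_real_0)
    then have z: "of_real (q (j + 2)) * of_nat ((j + 2) * (j + 1)) + of_real (q j) * of_nat (2 * Suc t * (2 * (k + j) + 2 * Suc t + 1)) = (0 :: complex)"
      by (simp only: of_real_add of_real_mult of_real_of_nat_eq)
    have "A t + B (Suc t) = (of_real (q (j + 2)) * of_nat ((j + 2) * (j + 1))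
        + of_real (q j) * of_nat (2 * Suc t * (2 * (k + j) + 2 * Suc t + 1))) * solid_monomial s k j t x"
      unfolding A_def B_def j by (simp add: distrib_right del: of_nat_add of_nat_mult of_nat_Suc)
    then show "A t + B (Suc t) = 0" unfolding z by simp
  qed
  finally show ?thesis .
qed

text \<open>At radius 1 the homogenizing powers disappear; the exponents skipped by the sum have the
  wrong parity and carry zero coefficients.\<close>

lemma solid_harmonic_sphere:
  assumes k: "k \<le> l" and x: "norm x = 1"
  shows "solid_harmonic s l k x = axial s x ^ k * of_real (poly (legendre_deriv l k) (x $ 3))"
proof -
  define n where "n = l - k"
  let ?f = "\<lambda>j. of_real (coeff (legendre_deriv l k) j) * of_real (x $ 3) ^ j :: complex"
  have "solid_harmonic s l k x = axial s x ^ k * (\<Sum>t\<le>n div 2. ?f (n - 2 * t))"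
    by (simp add: solid_harmonic_def solid_monomial_def radius_sq_eq x n_def sum_distrib_left algebra_simps)
  also have "(\<Sum>t\<le>n div 2. ?f (n - 2 * t)) = (\<Sum>j\<in>(\<lambda>t. n - 2 * t) ` {..n div 2}. ?f j)"
    by (subst sum.reindex) (auto simp: inj_on_def)
  also have "\<dots> = (\<Sum>j\<le>n. ?f j)"
  proof (rule sum.mono_neutral_left)
    show "\<forall>j\<in>{..n} - (\<lambda>t. n - 2 * t) ` {..n div 2}. ?f j = 0"
    proof safe
      fix j assume j: "j \<le> n" "j \<notin> (\<lambda>t. n - 2 * t) ` {..n div 2}"
      have "odd (n - j)"
      proof
        assume "even (n - j)"
        then obtain t where "n - j = 2 * t" by (rule evenE)
        then have "j = n - 2 * t" "t \<in> {..n div 2}" using j by auto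
        then show False using j by blast
      qed
      then show "?f j = 0" using coeff_legendre_deriv_odd[OF k, of j] j by (simp add: n_def)
    qed
  qed auto
  also have "\<dots> = of_real (poly (legendre_deriv l k) (x $ 3))"
    by (simp add: poly_altdef degree_legendre_deriv[OF k] n_def)
  finally show ?thesis .
qed

lemma solid_harmonic_nonzero:
  assumes k: "k \<le> l"
  shows "\<exists>x. norm x = 1 \<and> solid_harmonic s l k x \<noteq> 0"
proof -
  have "infinite {-1<..<(1::real)}" by (rule infinite_Ioo) simp
  then have "infinite ({-1<..<1} - {z. poly (legendre_deriv l k) z = 0})"
    using poly_roots_finite[OF legendre_deriv_nonzero[OF k]] by simp
  then have "{-1<..<1} - {z. poly (legendre_deriv l k) z = 0} \<noteq> {}" by (metis finite.emptyI)
  then obtain z where "z \<in> {-1<..<1} - {z. poly (legendre_deriv l k) z = 0}" by blast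
  then have z: "-1 < z" "z < 1" "poly (legendre_deriv l k) z \<noteq> 0" by auto
  have z2: "z\<^sup>2 < 1" using z by (simp add: abs_square_less_1)
  \<comment> \<open>A point of the sphere at height \<open>z\<close>, which avoids both the roots of
    the polynomial and the poles, where \<open>axial\<close> vanishes.\<close>
  define x :: "real^3" where "x = vector [sqrt (1 - z\<^sup>2), 0, z]"
  have "norm x = 1" using z2 by (simp add: norm_vec_def L2_set_def sum_3 x_def)
  moreover have "axial s x \<noteq> 0" using z2 by (simp add: axial_def x_def)
  ultimately show ?thesis using z solid_harmonic_sphere[OF k, of x s] by (intro exI[of _ x]) (simp add: x_def)
qed

text \<open>On the sphere sin \<theta> is the modulus of x1 + i x2, so the power of sin \<theta> in
  the Legendre function and the phase exp(i m \<phi>) combine to a power of x1 + i x2, or of its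
  conjugate for negative \<open>m\<close>. At the poles and for nonzero \<open>m\<close> the modulus
  is 0, so the convention for \<open>Arg\<close> has no effect.\<close>

lemma sph_harm_sphere:
  assumes m: "- int l \<le> m" "m \<le> int l"
  obtains c :: real and s :: complex and k :: nat where "c \<noteq> 0" "s\<^sup>2 = -1" "k \<le> l"
    "\<And>x. norm x = 1 \<Longrightarrow> sph_harm l m x = of_real c * solid_harmonic s l k x"
proof -
  define k where "k = nat \<bar>m\<bar>"
  define s :: complex where "s = (if m \<ge> 0 then \<i> else - \<i>)"
  \<comment> \<open>Collects the normalization, the factor relating the orders \<open>- k\<close>
    and \<open>k\<close>, and the constant of Rodrigues' formula.\<close>
  define c where "c = sph_norm l m * (if m \<ge> 0 then 1 else (-1) ^ k * fact (l - k) / fact (l + k)) * ((-1) ^ k / (2 ^ l * fact l))"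
  have k: "k \<le> l" using m by (auto simp: k_def)
  have "sph_norm l m > 0" unfolding sph_norm_def by (simp add: add_pos_nonneg)
  then have c: "c \<noteq> 0" by (simp add: c_def)
  have "sph_harm l m x = of_real c * solid_harmonic s l k x" if x: "norm x = 1" for x
  proof -
    let ?z = "Complex (x $ 1) (x $ 2)"
    have n: "(x $ 1)\<^sup>2 + (x $ 2)\<^sup>2 + (x $ 3)\<^sup>2 = 1"
      using x by (simp add: norm_vec_def L2_set_def sum_3)
    have "\<bar>x $ 3\<bar> \<le> 1" using component_le_norm_cart[of x 3] x by simp
    then have cos: "cos (arccos (x $ 3)) = x $ 3" by (intro cos_arccos) auto
    have sq: "sqrt (1 - (x $ 3)\<^sup>2) = cmod ?z" using n by (simp add: cmod_def algebra_simps)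
    have ex: "of_real (cmod ?z ^ k) * exp (\<i> * of_int m * of_real (Arg ?z)) = axial s x ^ k"
    proof (cases "m \<ge> 0")
      case True
      then have "exp (\<i> * of_int m * of_real (Arg ?z)) = cis (Arg ?z) ^ k"
        by (simp add: cis_conv_exp exp_of_nat_mult[symmetric] k_def algebra_simps)
      then have "of_real (cmod ?z ^ k) * exp (\<i> * of_int m * of_real (Arg ?z)) = rcis (cmod ?z) (Arg ?z) ^ k"
        by (simp add: rcis_def power_mult_distrib)
      also have "rcis (cmod ?z) (Arg ?z) = axial s x"
        using True by (simp add: rcis_cmod_Arg axial_def s_def complex_eq_iff)
      finally show ?thesis .
    next
      case False
      then have "of_int m = - (of_nat k :: complex)" by (simp add: k_def)
      then have "exp (\<i> * of_int m * of_real (Arg ?z)) = cnj (cis (Arg ?z)) ^ k"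
        unfolding cis_cnj by (simp add: cis_conv_exp exp_of_nat_mult[symmetric] algebra_simps)
      then have "of_real (cmod ?z ^ k) * exp (\<i> * of_int m * of_real (Arg ?z)) = cnj (rcis (cmod ?z) (Arg ?z)) ^ k"
        by (simp add: rcis_def power_mult_distrib)
      also have "cnj (rcis (cmod ?z) (Arg ?z)) = axial s x"
        using False by (simp add: rcis_cmod_Arg axial_def s_def complex_eq_iff)
      finally show ?thesis .
    qed
    have "assoc_legendre l m (x $ 3) = (if m \<ge> 0 then 1 else (-1) ^ k * fact (l - k) / fact (l + k))
        * ((-1) ^ k / (2 ^ l * fact l)) * cmod ?z ^ k * poly (legendre_deriv l k) (x $ 3)"
      by (simp add: assoc_legendre_def assoc_legendre_nonneg_def legendre_deriv_def sq k_def)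
    then have "sph_harm l m x = of_real (c * cmod ?z ^ k * poly (legendre_deriv l k) (x $ 3)) * exp (\<i> * of_int m * of_real (Arg ?z))"
      unfolding sph_harm_def sph_harm_angles_def cos c_def by (simp add: algebra_simps)
    also have "\<dots> = of_real c * (of_real (cmod ?z ^ k) * exp (\<i> * of_int m * of_real (Arg ?z))) * of_real (poly (legendre_deriv l k) (x $ 3))"
      by simp
    also have "\<dots> = of_real c * solid_harmonic s l k x"
      unfolding ex solid_harmonic_sphere[OF k x] by simp
    finally show ?thesis .
  qed
  moreover have "s\<^sup>2 = -1" by (simp add: s_def)
  ultimately show ?thesis using that c k by blast
qed

section \<open>Integration over spheres\<close>

text \<open>Uniform continuity on the compact product of an interval and the sphere; the resulting
  \<open>d\<close> does not depend on the point, as is required under the surface integral.\<close>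

lemma uniform_on_sphere:
  fixes \<psi> :: "real \<Rightarrow> real^3 \<Rightarrow> complex"
  assumes cont: "continuous_on UNIV (\<lambda>(r, x). \<psi> r x)" and e: "e > 0"
  shows "\<exists>d>0. \<forall>r x. \<bar>r - a\<bar> < d \<longrightarrow> norm x = 1 \<longrightarrow> norm (\<psi> r x - \<psi> a x) < e"
proof -
  have "uniformly_continuous_on (cball a 1 \<times> sphere 0 1) (\<lambda>(r, x). \<psi> r x)"
    by (intro compact_uniformly_continuous continuous_on_subset[OF cont] compact_Times) auto
  then obtain d where d: "d > 0" "\<And>u v. u \<in> cball a 1 \<times> sphere 0 1 \<Longrightarrow> v \<in> cball a 1 \<times> sphere 0 1 \<Longrightarrow> dist v u < d \<Longrightarrow>
      dist (case v of (r, x) \<Rightarrow> \<psi> r x) (case u of (r, x) \<Rightarrow> \<psi> r x) < e"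
    using e unfolding uniformly_continuous_on_def by metis
  show ?thesis
  proof (intro exI[of _ "min d 1"] conjI allI impI)
    fix r and x :: "real^3" assume "\<bar>r - a\<bar> < min d 1" "norm x = 1"
    then show "norm (\<psi> r x - \<psi> a x) < e"
      using d(2)[of "(a, x)" "(r, x)"] by (simp add: dist_norm dist_Pair_Pair abs_minus_commute)
  qed (use d(1) in simp)
qed

lemma continuous_slice:
  assumes "continuous_on UNIV (\<lambda>(r, x). \<psi> r x)"
  shows "continuous_on A (\<psi> r)"
proof -
  have "continuous_on A (\<lambda>x. (\<lambda>(r, x). \<psi> r x) (r, x))"
    by (rule continuous_on_compose2[OF assms]) (auto intro!: continuous_intros)
  then show ?thesis by simp
qed

definition total_area :: real where "total_area = measure surface_measure (space surface_measure)"

lemma surface_integral_bound: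
  fixes f :: "real^3 \<Rightarrow> complex"
  assumes "continuous_on UNIV f" "\<And>x. norm x = 1 \<Longrightarrow> norm (f x) \<le> B"
  shows "norm (\<integral>x. f x \<partial>surface_measure) \<le> B * total_area"
proof -
  interpret finite_measure surface_measure by (rule finite_surface_measure)
  have "norm (\<integral>x. f x \<partial>surface_measure) \<le> (\<integral>x. B \<partial>surface_measure)"
    by (rule order_trans[OF integral_norm_bound integral_mono])
       (use assms in \<open>auto simp: space_surface_measure intro!: continuous_integrable_surface integrable_norm\<close>)
  then show ?thesis by (simp add: total_area_def mult.commute)
qed

lemma surface_integral_continuous:
  fixes \<psi> :: "real \<Rightarrow> real^3 \<Rightarrow> complex"
  assumes cont: "continuous_on UNIV (\<lambda>(r, x). \<psi> r x)"
  shows "continuous_on A (\<lambda>r. \<integral>x. \<psi> r x \<partial>surface_measure)"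
proof (rule continuous_at_imp_continuous_on, rule ballI)
  fix a
  have c: "continuous_on UNIV (\<psi> r)" for r by (rule continuous_slice[OF cont])
  have pos: "total_area \<ge> 0" by (simp add: total_area_def)
  show "isCont (\<lambda>r. \<integral>x. \<psi> r x \<partial>surface_measure) a"
    unfolding continuous_at_eps_delta
  proof (intro allI impI)
    fix e :: real assume e: "e > 0"
    \<comment> \<open>The \<open>+ 1\<close> keeps the quotient meaningful, since at this point
      \<open>total_area\<close> is only known to be nonnegative.\<close>
    then have "e / (total_area + 1) > 0" using pos by simp
    from uniform_on_sphere[OF cont this, of a] obtain d where d: "d > 0"
      "\<And>r x. \<bar>r - a\<bar> < d \<Longrightarrow> norm x = 1 \<Longrightarrow> norm (\<psi> r x - \<psi> a x) < e / (total_area + 1)" by blast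
    show "\<exists>d>0. \<forall>r. dist r a < d \<longrightarrow> dist (\<integral>x. \<psi> r x \<partial>surface_measure) (\<integral>x. \<psi> a x \<partial>surface_measure) < e"
    proof (intro exI[of _ d] conjI allI impI d(1))
      fix r assume "dist r a < d"
      then have "norm (\<integral>x. \<psi> r x - \<psi> a x \<partial>surface_measure) \<le> e / (total_area + 1) * total_area"
        using d(2)[of r] by (intro surface_integral_bound continuous_intros c) (auto simp: dist_norm less_imp_le)
      also have "\<dots> < e" using e pos by (simp add: field_simps)
      finally show "dist (\<integral>x. \<psi> r x \<partial>surface_measure) (\<integral>x. \<psi> a x \<partial>surface_measure) < e"
        using continuous_integrable_surface[OF c] by (simp add: dist_norm)
    qed
  qed
qed

text \<open>The linearization error is bounded by the oscillation of \<psi> in \<open>r\<close>,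
  uniformly over the sphere, and so survives integration.\<close>

lemma surface_integral_derivative:
  fixes \<phi> \<psi> :: "real \<Rightarrow> real^3 \<Rightarrow> complex"
  assumes c\<phi>: "continuous_on UNIV (\<lambda>(r, x). \<phi> r x)" and c\<psi>: "continuous_on UNIV (\<lambda>(r, x). \<psi> r x)"
    and der: "\<And>r x. ((\<lambda>r. \<phi> r x) has_vector_derivative \<psi> r x) (at r)"
  shows "((\<lambda>r. \<integral>x. \<phi> r x \<partial>surface_measure) has_vector_derivative (\<integral>x. \<psi> a x \<partial>surface_measure)) (at a)"
proof -
  note c = continuous_slice[OF c\<phi>, of UNIV] continuous_slice[OF c\<psi>, of UNIV]
  have pos: "total_area \<ge> 0" by (simp add: total_area_def)
  show ?thesis
    unfolding has_vector_derivative_def has_derivative_at_alt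
  proof (intro conjI allI impI)
    show "bounded_linear (\<lambda>h. h *\<^sub>R (\<integral>x. \<psi> a x \<partial>surface_measure))" by (rule bounded_linear_scaleR_left)
    fix e :: real assume e: "e > 0"
    then have "e / (total_area + 1) > 0" using pos by simp
    from uniform_on_sphere[OF c\<psi> this, of a] obtain d where d: "d > 0"
      "\<And>r x. \<bar>r - a\<bar> < d \<Longrightarrow> norm x = 1 \<Longrightarrow> norm (\<psi> r x - \<psi> a x) < e / (total_area + 1)" by blast
    show "\<exists>d>0. \<forall>y. norm (y - a) < d \<longrightarrow>
      norm ((\<integral>x. \<phi> y x \<partial>surface_measure) - (\<integral>x. \<phi> a x \<partial>surface_measure) - (y - a) *\<^sub>R (\<integral>x. \<psi> a x \<partial>surface_measure))
        \<le> e * norm (y - a)"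
    proof (intro exI[of _ d] conjI allI impI d(1))
      fix y assume y: "norm (y - a) < d"
      have pt: "norm (\<phi> y x - \<phi> a x - (y - a) *\<^sub>R \<psi> a x) \<le> \<bar>y - a\<bar> * (e / (total_area + 1))" if x: "norm x = 1" for x
      proof -
        have "norm (\<phi> y x - \<phi> a x - (y - a) *\<^sub>R \<psi> a x) \<le> norm (y - a) * (e / (total_area + 1))"
        proof (rule vector_differentiable_bound_linearization)
          show "((\<lambda>r. \<phi> r x) has_vector_derivative \<psi> r x) (at r within ball a d)" for r
            by (rule has_vector_derivative_at_within[OF der])
          show "closed_segment a y \<subseteq> ball a d"
            using y d(1) by (intro closed_segment_subset) (auto simp: dist_norm norm_minus_commute)
          show "norm (\<psi> r x - \<psi> a x) \<le> e / (total_area + 1)" if "r \<in> ball a d" for r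
            using d(2)[of r x] that x by (auto simp: dist_norm abs_minus_commute less_imp_le)
          show "a \<in> ball a d" using d(1) by simp
        qed
        then show ?thesis by simp
      qed
      have "norm (\<integral>x. \<phi> y x - \<phi> a x - (y - a) *\<^sub>R \<psi> a x \<partial>surface_measure) \<le> \<bar>y - a\<bar> * (e / (total_area + 1)) * total_area"
        using pt by (intro surface_integral_bound continuous_intros c) auto
      also have "\<dots> = \<bar>y - a\<bar> * (e / (total_area + 1) * total_area)" by simp
      also have "\<dots> \<le> \<bar>y - a\<bar> * e" using e pos by (intro mult_left_mono) (auto simp: field_simps)
      finally show "norm ((\<integral>x. \<phi> y x \<partial>surface_measure) - (\<integral>x. \<phi> a x \<partial>surface_measure) - (y - a) *\<^sub>R (\<integral>x. \<psi> a x \<partial>surface_measure))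
        \<le> e * norm (y - a)"
        using continuous_integrable_surface[OF c(1)] continuous_integrable_surface[OF c(2)]
        by (simp add: mult.commute)
    qed
  qed
qed

text \<open>The positive part has a kink at 0 and its square has none, which is why the cutoff below
  appears squared.\<close>

lemma has_real_derivative_max_sq: "((\<lambda>u::real. (max 0 u)\<^sup>2) has_real_derivative 2 * max 0 u) (at u)"
proof -
  consider "u > 0" | "u < 0" | "u = 0" by linarith
  then show ?thesis
  proof cases
    case 1
    have "((\<lambda>u::real. u\<^sup>2) has_real_derivative 2 * u) (at u)" by (auto intro!: derivative_eq_intros)
    from has_field_derivative_transform_within_open[OF this, of "{0<..}" "\<lambda>u. (max 0 u)\<^sup>2"] 1
    show ?thesis by auto
  next
    case 2
    have "((\<lambda>u::real. 0) has_real_derivative 0) (at u)" by simp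
    from has_field_derivative_transform_within_open[OF this, of "{..<0}" "\<lambda>u. (max 0 u)\<^sup>2"] 2
    show ?thesis by auto
  next
    case 3
    have "((\<lambda>h::real. (max 0 h)\<^sup>2 / h) \<longlongrightarrow> 0) (at 0)"
    proof (rule Lim_null_comparison)
      show "((\<lambda>h::real. \<bar>h\<bar>) \<longlongrightarrow> 0) (at 0)" by (auto intro!: tendsto_eq_intros)
      show "\<forall>\<^sub>F h in at (0::real). norm ((max 0 h)\<^sup>2 / h) \<le> \<bar>h\<bar>"
        by (intro always_eventually) (auto simp: max_def power2_eq_square)
    qed
    then show ?thesis using 3 by (simp add: has_field_derivative_iff)
  qed
qed

text \<open>Differentiate the hypothesis twice with respect to \<open>t\<close>, dividing by \<open>4 t\<close> in between.\<close>
lemma moment_zero_imp_zero: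
  fixes c :: "real \<Rightarrow> complex"
  assumes cont: "continuous_on {0..1} c"
    and zero: "\<And>t. 0 < t \<Longrightarrow> t < 1 \<Longrightarrow> integral {0..t} (\<lambda>r. (t\<^sup>2 - r\<^sup>2)\<^sup>2 *\<^sub>R c r) = 0"
    and r: "0 < r" "r < 1"
  shows "c r = 0"
proof -
  define g where "g k t = integral {0..t} (\<lambda>r. r ^ k *\<^sub>R c r)" for k t
  have ck: "continuous_on {0..1} (\<lambda>r. r ^ k *\<^sub>R c r)" for k by (intro continuous_intros cont)
  have gd: "(g k has_vector_derivative t ^ k *\<^sub>R c t) (at t)" if "0 < t" "t < 1" for k t
  proof -
    have "(g k has_vector_derivative t ^ k *\<^sub>R c t) (at t within {0..1})"
      unfolding g_def using that by (intro integral_has_vector_derivative ck) auto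
    then show ?thesis using that by (simp add: at_within_Icc_at)
  qed
  have unique: "D t = 0" if "0 < t" "t < 1" "\<And>t. 0 < t \<Longrightarrow> t < 1 \<Longrightarrow> h t = 0" "(h has_vector_derivative D t) (at t)"
    for t and h D :: "real \<Rightarrow> complex"
  proof -
    have "(h has_vector_derivative 0) (at t)"
      by (rule has_vector_derivative_transform_within_open[of "\<lambda>_. 0" 0 t "{0<..<1}"]) (use that in auto)
    then show ?thesis using vector_derivative_unique_at that(4) by blast
  qed
  have int: "(\<lambda>r. r ^ k *\<^sub>R c r) integrable_on {0..t}" if "0 < t" "t < 1" for k t
    using that by (intro integrable_continuous_real continuous_on_subset[OF ck]) auto
  have e1: "t ^ 4 *\<^sub>R g 0 t - (2 * t\<^sup>2) *\<^sub>R g 2 t + g 4 t = 0" if t: "0 < t" "t < 1" for t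
  proof -
    have "((\<lambda>r. t ^ 4 *\<^sub>R (r ^ 0 *\<^sub>R c r) - (2 * t\<^sup>2) *\<^sub>R (r ^ 2 *\<^sub>R c r) + r ^ 4 *\<^sub>R c r)
      has_integral t ^ 4 *\<^sub>R g 0 t - (2 * t\<^sup>2) *\<^sub>R g 2 t + g 4 t) {0..t}"
      unfolding g_def by (intro has_integral_add has_integral_diff has_integral_cmul integrable_integral int t)
    moreover have "t ^ 4 *\<^sub>R (r ^ 0 *\<^sub>R c r) - (2 * t\<^sup>2) *\<^sub>R (r ^ 2 *\<^sub>R c r) + r ^ 4 *\<^sub>R c r = (t\<^sup>2 - r\<^sup>2)\<^sup>2 *\<^sub>R c r" for r
      by (simp add: power2_diff algebra_simps power_mult[symmetric] flip: scaleR_add_left scaleR_diff_left)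
    ultimately show ?thesis using zero[OF t] by (simp add: integral_unique)
  qed
  have e2: "t\<^sup>2 *\<^sub>R g 0 t - g 2 t = 0" if t: "0 < t" "t < 1" for t
  proof -
    \<comment> \<open>The contributions of the upper limit, t^4 c(t) - 2 t^4 c(t) + t^4 c(t),
      cancel, so only the explicit powers of \<open>t\<close> are differentiated.\<close>
    have "(4 * t ^ 3) *\<^sub>R g 0 t - (4 * t) *\<^sub>R g 2 t = 0"
    proof (rule unique[OF t e1])
      show "((\<lambda>t. t ^ 4 *\<^sub>R g 0 t - (2 * t\<^sup>2) *\<^sub>R g 2 t + g 4 t) has_vector_derivative
         ((4 * t ^ 3) *\<^sub>R g 0 t - (4 * t) *\<^sub>R g 2 t)) (at t)"
        by (rule has_vector_derivative_eq_rhs, (rule derivative_intros gd t | (rule derivative_eq_intros, simp, simp))+)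
           (auto simp: scaleR_conv_of_real algebra_simps power2_eq_square power4_eq_xxxx power3_eq_cube)
    qed
    also have "(4 * t ^ 3) *\<^sub>R g 0 t - (4 * t) *\<^sub>R g 2 t = (4 * t) *\<^sub>R (t\<^sup>2 *\<^sub>R g 0 t - g 2 t)"
      by (simp add: algebra_simps power3_eq_cube power2_eq_square)
    finally show ?thesis using t by simp
  qed
  have e3: "g 0 t = 0" if t: "0 < t" "t < 1" for t
  proof -
    have "(2 * t) *\<^sub>R g 0 t = 0"
    proof (rule unique[OF t e2])
      show "((\<lambda>t. t\<^sup>2 *\<^sub>R g 0 t - g 2 t) has_vector_derivative (2 * t) *\<^sub>R g 0 t) (at t)"
        by (rule has_vector_derivative_eq_rhs, (rule derivative_intros gd t | (rule derivative_eq_intros, simp, simp))+)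
           (auto simp: algebra_simps)
    qed
    then show ?thesis using t by simp
  qed
  show ?thesis using unique[OF r, of "g 0" "\<lambda>t. t ^ 0 *\<^sub>R c t"] e3 gd[OF r, of 0] by simp
qed

section \<open>Radial integrals and dilations\<close>

abbreviation unit_interval :: "real measure" where
  "unit_interval \<equiv> restrict_space lborel {0<..<1}"

lemma radial_measure_integral:
  fixes f :: "real \<Rightarrow> 'b::{banach, second_countable_topology}"
  assumes [measurable]: "f \<in> borel_measurable borel"
  shows "(\<integral>r. f r \<partial>radial_measure) = (\<integral>r. r\<^sup>2 *\<^sub>R f r \<partial>unit_interval)"
proof -
  have "(\<integral>r. f r \<partial>radial_measure) = (\<integral>r. (indicator {0<..<1} r * r\<^sup>2) *\<^sub>R f r \<partial>lborel)"
    unfolding radial_measure_def by (rule integral_density) auto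
  also have "\<dots> = (\<integral>r. indicator {0<..<1} r *\<^sub>R (r\<^sup>2 *\<^sub>R f r) \<partial>lborel)" by simp
  also have "\<dots> = (\<integral>r. r\<^sup>2 *\<^sub>R f r \<partial>unit_interval)"
    by (rule integral_restrict_space[symmetric]) auto
  finally show ?thesis .
qed

lemma continuous_integrable_unit_interval:
  fixes f :: "real \<Rightarrow> 'b::euclidean_space"
  assumes "continuous_on {0..1} f"
  shows "integrable unit_interval f" and "(\<integral>r. f r \<partial>unit_interval) = integral {0..1} f"
proof -
  have si: "set_integrable lborel {0..1} f"
    unfolding set_integrable_def using borel_integrable_compact[OF _ assms] by (simp add: indicator_scaleR_eq_if)
  then have so: "set_integrable lborel {0<..<1} f"
    by (rule set_integrable_subset) auto
  then show "integrable unit_interval f"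
    by (simp add: integrable_restrict_space set_integrable_def)
  have "(\<integral>r. f r \<partial>unit_interval) = (LBINT r:{0<..<1}. f r)"
    by (simp add: integral_restrict_space set_lebesgue_integral_def)
  also have "\<dots> = integral {0<..<1} f" by (rule set_borel_integral_eq_integral(2)[OF so])
  also have "\<dots> = integral {0..1} f" by (simp add: integral_open_interval_real)
  finally show "(\<integral>r. f r \<partial>unit_interval) = integral {0..1} f" .
qed

lemma sphere_integral_cong:
  assumes "\<And>x. norm x = 1 \<Longrightarrow> f x = h x"
  shows "(\<integral>x. f x \<partial>surface_measure) = (\<integral>x. h x \<partial>surface_measure)"
  using assms by (intro Bochner_Integration.integral_cong) (auto simp: space_surface_measure)

lemma continuous_dilate:
  assumes "continuous_on UNIV f"
  shows "continuous_on UNIV (\<lambda>(r, x). f (r *\<^sub>R (x :: real^3)))"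
  unfolding case_prod_beta
  by (rule continuous_on_compose2[OF assms]) (auto intro!: continuous_intros)

lemma has_vector_derivative_dilate:
  assumes "F differentiable at (r *\<^sub>R x)"
  shows "((\<lambda>r. F (r *\<^sub>R x)) has_vector_derivative
    (\<Sum>i\<in>UNIV. of_real (x $ i) * (partial_deriv i F (r *\<^sub>R x) :: complex))) (at r)"
proof -
  let ?D = "frechet_derivative F (at (r *\<^sub>R x))"
  have lin: "linear ?D" by (rule linear_frechet_derivative[OF assms])
  have "((\<lambda>r. r *\<^sub>R x) has_derivative (\<lambda>t. t *\<^sub>R x)) (at r)" by (auto intro!: derivative_eq_intros)
  from has_derivative_compose[OF this] assms
  have "((\<lambda>r. F (r *\<^sub>R x)) has_derivative (\<lambda>t. ?D (t *\<^sub>R x))) (at r)"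
    by (simp add: frechet_derivative_works)
  moreover have "?D (t *\<^sub>R x) = t *\<^sub>R (\<Sum>i\<in>UNIV. of_real (x $ i) * partial_deriv i F (r *\<^sub>R x))" for t
  proof -
    have "?D x = ?D (\<Sum>i\<in>UNIV. x $ i *\<^sub>R axis i 1)"
      using basis_expansion[of x] by (simp add: scalar_mult_eq_scaleR)
    also have "\<dots> = (\<Sum>i\<in>UNIV. x $ i *\<^sub>R ?D (axis i 1))"
      by (simp add: linear_sum[OF lin] linear_scale[OF lin])
    finally show ?thesis
      by (simp only: linear_scale[OF lin] partial_deriv_def scaleR_conv_of_real[where 'a = complex])
  qed
  ultimately show ?thesis by (simp add: has_vector_derivative_def)
qed

text \<open>Its square is a C^1 substitute for the indicator of the ball of radius \<open>t\<close>,
  so that multiplying by it yields C^1 fields of compact support.\<close>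

abbreviation cutoff :: "real \<Rightarrow> real^3 \<Rightarrow> real" where
  "cutoff t x \<equiv> max 0 (t\<^sup>2 - (norm x)\<^sup>2)"

lemma cutoff_sq_has_derivative:
  "((\<lambda>x. (cutoff t x)\<^sup>2) has_derivative (\<lambda>h. 2 * cutoff t x * (- 2 * (x \<bullet> h)))) (at x)"
proof -
  have "((\<lambda>x. t\<^sup>2 - (norm x)\<^sup>2) has_derivative (\<lambda>h. - 2 * (x \<bullet> h))) (at x)"
    unfolding power2_norm_eq_inner by (auto intro!: derivative_eq_intros simp: inner_commute)
  from has_derivative_compose[OF this has_real_derivative_max_sq[unfolded has_field_derivative_def]]
  show ?thesis .
qed

section \<open>Spherical averages against a homogeneous harmonic polynomial\<close>

locale solid =
  fixes p :: "real^3 \<Rightarrow> complex" and l :: nat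
  assumes poly3: "poly3 p"
    and harmonic: "\<And>x. laplacian p x = 0"
    and euler: "\<And>x. euler_deriv p x = of_nat l * p x"
    and scale: "\<And>r x. p (r *\<^sub>R x) = of_real r ^ l * p x"
begin

definition amplitude :: "(real^3 \<Rightarrow> complex) \<Rightarrow> real \<Rightarrow> complex" where
  "amplitude F r = (\<integral>x. p x * F (r *\<^sub>R x) \<partial>surface_measure)"

definition amplitude_deriv :: "(real^3 \<Rightarrow> complex) \<Rightarrow> real \<Rightarrow> complex" where
  "amplitude_deriv F r = (\<integral>x. p x * (\<Sum>i\<in>UNIV. of_real (x $ i) * partial_deriv i F (r *\<^sub>R x)) \<partial>surface_measure)"

lemma continuous_p: "continuous_on A p"
  by (intro smooth_continuous poly3_smooth poly3)

lemma amplitude_integrand_continuous: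
  assumes "smooth F"
  shows "continuous_on UNIV (\<lambda>(r, x). p x * F (r *\<^sub>R x))"
    and "continuous_on UNIV (\<lambda>(r, x). p x * (\<Sum>i\<in>UNIV. of_real (x $ i) * partial_deriv i F (r *\<^sub>R x)))"
proof -
  have c: "continuous_on UNIV (\<lambda>z :: real \<times> (real^3). p (snd z))"
    by (rule continuous_on_compose2[OF continuous_p[of UNIV]]) (auto intro!: continuous_intros)
  note d = continuous_dilate[OF smooth_continuous[OF assms], unfolded case_prod_beta]
    continuous_dilate[OF smooth_continuous_partial[OF assms], unfolded case_prod_beta]
  show "continuous_on UNIV (\<lambda>(r, x). p x * F (r *\<^sub>R x))"
    "continuous_on UNIV (\<lambda>(r, x). p x * (\<Sum>i\<in>UNIV. of_real (x $ i) * partial_deriv i F (r *\<^sub>R x)))"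
    unfolding case_prod_beta by (intro continuous_intros c d)+
qed

lemma amplitude_has_derivative:
  assumes F: "smooth F"
  shows "(amplitude F has_vector_derivative amplitude_deriv F r) (at r)"
  unfolding amplitude_def[abs_def] amplitude_deriv_def
  by (rule surface_integral_derivative[OF amplitude_integrand_continuous[OF F]])
     (intro has_vector_derivative_mult_right has_vector_derivative_dilate smooth_differentiable F)

lemma amplitude_continuous:
  assumes "smooth F"
  shows "continuous_on A (amplitude F)" and "continuous_on A (amplitude_deriv F)"
  unfolding amplitude_def[abs_def] amplitude_deriv_def[abs_def]
  by (rule surface_integral_continuous[OF amplitude_integrand_continuous(1)[OF assms]]
      surface_integral_continuous[OF amplitude_integrand_continuous(2)[OF assms]])+

definition grad_amplitude :: "(real^3 \<Rightarrow> complex) \<Rightarrow> real \<Rightarrow> complex" where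
  "grad_amplitude F r = (\<integral>x. (\<Sum>i\<in>UNIV. partial_deriv i p (r *\<^sub>R x) * partial_deriv i F (r *\<^sub>R x)) \<partial>surface_measure)"

lemma continuous_grad_product:
  assumes "smooth F"
  shows "continuous_on UNIV (\<lambda>x. \<Sum>i\<in>UNIV. partial_deriv i p x * partial_deriv i F x)"
  by (intro continuous_intros smooth_continuous_partial poly3_smooth poly3 assms)

lemma grad_amplitude_continuous:
  assumes "smooth F"
  shows "continuous_on A (grad_amplitude F)"
  unfolding grad_amplitude_def[abs_def]
  by (rule surface_integral_continuous[OF continuous_dilate[OF continuous_grad_product[OF assms]]])

text \<open>The divergence of the squared cutoff times \<open>F\<close> times the gradient of
  \<open>p\<close> integrates to zero. Harmonicity removes the Laplacian of \<open>p\<close>, and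
  the gradient of the weight, which is -4 x times the cutoff, meets the gradient of \<open>p\<close>
  in the Euler derivative l p.\<close>

lemma ball_green_identity:
  assumes F: "smooth F" and t: "0 < t" "t < 1"
  shows "(\<integral>x. (cutoff t x)\<^sup>2 *\<^sub>R (\<Sum>i\<in>UNIV. partial_deriv i p x * partial_deriv i F x) \<partial>ball_measure)
      = (\<integral>x. (4 * cutoff t x) *\<^sub>R (of_nat l * (p x * F x)) \<partial>ball_measure)"
proof -
  let ?h = "\<lambda>i x. (cutoff t x)\<^sup>2 *\<^sub>R (partial_deriv i p x * F x)"
  have pi: "poly3 (partial_deriv i p)" "poly3 (partial_deriv i (partial_deriv i p))" for i
    by (intro poly3_partial_deriv poly3)+
  define D where "D i x = (- 4 * cutoff t x * x $ i) *\<^sub>R (partial_deriv i p x * F x)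
      + (cutoff t x)\<^sup>2 *\<^sub>R (partial_deriv i (partial_deriv i p) x * F x + partial_deriv i p x * partial_deriv i F x)" for i x
  have der: "(?h i has_derivative (\<lambda>h. (cutoff t x)\<^sup>2 *\<^sub>R frechet_derivative (\<lambda>x. partial_deriv i p x * F x) (at x) h
        + (2 * cutoff t x * (- 2 * (x \<bullet> h))) *\<^sub>R (partial_deriv i p x * F x))) (at x)" for i x
    by (intro has_derivative_scaleR cutoff_sq_has_derivative)
       (simp add: frechet_derivative_works[symmetric] poly3_differentiable[OF pi(1)] smooth_differentiable[OF F])
  have pd: "partial_deriv i (?h i) = D i" for i
  proof
    fix x
    show "partial_deriv i (?h i) x = D i x"
      unfolding partial_deriv_eq[OF der] D_def
      using partial_deriv_mult[OF poly3_differentiable[OF pi(1)] smooth_differentiable[OF F], of i i x]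
      by (simp add: partial_deriv_def[symmetric] inner_axis algebra_simps)
  qed
  have cc: "continuous_on UNIV (cutoff t)" by (intro continuous_intros)
  have cp: "continuous_on UNIV (partial_deriv i p)" "continuous_on UNIV (partial_deriv i (partial_deriv i p))"
    "continuous_on UNIV F" "continuous_on UNIV (partial_deriv i F)" for i
    by (intro smooth_continuous smooth_continuous_partial poly3_smooth pi F)+
  have cD: "continuous_on UNIV (D i)" for i
    unfolding D_def[abs_def] by (intro continuous_intros cp)
  have z: "cutoff t x = 0" if "norm x \<ge> t" for x
  proof -
    have "t\<^sup>2 \<le> (norm x)\<^sup>2" using that t by (intro power_mono) auto
    then show ?thesis by simp
  qed
  have "0 = (\<integral>x. D i x \<partial>lborel)" for i
    unfolding pd[symmetric]
  proof (rule integral_partial_deriv_zero[where R = t, symmetric])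
    show "?h i differentiable at x" for x using der by (auto simp: differentiable_def)
  qed (use cD pd z in auto)
  moreover have "(\<integral>x. D i x \<partial>lborel) = (\<integral>x. D i x \<partial>ball_measure)" for i
    by (rule integral_ball_eq_lborel[symmetric, OF borel_measurable_continuous_onI[OF cD]])
       (use z t in \<open>simp add: D_def\<close>)
  ultimately have "0 = (\<Sum>i\<in>UNIV. (\<integral>x. D i x \<partial>ball_measure))" by simp
  also have "\<dots> = (\<integral>x. (\<Sum>i\<in>UNIV. D i x) \<partial>ball_measure)"
    by (intro Bochner_Integration.integral_sum[symmetric] continuous_integrable_ball cD)
  also have "\<dots> = (\<integral>x. (cutoff t x)\<^sup>2 *\<^sub>R (\<Sum>i\<in>UNIV. partial_deriv i p x * partial_deriv i F x)
      - (4 * cutoff t x) *\<^sub>R (of_nat l * (p x * F x)) \<partial>ball_measure)"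
  proof (rule Bochner_Integration.integral_cong[OF refl])
    fix x
    have "(\<Sum>i\<in>UNIV. D i x) = (cutoff t x)\<^sup>2 *\<^sub>R (\<Sum>i\<in>UNIV. partial_deriv i p x * partial_deriv i F x)
        - (4 * cutoff t x) *\<^sub>R (euler_deriv p x * F x) + (cutoff t x)\<^sup>2 *\<^sub>R (laplacian p x * F x)"
      by (simp add: D_def euler_deriv_def laplacian_def sum_3 scaleR_conv_of_real algebra_simps)
    then show "(\<Sum>i\<in>UNIV. D i x) = (cutoff t x)\<^sup>2 *\<^sub>R (\<Sum>i\<in>UNIV. partial_deriv i p x * partial_deriv i F x)
      - (4 * cutoff t x) *\<^sub>R (of_nat l * (p x * F x))"
      by (simp add: harmonic euler mult.assoc)
  qed
  also have "\<dots> = (\<integral>x. (cutoff t x)\<^sup>2 *\<^sub>R (\<Sum>i\<in>UNIV. partial_deriv i p x * partial_deriv i F x) \<partial>ball_measure)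
      - (\<integral>x. (4 * cutoff t x) *\<^sub>R (of_nat l * (p x * F x)) \<partial>ball_measure)"
    by (intro Bochner_Integration.integral_diff continuous_integrable_ball continuous_intros cp continuous_p)
  finally show ?thesis by simp
qed

text \<open>The right-hand side is the derivative of l r^(l+1) W(r), the flux term of Green's
  identity on the ball of radius \<open>r\<close>; the left-hand side is the derivative of the
  volume term. The weighted identity on balls of radius \<open>t\<close> equates all moments against
  (t^2 - r^2)^2, which forces pointwise equality.\<close>

lemma grad_amplitude_eq:
  assumes F: "smooth F" and r: "0 < r" "r < 1"
  shows "r\<^sup>2 *\<^sub>R grad_amplitude F r
    = (real (l * (l + 1)) * r ^ l) *\<^sub>R amplitude F r + (real l * r ^ (l + 1)) *\<^sub>R amplitude_deriv F r"
proof -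
  let ?W = "amplitude F" and ?W' = "amplitude_deriv F" and ?A = "grad_amplitude F"
  define b' where "b' r = (real (l * (l + 1)) * r ^ l) *\<^sub>R ?W r + (real l * r ^ (l + 1)) *\<^sub>R ?W' r" for r
  note cW = amplitude_continuous[OF F] grad_amplitude_continuous[OF F]
  have cb: "continuous_on A b'" for A
    unfolding b'_def by (intro continuous_intros cW)
  have "r\<^sup>2 *\<^sub>R ?A r - b' r = 0"
  proof (rule moment_zero_imp_zero[OF _ _ r])
    show "continuous_on {0..1} (\<lambda>r. r\<^sup>2 *\<^sub>R ?A r - b' r)" by (intro continuous_intros cW cb)
    fix t :: real assume t: "0 < t" "t < 1"
    let ?m = "\<lambda>r. max 0 (t\<^sup>2 - r\<^sup>2)"
    have le: "t\<^sup>2 \<ge> r\<^sup>2" if "r \<in> {0..t}" for r using that by (auto intro: power_mono)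
    have cut: "integral {0..1} (\<lambda>r. h r *\<^sub>R (f r :: complex)) = integral {0..t} (\<lambda>r. h r *\<^sub>R f r)"
      if "\<And>r. r \<ge> t \<Longrightarrow> h r = 0" for h f
      by (rule integral_spike_set, rule negligible_subset[OF negligible_empty], use t that in \<open>force\<close>,
          rule negligible_subset[OF negligible_empty], use t that in force)
    have m0: "?m r = 0" if "r \<ge> t" for r
      using power_mono[OF that, of 2] t by simp
    \<comment> \<open>\<open>h\<close> is taken even because the norm of
      \<open>r *\<^sub>R x\<close> is \<open>\<bar>r\<bar>\<close> and the radial integral formally
      runs over all real \<open>r\<close>.\<close>
    have radial: "(\<integral>x. h (norm x) *\<^sub>R k x \<partial>ball_measure) = integral {0..t} (\<lambda>r. r\<^sup>2 *\<^sub>R (h r *\<^sub>R (\<integral>x. k (r *\<^sub>R x) \<partial>surface_measure)))"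
      if h: "continuous_on UNIV h" "\<And>r. h \<bar>r\<bar> = h r" "\<And>r. r \<ge> t \<Longrightarrow> h r = 0" and k: "continuous_on UNIV k"
      for h :: "real \<Rightarrow> real" and k :: "real^3 \<Rightarrow> complex"
    proof -
      have c: "continuous_on UNIV (\<lambda>x. h (norm x) *\<^sub>R k x)"
        by (intro continuous_intros continuous_on_compose2[OF h(1)] k) auto
      have cs: "continuous_on A (\<lambda>r. \<integral>x. k (r *\<^sub>R x) \<partial>surface_measure)" for A
        by (rule surface_integral_continuous[OF continuous_dilate[OF k]])
      have ch: "continuous_on A h" for A by (rule continuous_on_subset[OF h(1)]) simp
      have "(\<integral>x. h (norm x) *\<^sub>R k x \<partial>ball_measure)
          = (\<integral>r. (\<integral>x. h (norm (r *\<^sub>R x)) *\<^sub>R k (r *\<^sub>R x) \<partial>surface_measure) \<partial>radial_measure)"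
        by (rule polar_integral(1)[OF borel_measurable_continuous_onI[OF c] continuous_integrable_ball[OF c]])
      also have "\<dots> = (\<integral>r. h r *\<^sub>R (\<integral>x. k (r *\<^sub>R x) \<partial>surface_measure) \<partial>radial_measure)"
      proof (rule Bochner_Integration.integral_cong[OF refl])
        fix r
        have "(\<integral>x. h (norm (r *\<^sub>R x)) *\<^sub>R k (r *\<^sub>R x) \<partial>surface_measure) = (\<integral>x. h r *\<^sub>R k (r *\<^sub>R x) \<partial>surface_measure)"
          by (rule sphere_integral_cong) (simp add: h(2))
        then show "(\<integral>x. h (norm (r *\<^sub>R x)) *\<^sub>R k (r *\<^sub>R x) \<partial>surface_measure) = h r *\<^sub>R (\<integral>x. k (r *\<^sub>R x) \<partial>surface_measure)"
          by simp
      qed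
      also have "\<dots> = (\<integral>r. r\<^sup>2 *\<^sub>R (h r *\<^sub>R (\<integral>x. k (r *\<^sub>R x) \<partial>surface_measure)) \<partial>unit_interval)"
        by (intro radial_measure_integral borel_measurable_continuous_onI continuous_intros ch cs)
      also have "\<dots> = integral {0..1} (\<lambda>r. r\<^sup>2 *\<^sub>R (h r *\<^sub>R (\<integral>x. k (r *\<^sub>R x) \<partial>surface_measure)))"
        by (intro continuous_integrable_unit_interval continuous_intros ch cs)
      also have "\<dots> = integral {0..t} (\<lambda>r. r\<^sup>2 *\<^sub>R (h r *\<^sub>R (\<integral>x. k (r *\<^sub>R x) \<partial>surface_measure)))"
        using cut[of "\<lambda>r. r\<^sup>2 * h r"] h(3) by simp
      finally show ?thesis .
    qed
    have "integral {0..t} (\<lambda>r. r\<^sup>2 *\<^sub>R ((?m r)\<^sup>2 *\<^sub>R ?A r))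
        = integral {0..t} (\<lambda>r. r\<^sup>2 *\<^sub>R ((4 * ?m r) *\<^sub>R (\<integral>x. of_nat l * (p (r *\<^sub>R x) * F (r *\<^sub>R x)) \<partial>surface_measure)))"
      using ball_green_identity[OF F t]
        radial[of "\<lambda>r. (?m r)\<^sup>2", OF _ _ _ continuous_grad_product[OF F]]
        radial[of "\<lambda>r. 4 * ?m r" "\<lambda>x. of_nat l * (p x * F x)"] m0
      by (simp add: continuous_intros continuous_p smooth_continuous[OF F] grad_amplitude_def)
    also have "(\<lambda>r. \<integral>x. of_nat l * (p (r *\<^sub>R x) * F (r *\<^sub>R x)) \<partial>surface_measure) = (\<lambda>r. (real l * r ^ l) *\<^sub>R ?W r)"
      by (simp add: amplitude_def scale mult.assoc scaleR_conv_of_real[where 'a = complex])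
    finally have "integral {0..t} (\<lambda>r. r\<^sup>2 *\<^sub>R ((?m r)\<^sup>2 *\<^sub>R ?A r))
        = integral {0..t} (\<lambda>r. r\<^sup>2 *\<^sub>R ((4 * ?m r) *\<^sub>R ((real l * r ^ l) *\<^sub>R ?W r)))" .
    then have green: "integral {0..t} (\<lambda>r. (t\<^sup>2 - r\<^sup>2)\<^sup>2 *\<^sub>R (r\<^sup>2 *\<^sub>R ?A r))
        = integral {0..t} (\<lambda>r. (4 * r * (t\<^sup>2 - r\<^sup>2) * (real l * r ^ (l + 1))) *\<^sub>R ?W r)"
    proof (rule box_equals)
      show "integral {0..t} (\<lambda>r. r\<^sup>2 *\<^sub>R ((?m r)\<^sup>2 *\<^sub>R ?A r)) = integral {0..t} (\<lambda>r. (t\<^sup>2 - r\<^sup>2)\<^sup>2 *\<^sub>R (r\<^sup>2 *\<^sub>R ?A r))"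
        using le by (intro Henstock_Kurzweil_Integration.integral_cong) (simp add: max_def mult.commute)
      show "integral {0..t} (\<lambda>r. r\<^sup>2 *\<^sub>R ((4 * ?m r) *\<^sub>R ((real l * r ^ l) *\<^sub>R ?W r)))
        = integral {0..t} (\<lambda>r. (4 * r * (t\<^sup>2 - r\<^sup>2) * (real l * r ^ (l + 1))) *\<^sub>R ?W r)"
        using le by (intro Henstock_Kurzweil_Integration.integral_cong)
          (simp add: max_def power2_eq_square mult.commute mult.left_commute)
    qed
    \<comment> \<open>Integration by parts: the antiderivative (t^2 - r^2)^2 l r^(l+1) W vanishes at
      \<open>t\<close> through the weight and at 0 through the power of \<open>r\<close>.\<close>
    have "((\<lambda>r. (t\<^sup>2 - r\<^sup>2)\<^sup>2 *\<^sub>R b' r - (4 * r * (t\<^sup>2 - r\<^sup>2) * (real l * r ^ (l + 1))) *\<^sub>R ?W r) has_integral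
       ((t\<^sup>2 - t\<^sup>2)\<^sup>2 * (real l * t ^ (l + 1))) *\<^sub>R ?W t - ((t\<^sup>2 - 0\<^sup>2)\<^sup>2 * (real l * 0 ^ (l + 1))) *\<^sub>R ?W 0) {0..t}"
    proof (rule fundamental_theorem_of_calculus)
      fix r
      have "((\<lambda>r. (t\<^sup>2 - r\<^sup>2)\<^sup>2 * (real l * r ^ (l + 1))) has_real_derivative
         2 * (t\<^sup>2 - r\<^sup>2) * (- (2 * r)) * (real l * r ^ (l + 1)) + (t\<^sup>2 - r\<^sup>2)\<^sup>2 * (real l * (real (l + 1) * r ^ l))) (at r within {0..t})"
      proof -
        have "((\<lambda>r. (t\<^sup>2 - r\<^sup>2)\<^sup>2) has_real_derivative 2 * (t\<^sup>2 - r\<^sup>2) * (- (2 * r))) (at r within {0..t})"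
          by (auto intro!: derivative_eq_intros)
        moreover have "((\<lambda>r. real l * r ^ (l + 1)) has_real_derivative real l * (real (l + 1) * r ^ l)) (at r within {0..t})"
          using DERIV_cmult[OF DERIV_power[OF DERIV_ident], of "real l" "l + 1" r "{0..t}"] by simp
        ultimately show ?thesis using DERIV_mult' by (fastforce simp: add.commute)
      qed
      from has_vector_derivative_scaleR[OF this has_vector_derivative_at_within[OF amplitude_has_derivative[OF F]]]
      show "((\<lambda>r. ((t\<^sup>2 - r\<^sup>2)\<^sup>2 * (real l * r ^ (l + 1))) *\<^sub>R ?W r) has_vector_derivative
         (t\<^sup>2 - r\<^sup>2)\<^sup>2 *\<^sub>R b' r - (4 * r * (t\<^sup>2 - r\<^sup>2) * (real l * r ^ (l + 1))) *\<^sub>R ?W r) (at r within {0..t})"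
        by (rule has_vector_derivative_eq_rhs) (simp add: b'_def scaleR_conv_of_real algebra_simps)
    qed (use t in simp)
    then have h: "((\<lambda>r. (t\<^sup>2 - r\<^sup>2)\<^sup>2 *\<^sub>R b' r - (4 * r * (t\<^sup>2 - r\<^sup>2) * (real l * r ^ (l + 1))) *\<^sub>R ?W r) has_integral 0) {0..t}"
      by simp
    have i: "(\<lambda>r. (4 * r * (t\<^sup>2 - r\<^sup>2) * (real l * r ^ (l + 1))) *\<^sub>R ?W r) integrable_on {0..t}"
      "(\<lambda>r. (t\<^sup>2 - r\<^sup>2)\<^sup>2 *\<^sub>R (r\<^sup>2 *\<^sub>R ?A r)) integrable_on {0..t}"
      by (intro integrable_continuous_real continuous_intros cW)+
    have "((\<lambda>r. (t\<^sup>2 - r\<^sup>2)\<^sup>2 *\<^sub>R (r\<^sup>2 *\<^sub>R ?A r) - (((t\<^sup>2 - r\<^sup>2)\<^sup>2 *\<^sub>R b' r - (4 * r * (t\<^sup>2 - r\<^sup>2) * (real l * r ^ (l + 1))) *\<^sub>R ?W r)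
          + (4 * r * (t\<^sup>2 - r\<^sup>2) * (real l * r ^ (l + 1))) *\<^sub>R ?W r)) has_integral
        integral {0..t} (\<lambda>r. (t\<^sup>2 - r\<^sup>2)\<^sup>2 *\<^sub>R (r\<^sup>2 *\<^sub>R ?A r)) -
        (0 + integral {0..t} (\<lambda>r. (4 * r * (t\<^sup>2 - r\<^sup>2) * (real l * r ^ (l + 1))) *\<^sub>R ?W r))) {0..t}"
      by (intro has_integral_diff has_integral_add h integrable_integral i)
    then show "integral {0..t} (\<lambda>r. (t\<^sup>2 - r\<^sup>2)\<^sup>2 *\<^sub>R (r\<^sup>2 *\<^sub>R ?A r - b' r)) = 0"
      unfolding green by (simp add: integral_unique scaleR_diff_right)
  qed
  then show ?thesis by (simp add: b'_def)
qed

section \<open>Profiles r^l s(r^2) and the separated functions\<close>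

definition profile :: "real poly \<Rightarrow> real \<Rightarrow> real" where
  "profile s r = r ^ l * poly s (r\<^sup>2)"

text \<open>\<open>r\<close> times the derivative of the profile; unlike the derivative it involves no truncated exponent \<open>l - 1\<close>.\<close>
definition profile_slope :: "real poly \<Rightarrow> real \<Rightarrow> real" where
  "profile_slope s r = real l * r ^ l * poly s (r\<^sup>2) + 2 * r ^ (l + 2) * poly (pderiv s) (r\<^sup>2)"

text \<open>A polynomial in |x|^2 rather than in |x| keeps this a polynomial in the coordinates,
  smooth at the origin.\<close>

definition ansatz :: "real poly \<Rightarrow> real^3 \<Rightarrow> complex" where
  "ansatz s x = of_real (poly s ((norm x)\<^sup>2)) * p x"

lemma profile_linear:
  "profile (s + t) r = profile s r + profile t r" "profile (smult c s) r = c * profile s r"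
  "profile_slope (s + t) r = profile_slope s r + profile_slope t r"
  "profile_slope (smult c s) r = c * profile_slope s r"
  by (simp_all add: profile_def profile_slope_def pderiv_add pderiv_smult algebra_simps)

lemma profile_continuous: "continuous_on A (profile s)" "continuous_on A (profile_slope s)"
  unfolding profile_def[abs_def] profile_slope_def[abs_def] by (intro continuous_intros)+

lemma profile_has_derivative:
  assumes "r \<noteq> 0"
  shows "(profile s has_real_derivative profile_slope s r / r) (at r)"
proof -
  have "((\<lambda>r. poly s (r\<^sup>2)) has_real_derivative poly (pderiv s) (r\<^sup>2) * (2 * r)) (at r)"
    by (rule DERIV_chain'[of "\<lambda>r. r\<^sup>2" _ _ _ "poly s", OF _ poly_DERIV]) (auto intro!: derivative_eq_intros)
  from DERIV_mult'[OF DERIV_pow[of l r UNIV] this]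
  have "(profile s has_real_derivative r ^ l * (poly (pderiv s) (r\<^sup>2) * (2 * r)) + real l * r ^ (l - Suc 0) * poly s (r\<^sup>2)) (at r)"
    unfolding profile_def[abs_def] by simp
  moreover have "r ^ l * (poly (pderiv s) (r\<^sup>2) * (2 * r)) + real l * r ^ (l - Suc 0) * poly s (r\<^sup>2) = profile_slope s r / r"
    unfolding profile_slope_def using assms by (cases l) (simp_all add: field_simps power2_eq_square)
  ultimately show ?thesis by simp
qed

lemma poly3_ansatz: "poly3 (ansatz s)"
proof -
  have "poly3 (\<lambda>x. of_real (poly s ((norm x)\<^sup>2)))"
  proof (induction s)
    case (pCons a s)
    have "(\<lambda>x::real^3. complex_of_real (poly (pCons a s) ((norm x)\<^sup>2)))
        = (\<lambda>x. of_real a + radius_sq x * of_real (poly s ((norm x)\<^sup>2)))"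
      by (simp add: radius_sq_eq)
    then show ?case by (simp only:) (intro poly3.add poly3.const poly3.mult poly3_radius_sq pCons)
  qed (simp add: poly3.const)
  then show ?thesis unfolding ansatz_def[abs_def] by (intro poly3.mult poly3)
qed

lemma smooth_ansatz: "smooth (ansatz s)"
  by (rule poly3_smooth[OF poly3_ansatz])

lemma partial_deriv_ansatz:
  "partial_deriv i (ansatz s) x
    = of_real (2 * poly (pderiv s) ((norm x)\<^sup>2) * x $ i) * p x + of_real (poly s ((norm x)\<^sup>2)) * partial_deriv i p x"
proof -
  have "((\<lambda>x::real^3. (norm x)\<^sup>2) has_derivative (\<lambda>h. 2 * (x \<bullet> h))) (at x)"
    unfolding power2_norm_eq_inner by (auto intro!: derivative_eq_intros simp: inner_commute)
  from has_derivative_compose[OF this poly_DERIV[of s, unfolded has_field_derivative_def]]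
  have d: "((\<lambda>x. poly s ((norm x)\<^sup>2)) has_derivative (\<lambda>h. poly (pderiv s) ((norm x)\<^sup>2) * (2 * (x \<bullet> h)))) (at x)" .
  then have d': "(\<lambda>x. poly s ((norm x)\<^sup>2)) differentiable at x" by (auto simp: differentiable_def)
  have "partial_deriv i (\<lambda>x. complex_of_real (poly s ((norm x)\<^sup>2))) x = of_real (2 * poly (pderiv s) ((norm x)\<^sup>2) * x $ i)"
    by (subst partial_deriv_linear[OF bounded_linear_of_real d']) (simp add: partial_deriv_eq[OF d] inner_axis)
  moreover have "(\<lambda>x. complex_of_real (poly s ((norm x)\<^sup>2))) differentiable at x"
    using bounded_linear.has_derivative[OF bounded_linear_of_real d] by (auto simp: differentiable_def)
  ultimately show ?thesis
    unfolding ansatz_def[abs_def]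
    by (subst partial_deriv_mult) (auto simp: poly3_differentiable[OF poly3])
qed

lemma ansatz_diff: "ansatz s x - ansatz t x = ansatz (s - t) x"
  by (simp add: ansatz_def algebra_simps)

lemma grad_ansatz_diff: "grad (ansatz s) x - grad (ansatz t) x = grad (ansatz (s - t)) x"
  by (simp add: vec_eq_iff partial_deriv_ansatz pderiv_diff algebra_simps)

lemma ansatz_sphere: "norm x = 1 \<Longrightarrow> poly s 1 = 1 \<Longrightarrow> ansatz s x = p x"
  by (simp add: ansatz_def)

definition mass :: real where
  "mass = (\<integral>x. (norm (p x))\<^sup>2 \<partial>surface_measure)"

lemma smooth_cnj_ansatz: "smooth (\<lambda>x. cnj (ansatz s x))"
  by (rule smooth_linear[OF bounded_linear_cnj smooth_ansatz])

text \<open>Conjugation produces |p|^2 under the integral; this is what turns energies of separated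
  functions into a real one-dimensional form with the constant \<open>mass\<close>.\<close>

lemma amplitude_cnj_ansatz: "amplitude (\<lambda>x. cnj (ansatz s x)) r = of_real (mass * profile s r)"
proof -
  have "amplitude (\<lambda>x. cnj (ansatz s x)) r = (\<integral>x. of_real (profile s r) * of_real ((norm (p x))\<^sup>2) \<partial>surface_measure)"
    unfolding amplitude_def
  proof (rule sphere_integral_cong)
    fix x :: "real^3" assume "norm x = 1"
    then show "p x * cnj (ansatz s (r *\<^sub>R x)) = of_real (profile s r) * of_real ((norm (p x))\<^sup>2)"
      by (simp add: ansatz_def scale profile_def complex_norm_square del: of_real_power) (simp add: algebra_simps)
  qed
  also have "\<dots> = of_real (profile s r) * of_real mass"
    unfolding mass_def by (simp only: integral_mult_right_zero integral_complex_of_real)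
  finally show ?thesis by simp
qed

text \<open>Differentiating the closed form of the amplitude and using uniqueness of derivatives
  avoids evaluating the gradient integral.\<close>

lemma amplitude_deriv_cnj_ansatz:
  assumes "r \<noteq> 0"
  shows "r *\<^sub>R amplitude_deriv (\<lambda>x. cnj (ansatz s x)) r = of_real (mass * profile_slope s r)"
proof -
  have "((\<lambda>r. complex_of_real (mass * profile s r)) has_vector_derivative of_real (mass * (profile_slope s r / r))) (at r)"
    by (intro has_vector_derivative_of_real DERIV_cmult profile_has_derivative assms)
  moreover have "amplitude (\<lambda>x. cnj (ansatz s x)) = (\<lambda>r. complex_of_real (mass * profile s r))"
    by (simp add: fun_eq_iff amplitude_cnj_ansatz)
  ultimately have "amplitude_deriv (\<lambda>x. cnj (ansatz s x)) r = of_real (mass * (profile_slope s r / r))"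
    using amplitude_has_derivative[OF smooth_cnj_ansatz, of s r] vector_derivative_unique_at by metis
  then show ?thesis using assms by (simp add: scaleR_conv_of_real)
qed

text \<open>The gradient of s(|x|^2) p splits into 2 s' p x, which sees only the radial derivative
  of \<open>F\<close>, and s times the gradient of \<open>p\<close>, which
  \<open>grad_amplitude_eq\<close> expresses by the amplitude. With R the profile of
  \<open>s\<close> and W the amplitude of \<open>F\<close>, the sum is r R' r W' + l (l + 1) R
  W.\<close>

lemma grad_product_ansatz:
  assumes F: "smooth F" and r: "0 < r" "r < 1"
  shows "r\<^sup>2 *\<^sub>R (\<integral>x. (\<Sum>i\<in>UNIV. partial_deriv i (ansatz s) (r *\<^sub>R x) * partial_deriv i F (r *\<^sub>R x)) \<partial>surface_measure)
    = profile_slope s r *\<^sub>R (r *\<^sub>R amplitude_deriv F r) + (real (l * (l + 1)) * profile s r) *\<^sub>R amplitude F r"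
proof -
  let ?q = "of_real (2 * poly (pderiv s) (r\<^sup>2) * r ^ (l + 1)) :: complex" and ?s = "of_real (poly s (r\<^sup>2)) :: complex"
  have "(\<integral>x. (\<Sum>i\<in>UNIV. partial_deriv i (ansatz s) (r *\<^sub>R x) * partial_deriv i F (r *\<^sub>R x)) \<partial>surface_measure)
      = (\<integral>x. ?q * (p x * (\<Sum>i\<in>UNIV. of_real (x $ i) * partial_deriv i F (r *\<^sub>R x)))
           + ?s * (\<Sum>i\<in>UNIV. partial_deriv i p (r *\<^sub>R x) * partial_deriv i F (r *\<^sub>R x)) \<partial>surface_measure)"
  proof (rule sphere_integral_cong)
    fix x :: "real^3" assume "norm x = 1"
    then show "(\<Sum>i\<in>UNIV. partial_deriv i (ansatz s) (r *\<^sub>R x) * partial_deriv i F (r *\<^sub>R x))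
      = ?q * (p x * (\<Sum>i\<in>UNIV. of_real (x $ i) * partial_deriv i F (r *\<^sub>R x)))
           + ?s * (\<Sum>i\<in>UNIV. partial_deriv i p (r *\<^sub>R x) * partial_deriv i F (r *\<^sub>R x))"
      by (simp add: partial_deriv_ansatz scale sum_3 algebra_simps)
  qed
  also have "\<dots> = ?q * amplitude_deriv F r + ?s * grad_amplitude F r"
  proof -
    note c = continuous_slice[OF amplitude_integrand_continuous(2)[OF F]]
      continuous_slice[OF continuous_dilate[OF continuous_grad_product[OF F]]]
    show ?thesis
      unfolding amplitude_deriv_def grad_amplitude_def
      using continuous_integrable_surface[OF c(1)] continuous_integrable_surface[OF c(2)] by simp
  qed
  finally have "r\<^sup>2 *\<^sub>R (\<integral>x. (\<Sum>i\<in>UNIV. partial_deriv i (ansatz s) (r *\<^sub>R x) * partial_deriv i F (r *\<^sub>R x)) \<partial>surface_measure)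
     = r\<^sup>2 *\<^sub>R (?q * amplitude_deriv F r) + ?s * (r\<^sup>2 *\<^sub>R grad_amplitude F r)"
    by (simp add: scaleR_add_right)
  also have "\<dots> = profile_slope s r *\<^sub>R (r *\<^sub>R amplitude_deriv F r) + (real (l * (l + 1)) * profile s r) *\<^sub>R amplitude F r"
    unfolding grad_amplitude_eq[OF F r] profile_slope_def profile_def
    by (simp add: scaleR_conv_of_real algebra_simps power2_eq_square)
  finally show ?thesis .
qed

end

section \<open>The energy in polar coordinates\<close>

locale radial_conductivity = conductivity \<gamma> C + solid p l
  for \<gamma> :: "real^3 \<Rightarrow> real" and C :: real and p :: "real^3 \<Rightarrow> complex" and l :: nat +
  fixes g :: "real \<Rightarrow> real"
  assumes g_measurable [measurable]: "g \<in> borel_measurable borel"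
    and g_bounds: "\<And>r. inverse C \<le> g r" "\<And>r. g r \<le> C"
    and \<gamma>_radial: "AE x in ball_measure. \<gamma> x = g (norm x)"
begin

text \<open>\<gamma> is merely Lebesgue measurable on the ball, so it is first replaced by the Borel
  function \<open>g (norm x)\<close>, to which polar coordinates apply.\<close>

lemma polar_energy:
  fixes k :: "real^3 \<Rightarrow> complex"
  assumes k: "continuous_on UNIV k"
  shows "(\<integral>x. \<gamma> x *\<^sub>R k x \<partial>ball_measure) = (\<integral>r. g r *\<^sub>R (r\<^sup>2 *\<^sub>R (\<integral>x. k (r *\<^sub>R x) \<partial>surface_measure)) \<partial>unit_interval)"
proof -
  have km [measurable]: "k \<in> borel_measurable borel" by (rule borel_measurable_continuous_onI[OF k])
  have m: "(\<lambda>x. g (norm x) *\<^sub>R k x) \<in> borel_measurable borel" by measurable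
  have m2: "(\<lambda>x. g (norm x) *\<^sub>R k x) \<in> borel_measurable ball_measure"
    by (intro measurable_restrict_space1 measurable_completion) (use m in simp)
  have km2 [measurable]: "k \<in> borel_measurable ball_measure"
    by (rule borel_measurable_integrable[OF continuous_integrable_ball[OF k]])
  have gb: "\<bar>g r\<bar> \<le> C" for r
    using g_bounds[of r] positive_imp_inverse_positive[OF C_pos] by linarith
  have int: "integrable ball_measure (\<lambda>x. g (norm x) *\<^sub>R k x)"
    by (rule Bochner_Integration.integrable_bound[OF integrable_mult_right[OF integrable_norm[OF continuous_integrable_ball[OF k]], of C] m2])
       (use gb C_pos in \<open>auto simp: abs_mult intro!: AE_I2 mult_mono\<close>)
  have cs: "(\<lambda>r. \<integral>x. k (r *\<^sub>R x) \<partial>surface_measure) \<in> borel_measurable borel"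
    by (intro borel_measurable_continuous_onI surface_integral_continuous continuous_dilate k)
  have "(\<integral>x. \<gamma> x *\<^sub>R k x \<partial>ball_measure) = (\<integral>x. g (norm x) *\<^sub>R k x \<partial>ball_measure)"
    using \<gamma>_radial by (intro integral_cong_AE m2) (auto elim: eventually_mono)
  also have "\<dots> = (\<integral>r. (\<integral>x. g (norm (r *\<^sub>R x)) *\<^sub>R k (r *\<^sub>R x) \<partial>surface_measure) \<partial>radial_measure)"
    by (rule polar_integral(1)[OF m int])
  also have "\<dots> = (\<integral>r. g \<bar>r\<bar> *\<^sub>R (\<integral>x. k (r *\<^sub>R x) \<partial>surface_measure) \<partial>radial_measure)"
  proof (rule Bochner_Integration.integral_cong[OF refl])
    fix r
    have "(\<integral>x. g (norm (r *\<^sub>R x)) *\<^sub>R k (r *\<^sub>R x) \<partial>surface_measure) = (\<integral>x. g \<bar>r\<bar> *\<^sub>R k (r *\<^sub>R x) \<partial>surface_measure)"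
      by (rule sphere_integral_cong) simp
    then show "(\<integral>x. g (norm (r *\<^sub>R x)) *\<^sub>R k (r *\<^sub>R x) \<partial>surface_measure) = g \<bar>r\<bar> *\<^sub>R (\<integral>x. k (r *\<^sub>R x) \<partial>surface_measure)"
      by simp
  qed
  also have "\<dots> = (\<integral>r. r\<^sup>2 *\<^sub>R (g \<bar>r\<bar> *\<^sub>R (\<integral>x. k (r *\<^sub>R x) \<partial>surface_measure)) \<partial>unit_interval)"
    using cs by (intro radial_measure_integral borel_measurable_scaleR) measurable
  also have "\<dots> = (\<integral>r. g r *\<^sub>R (r\<^sup>2 *\<^sub>R (\<integral>x. k (r *\<^sub>R x) \<partial>surface_measure)) \<partial>unit_interval)"
    by (rule Bochner_Integration.integral_cong[OF refl]) (simp add: space_restrict_space mult.commute)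
  finally show ?thesis .
qed

lemma energy_ansatz:
  assumes F: "smooth F"
  shows "energy \<gamma> (grad (ansatz s)) (grad F)
    = (\<integral>r. g r *\<^sub>R (profile_slope s r *\<^sub>R (r *\<^sub>R amplitude_deriv F r)
        + (real (l * (l + 1)) * profile s r) *\<^sub>R amplitude F r) \<partial>unit_interval)"
proof -
  have c: "continuous_on UNIV (\<lambda>x. \<Sum>i\<in>UNIV. partial_deriv i (ansatz s) x * partial_deriv i F x)"
    by (intro continuous_intros smooth_continuous_partial smooth_ansatz F)
  have "energy \<gamma> (grad (ansatz s)) (grad F) = (\<integral>x. \<gamma> x *\<^sub>R (\<Sum>i\<in>UNIV. partial_deriv i (ansatz s) x * partial_deriv i F x) \<partial>ball_measure)"
    by (simp add: energy_def)
  also have "\<dots> = (\<integral>r. g r *\<^sub>R (r\<^sup>2 *\<^sub>R (\<integral>x. (\<Sum>i\<in>UNIV. partial_deriv i (ansatz s) (r *\<^sub>R x) * partial_deriv i F (r *\<^sub>R x)) \<partial>surface_measure)) \<partial>unit_interval)"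
    by (rule polar_energy[OF c])
  also have "\<dots> = (\<integral>r. g r *\<^sub>R (profile_slope s r *\<^sub>R (r *\<^sub>R amplitude_deriv F r)
        + (real (l * (l + 1)) * profile s r) *\<^sub>R amplitude F r) \<partial>unit_interval)"
    by (rule Bochner_Integration.integral_cong[OF refl]) (simp only: grad_product_ansatz[OF F] space_restrict_space Int_iff greaterThanLessThan_iff)
  finally show ?thesis .
qed

end

section \<open>The radial variational problem\<close>

lemma real_poly_approximation:
  fixes f :: "real \<Rightarrow> real"
  assumes "continuous_on {0..1} f" "e > 0"
  shows "\<exists>s. \<forall>t\<in>{0..1}. \<bar>poly s t - f t\<bar> < e"
proof -
  obtain h where h: "real_polynomial_function h" "\<And>t. t \<in> {0..1} \<Longrightarrow> \<bar>f t - h t\<bar> < e"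
    using Stone_Weierstrass_real_polynomial_function[OF compact_Icc assms] by blast
  then obtain a n where "h = (\<lambda>t. \<Sum>i\<le>n. a i * t ^ i)" using real_polynomial_function_iff_sum by auto
  then have "h t = poly (\<Sum>i\<le>n. monom (a i) i) t" for t by (simp add: poly_sum poly_monom)
  then show ?thesis using h(2) by (intro exI[of _ "\<Sum>i\<le>n. monom (a i) i"]) (auto simp: abs_minus_commute)
qed

text \<open>The normalization at 1 lets a derivative be approximated while the boundary value at
  radius 1 stays exact.\<close>

lemma poly_antiderivative:
  fixes t :: "real poly"
  shows "\<exists>s. pderiv s = t \<and> poly s 1 = 0"
proof -
  let ?s = "\<Sum>i\<le>degree t. monom (coeff t i / real (Suc i)) (Suc i)"
  have "pderiv ?s = (\<Sum>i\<le>degree t. monom (coeff t i) i)"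
    using higher_pderiv_sum[of 1 "\<lambda>i. monom (coeff t i / real (Suc i)) (Suc i)" "{..degree t}"]
    by (simp add: pderiv_monom del: of_nat_Suc)
  also have "\<dots> = t" by (rule poly_as_sum_of_monoms)
  finally have "pderiv (?s - [:poly ?s 1:]) = t" by (simp add: pderiv_diff pderiv_pCons)
  then show ?thesis by (intro exI[of _ "?s - [:poly ?s 1:]"]) simp
qed

text \<open>The parallelogram identity makes a minimizing sequence of the quadratic form Cauchy.\<close>
lemma minimizing_sequence:
  fixes B :: "real poly \<Rightarrow> real poly \<Rightarrow> real"
  assumes sym: "\<And>s t. B s t = B t s" and add: "\<And>s t u. B (s + t) u = B s u + B t u"
    and smult: "\<And>c s t. B (smult c s) t = c * B s t" and nonneg: "\<And>s. B s s \<ge> 0"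
  shows "\<exists>s M. (\<forall>n. poly (s n) 1 = 1) \<and> (\<forall>n::nat. B (s n) (s n) \<le> M)
    \<and> (\<forall>e>0. \<exists>N. \<forall>m\<ge>N. \<forall>n\<ge>N. B (s m - s n) (s m - s n) < e)
    \<and> (\<forall>t. poly t 1 = 0 \<longrightarrow> (\<lambda>n. B (s n) t) \<longlonglongrightarrow> 0)"
proof -
  have add': "B u (s + t) = B u s + B u t" for u s t using add sym by metis
  have smult': "B t (smult c s) = c * B t s" for t c s using smult sym by metis
  have uminus: "B (- s) t = - B s t" "B t (- s) = - B t s" for s t
    using smult[of "-1" s t] smult'[of t "-1" s] by simp_all
  have diff: "B (s - t) u = B s u - B t u" "B u (s - t) = B u s - B u t" for s t u
    using add[of s "- t" u] add'[of u s "- t"] by (simp_all add: uminus)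
  let ?A = "{s :: real poly. poly s 1 = 1}"
  define m where "m = (INF s\<in>?A. B s s)"
  have bdd: "bdd_below ((\<lambda>s. B s s) ` ?A)" by (rule bdd_belowI2[where m = 0]) (simp add: nonneg)
  have ne: "?A \<noteq> {}" by (auto intro: exI[of _ 1])
  have m_le: "m \<le> B s s" if "poly s 1 = 1" for s
    unfolding m_def by (rule cINF_lower[OF bdd]) (simp add: that)
  have "\<exists>s. poly s 1 = 1 \<and> B s s < m + 1 / real (Suc n)" for n
    using cInf_lessD[of "(\<lambda>s. B s s) ` ?A" "m + 1 / real (Suc n)"] ne unfolding m_def by auto
  then obtain s where s: "\<And>n. poly (s n) 1 = 1" "\<And>n. B (s n) (s n) < m + 1 / real (Suc n)" by metis
  have "B (s n) (s n) \<le> m + 1" for n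
    using less_imp_le[OF s(2)[of n]] by (rule order_trans) (simp add: divide_le_eq)
  moreover have "\<exists>N. \<forall>j\<ge>N. \<forall>n\<ge>N. B (s j - s n) (s j - s n) < e" if e: "e > 0" for e
  proof -
    \<comment> \<open>Both energies will exceed \<open>m\<close> by less than \<open>e / 4\<close>,
      and each counts twice in the parallelogram identity.\<close>
    obtain N where N: "4 / e < real (Suc N)" using reals_Archimedean2 by (metis less_trans lessI of_nat_less_iff)
    show ?thesis
    proof (intro exI[of _ N] allI impI)
      fix j n assume jn: "j \<ge> N" "n \<ge> N"
      \<comment> \<open>The midpoint is admissible because the constraint at 1 is affine.\<close>
      have "m \<le> B (smult (1/2) (s j + s n)) (smult (1/2) (s j + s n))"
        by (rule m_le) (simp add: s)
      then have "4 * m \<le> B (s j + s n) (s j + s n)" by (simp add: smult smult')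
      moreover have "B (s j - s n) (s j - s n) + B (s j + s n) (s j + s n) = 2 * B (s j) (s j) + 2 * B (s n) (s n)"
        by (simp add: diff add add')
      moreover have inv: "1 / real (Suc i) < e / 4" if "i \<ge> N" for i
      proof -
        have "4 / e < real (Suc i)" using N that by simp
        then show ?thesis using e by (simp add: field_simps)
      qed
      ultimately show "B (s j - s n) (s j - s n) < e"
        using s(2)[of j] s(2)[of n] inv[OF jn(1)] inv[OF jn(2)] by linarith
    qed
  qed
  moreover have "(\<lambda>n. B (s n) t) \<longlonglongrightarrow> 0" if t: "poly t 1 = 0" for t
  proof (rule Lim_null_comparison)
    have "(\<lambda>n. sqrt (1 / real (Suc n)) * (1 + B t t)) \<longlonglongrightarrow> sqrt 0 * (1 + B t t)"
      by (intro tendsto_intros LIMSEQ_Suc[OF lim_1_over_n])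
    then show "(\<lambda>n. sqrt (1 / real (Suc n)) * (1 + B t t)) \<longlonglongrightarrow> 0" by simp
    show "\<forall>\<^sub>F n in sequentially. norm (B (s n) t) \<le> sqrt (1 / real (Suc n)) * (1 + B t t)"
    proof (intro always_eventually allI)
      fix n
      \<comment> \<open>Perturbing by plus or minus \<open>d\<close> times \<open>t\<close> balances
        the defect 1 / (n + 1) = d^2 of the minimization against the quadratic term d^2 B(t, t);
        dividing by \<open>d\<close> leaves a bound of order \<open>d\<close>.\<close>
      define d where "d = sqrt (1 / real (Suc n))"
      have d: "d > 0" "d * d = 1 / real (Suc n)" by (simp_all add: d_def)
      have key: "- 2 * x * B (s n) t \<le> 1 / real (Suc n) + x * x * B t t" for x
      proof -
        have "m \<le> B (s n + smult x t) (s n + smult x t)" by (rule m_le) (simp add: s t)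
        also have "\<dots> = B (s n) (s n) + 2 * x * B (s n) t + x * x * B t t"
          using sym[of t "s n"] by (simp add: add add' smult smult' algebra_simps)
        finally show ?thesis using s(2)[of n] by linarith
      qed
      have "d * (2 * \<bar>B (s n) t\<bar>) \<le> d * (d * (1 + B t t))"
        using key[of d] key[of "- d"] unfolding d(2)[symmetric] by (simp add: abs_if algebra_simps)
      then have "2 * \<bar>B (s n) t\<bar> \<le> d * (1 + B t t)" using d by (simp only: mult_le_cancel_left_pos)
      then show "norm (B (s n) t) \<le> sqrt (1 / real (Suc n)) * (1 + B t t)"
        unfolding d_def[symmetric] by (smt (verit) real_norm_def)
    qed
  qed
  ultimately show ?thesis using s(1) by blast
qed

context solid
begin

text \<open>
  The factor \<open>(r\<^sup>2 / (r\<^sup>2 + d))\<^bsup>l+1\<^esup>\<close> cuts off \<open>V\<close> at the origin, so that the quotient by \<open>r\<^sup>l\<close> is a \<open>C\<^sup>1\<close> function of \<open>r\<^sup>2\<close>,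
  to which Weierstrass applies.  Its effect on the energy vanishes as \<open>d\<close> tends to \<open>0\<close>, a point having zero capacity in
  dimension three.
\<close>
lemma profile_dense_step:
  fixes V V' :: "real \<Rightarrow> real"
  assumes V: "\<And>r. r \<in> {0..1} \<Longrightarrow> (V has_real_derivative V' r) (at r within {0..1})"
    and V': "continuous_on {0..1} V'" and V1: "V 1 = 0" and d: "d > 0"
  shows "\<exists>s. poly s 1 = 0 \<and> (\<forall>r. 0 < r \<longrightarrow> r < 1 \<longrightarrow>
    \<bar>profile s r - (r\<^sup>2 / (r\<^sup>2 + d)) ^ (l + 1) * V r\<bar> \<le> 2 * d \<and>
    \<bar>profile_slope s r - (r\<^sup>2 / (r\<^sup>2 + d)) ^ (l + 1) * (r * V' r + 2 * real (l + 1) * V r * (d / (r\<^sup>2 + d)))\<bar>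
      \<le> 2 * d * real (l + 1))"
proof -
  have cV: "continuous_on {0..1} V" using V by (rule DERIV_continuous_on)
  have pos: "r\<^sup>2 + d > 0" for r using d by (simp add: add_nonneg_pos)
  then have nz: "r\<^sup>2 + d \<noteq> 0" for r by (metis less_irrefl)
  \<comment> \<open>\<open>S\<close> is the cut-off \<open>V\<close> divided by r^l, and
    \<open>D\<close> is its derivative with respect to r^2, that is, S' / (2 r). The exponent
    \<open>l + 1\<close> of the cutoff supplies enough powers of \<open>r\<close> for
    \<open>D\<close> to be continuous at 0.\<close>
  define S where "S r = r ^ (l + 2) * V r / (r\<^sup>2 + d) ^ (l + 1)" for r
  define D where "D r = (r ^ (l + 1) * V' r + real (l + 2) * r ^ l * V r) / (2 * (r\<^sup>2 + d) ^ (l + 1))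
      - real (l + 1) * r ^ (l + 2) * V r / (r\<^sup>2 + d) ^ (l + 2)" for r
  have "continuous_on {0..1} D"
    unfolding D_def[abs_def] by (intro continuous_intros cV V') (use nz in auto)
  then have "continuous_on {0..1} (\<lambda>t. D (sqrt t))"
    by (rule continuous_on_compose2) (auto intro!: continuous_intros)
  \<comment> \<open>The derivative in r^2 is approximated and then integrated from 1, so that the
    functions and their derivatives are close simultaneously.\<close>
  from real_poly_approximation[OF this d] obtain q where q: "\<And>t. t \<in> {0..1} \<Longrightarrow> \<bar>poly q t - D (sqrt t)\<bar> < d" by blast
  obtain s where s: "pderiv s = q" "poly s 1 = 0" using poly_antiderivative by blast
  have q': "\<bar>poly q (r\<^sup>2) - D r\<bar> \<le> d" if "r \<in> {0..1}" for r
    using q[of "r\<^sup>2"] that by (auto simp: power_le_one less_imp_le)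
  have S': "(S has_real_derivative 2 * r * D r) (at r within {0..1})" if r: "r \<in> {0..1}" for r
  proof -
    have n: "((\<lambda>r. r ^ (l + 2) * V r) has_real_derivative r ^ (l + 2) * V' r + (real (l + 2) * r ^ (l + 1)) * V r) (at r within {0..1})"
      using DERIV_mult'[OF DERIV_pow[of "l + 2" r "{0..1}"] V[OF r]] by simp
    have m0: "((\<lambda>r. r\<^sup>2 + d) has_real_derivative 2 * r) (at r within {0..1})" by (auto intro!: derivative_eq_intros)
    have m: "((\<lambda>r. (r\<^sup>2 + d) ^ (l + 1)) has_real_derivative real (l + 1) * (2 * r * (r\<^sup>2 + d) ^ l)) (at r within {0..1})"
      using DERIV_power[OF m0, of "l + 1"] by simp
    have "(S has_real_derivative ((r ^ (l + 2) * V' r + (real (l + 2) * r ^ (l + 1)) * V r) * (r\<^sup>2 + d) ^ (l + 1)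
       - r ^ (l + 2) * V r * (real (l + 1) * (2 * r * (r\<^sup>2 + d) ^ l))) / ((r\<^sup>2 + d) ^ (l + 1) * (r\<^sup>2 + d) ^ (l + 1))) (at r within {0..1})"
      unfolding S_def[abs_def] by (rule DERIV_divide[OF n m]) (simp add: nz)
    moreover have "((r ^ (l + 2) * V' r + (real (l + 2) * r ^ (l + 1)) * V r) * (r\<^sup>2 + d) ^ (l + 1)
       - r ^ (l + 2) * V r * (real (l + 1) * (2 * r * (r\<^sup>2 + d) ^ l))) / ((r\<^sup>2 + d) ^ (l + 1) * (r\<^sup>2 + d) ^ (l + 1)) = 2 * r * D r"
    proof -
      have e: "(y * z ^ (l + 1) - x * (k * (2 * r * z ^ l))) / (z ^ (l + 1) * z ^ (l + 1))
          = y / z ^ (l + 1) - 2 * r * (k * x / z ^ (l + 2))" if "z \<noteq> 0" for x y z k :: real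
        using that by (simp add: field_simps)
      have y: "r ^ (l + 2) * V' r + (real (l + 2) * r ^ (l + 1)) * V r = r * (r ^ (l + 1) * V' r + real (l + 2) * r ^ l * V r)"
        by (simp add: algebra_simps)
      have h: "2 * r * (x / (2 * z) - u) = r * x / z - 2 * r * u" for x z u :: real
        by (simp add: right_diff_distrib)
      show ?thesis unfolding e[OF nz] D_def y h by (simp add: mult.assoc)
    qed
    ultimately show ?thesis by simp
  qed
  define E where "E r = poly s (r\<^sup>2) - S r" for r
  have E': "(E has_real_derivative 2 * r * (poly q (r\<^sup>2) - D r)) (at r within {0..1})" if r: "r \<in> {0..1}" for r
  proof -
    have "((\<lambda>r. poly s (r\<^sup>2)) has_real_derivative poly q (r\<^sup>2) * (2 * r)) (at r within {0..1})"
      using DERIV_chain'[of "\<lambda>r. r\<^sup>2" "2 * r" r "{0..1}" "poly s", OF _ poly_DERIV] s(1) by (auto intro!: derivative_eq_intros)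
    from DERIV_diff[OF this S'[OF r]] show ?thesis unfolding E_def[abs_def] by (simp add: algebra_simps)
  qed
  \<comment> \<open>\<open>E\<close> vanishes at 1 because both \<open>s\<close> and
    \<open>V\<close> do, and its derivative is at most \<open>2 * d\<close> in absolute
    value.\<close>
  have E: "\<bar>E r\<bar> \<le> 2 * d" if r: "r \<in> {0..1}" for r
  proof -
    have "norm (E r - E 1) \<le> 2 * d * norm (r - 1)"
    proof (rule field_differentiable_bound[where S = "{0..1}"])
      show "norm (2 * x * (poly q (x\<^sup>2) - D x)) \<le> 2 * d" if "x \<in> {0..1}" for x
        using q'[OF that] that mult_mono[of "\<bar>x\<bar>" 1 "\<bar>poly q (x\<^sup>2) - D x\<bar>" d] by (simp add: abs_mult)
    qed (use E' r in auto)
    also have "\<dots> \<le> 2 * d" using r d by (auto simp: abs_if)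
    finally show ?thesis using s(2) V1 by (simp add: E_def S_def)
  qed
  show ?thesis
  proof (intro exI[of _ s] conjI allI impI s(2))
    fix r :: real assume r: "0 < r" "r < 1"
    define z where "z = r\<^sup>2 + d"
    have z: "z > 0" "z \<noteq> 0" using pos[of r] by (auto simp: z_def)
    have zz: "r\<^sup>2 / z = 1 - d / z" using z by (simp add: z_def field_simps)
    have rl: "r ^ l \<le> 1" "r ^ (l + 2) \<le> 1" "0 \<le> r ^ l" "0 \<le> r ^ (l + 2)" using r by (auto intro: power_le_one simp del: power_Suc)
    have Sr: "r ^ l * S r = (r\<^sup>2 / z) ^ (l + 1) * V r"
    proof -
      have "r ^ l * r ^ (l + 2) = (r\<^sup>2) ^ (l + 1)" by (simp add: power_mult[symmetric] power_add[symmetric] mult_2 flip: power_Suc)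
      then show ?thesis unfolding S_def z_def[symmetric] power_divide by (simp add: mult.assoc[symmetric] del: power_Suc)
    qed
    have "profile s r - (r\<^sup>2 / z) ^ (l + 1) * V r = r ^ l * E r"
      unfolding Sr[symmetric] by (simp add: profile_def E_def algebra_simps)
    moreover have "\<bar>r ^ l * E r\<bar> \<le> 1 * (2 * d)"
      unfolding abs_mult using rl E[of r] r by (intro mult_mono) auto
    ultimately show "\<bar>profile s r - (r\<^sup>2 / (r\<^sup>2 + d)) ^ (l + 1) * V r\<bar> \<le> 2 * d"
      by (simp add: z_def)
    have Dr: "2 * r ^ (l + 2) * D r = (r\<^sup>2 / z) ^ (l + 1) * (r * V' r + real (l + 2) * V r - 2 * real (l + 1) * V r * (r\<^sup>2 / z))"
    proof -
      have "2 * r ^ (l + 2) * D r = (r ^ (l + 2) * r ^ l) * (r * V' r + real (l + 2) * V r) / z ^ (l + 1)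
          - 2 * real (l + 1) * V r * (r ^ (l + 2) * r ^ (l + 2)) / z ^ (l + 2)"
      proof -
        have h: "2 * x * (n / (2 * y) - u) = x * n / y - 2 * x * u" for x n y u :: real
          by (simp add: right_diff_distrib)
        have n: "r ^ (l + 1) * V' r + real (l + 2) * r ^ l * V r = r ^ l * (r * V' r + real (l + 2) * V r)"
          by (simp add: algebra_simps)
        show ?thesis unfolding D_def z_def[symmetric] h n by (simp add: mult_ac del: power_Suc of_nat_Suc of_nat_add)
      qed
      also have "r ^ (l + 2) * r ^ l = (r\<^sup>2) ^ (l + 1)" by (simp add: power_mult[symmetric] power_add[symmetric] mult_2 flip: power_Suc)
      also have "r ^ (l + 2) * r ^ (l + 2) = (r\<^sup>2) ^ (l + 1) * r\<^sup>2" by (simp add: power_mult[symmetric] power_add[symmetric] mult_2 flip: power_Suc)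
      also have "z ^ (l + 2) = z ^ (l + 1) * z" by simp
      finally show ?thesis
        unfolding power_divide right_diff_distrib[of "(r\<^sup>2) ^ (l + 1) / z ^ (l + 1)"]
        by (simp add: mult_ac del: power_Suc of_nat_Suc of_nat_add)
    qed
    have "profile_slope s r = real l * (r ^ l * S r) + 2 * r ^ (l + 2) * D r
        + (real l * (r ^ l * E r) + 2 * (r ^ (l + 2) * (poly q (r\<^sup>2) - D r)))"
      by (simp add: profile_slope_def s(1) E_def algebra_simps)
    \<comment> \<open>Writing r^2 / z = 1 - d / z, the multiples l, l + 2 and -2 (l + 1) of V
      cancel; what is left besides r V' carries the factor d / z.\<close>
    also have "real l * (r ^ l * S r) + 2 * r ^ (l + 2) * D r
        = (r\<^sup>2 / z) ^ (l + 1) * (r * V' r + 2 * real (l + 1) * V r * (d / z))"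
      unfolding Sr Dr zz by (simp add: algebra_simps)
    finally have "profile_slope s r - (r\<^sup>2 / z) ^ (l + 1) * (r * V' r + 2 * real (l + 1) * V r * (d / z))
        = real l * (r ^ l * E r) + 2 * (r ^ (l + 2) * (poly q (r\<^sup>2) - D r))" by simp
    moreover have "\<bar>real l * (r ^ l * E r) + 2 * (r ^ (l + 2) * (poly q (r\<^sup>2) - D r))\<bar> \<le> real l * (2 * d) + 2 * d"
    proof -
      have "\<bar>r ^ (l + 2) * (poly q (r\<^sup>2) - D r)\<bar> \<le> 1 * d"
        unfolding abs_mult using rl q'[of r] r d by (intro mult_mono) auto
      moreover have "\<bar>real l * (r ^ l * E r)\<bar> \<le> real l * (2 * d)"
        using \<open>\<bar>r ^ l * E r\<bar> \<le> 1 * (2 * d)\<close> by (simp add: abs_mult mult_left_mono)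
      ultimately show ?thesis by linarith
    qed
    ultimately show "\<bar>profile_slope s r - (r\<^sup>2 / (r\<^sup>2 + d)) ^ (l + 1) * (r * V' r + 2 * real (l + 1) * V r * (d / (r\<^sup>2 + d)))\<bar>
      \<le> 2 * d * real (l + 1)"
      by (simp add: z_def algebra_simps)
  qed
qed

end

text \<open>At a fixed \<open>r > 0\<close> the cutoff tends to 1 and d / (r^2 + d) tends to 0 as d
  does, while both stay between 0 and 1. Convergence need not be uniform near the origin, so a
  common bound \<open>M\<close> is recorded for dominated convergence.\<close>

lemma (in solid) profile_dense:
  fixes V V' :: "real \<Rightarrow> real"
  assumes V: "\<And>r. r \<in> {0..1} \<Longrightarrow> (V has_real_derivative V' r) (at r within {0..1})"
    and V': "continuous_on {0..1} V'" and V1: "V 1 = 0"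
  obtains s :: "nat \<Rightarrow> real poly" and M :: real where "\<And>n. poly (s n) 1 = 0"
    "\<And>n r. 0 < r \<Longrightarrow> r < 1 \<Longrightarrow> \<bar>profile (s n) r\<bar> \<le> M" "\<And>n r. 0 < r \<Longrightarrow> r < 1 \<Longrightarrow> \<bar>profile_slope (s n) r\<bar> \<le> M"
    "\<And>r. 0 < r \<Longrightarrow> r < 1 \<Longrightarrow> (\<lambda>n. profile (s n) r) \<longlonglongrightarrow> V r"
    "\<And>r. 0 < r \<Longrightarrow> r < 1 \<Longrightarrow> (\<lambda>n. profile_slope (s n) r) \<longlonglongrightarrow> r * V' r"
proof -
  define d where "d n = 1 / real (Suc n)" for n
  have d: "d n > 0" "d n \<le> 1" for n by (simp_all add: d_def)
  have d0: "d \<longlonglongrightarrow> 0" unfolding d_def by (rule LIMSEQ_Suc[OF lim_1_over_n])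
  define \<theta> where "\<theta> n r = (r\<^sup>2 / (r\<^sup>2 + d n)) ^ (l + 1)" for n r
  define A where "A n r = \<theta> n r * V r" for n r
  define B where "B n r = \<theta> n r * (r * V' r + 2 * real (l + 1) * V r * (d n / (r\<^sup>2 + d n)))" for n r
  have "\<exists>s. poly s 1 = 0 \<and> (\<forall>r. 0 < r \<longrightarrow> r < 1 \<longrightarrow> \<bar>profile s r - A n r\<bar> \<le> 2 * d n \<and> \<bar>profile_slope s r - B n r\<bar> \<le> 2 * d n * real (l + 1))" for n
    unfolding A_def B_def \<theta>_def by (rule profile_dense_step[OF V V' V1 d(1)])
  then obtain s where s: "\<And>n. poly (s n) 1 = 0"
    "\<And>n r. 0 < r \<Longrightarrow> r < 1 \<Longrightarrow> \<bar>profile (s n) r - A n r\<bar> \<le> 2 * d n"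
    "\<And>n r. 0 < r \<Longrightarrow> r < 1 \<Longrightarrow> \<bar>profile_slope (s n) r - B n r\<bar> \<le> 2 * d n * real (l + 1)" by metis
  have cV: "continuous_on {0..1} V" using V by (rule DERIV_continuous_on)
  have bdd: "\<exists>K. \<forall>r\<in>{0..1}. \<bar>f r\<bar> \<le> K" if "continuous_on {0..1} f" for f :: "real \<Rightarrow> real"
    using compact_imp_bounded[OF compact_continuous_image[OF that compact_Icc]] by (simp add: bounded_iff)
  obtain K K' where K: "\<And>r. r \<in> {0..1} \<Longrightarrow> \<bar>V r\<bar> \<le> K" "\<And>r. r \<in> {0..1} \<Longrightarrow> \<bar>V' r\<bar> \<le> K'"
    using bdd[OF cV] bdd[OF V'] by blast
  have K0: "K \<ge> 0" "K' \<ge> 0" using K(1)[of 0] K(2)[of 0] by auto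
  have \<theta>: "0 \<le> \<theta> n r" "\<theta> n r \<le> 1" and dq: "0 \<le> d n / (r\<^sup>2 + d n)" "d n / (r\<^sup>2 + d n) \<le> 1" for n r
  proof -
    have "r\<^sup>2 + d n > 0" using d[of n] by (simp add: add_nonneg_pos)
    then have "0 \<le> r\<^sup>2 / (r\<^sup>2 + d n)" "r\<^sup>2 / (r\<^sup>2 + d n) \<le> 1" "0 \<le> d n / (r\<^sup>2 + d n)" "d n / (r\<^sup>2 + d n) \<le> 1"
      using d[of n] by (auto simp: divide_simps)
    then show "0 \<le> \<theta> n r" "\<theta> n r \<le> 1" "0 \<le> d n / (r\<^sup>2 + d n)" "d n / (r\<^sup>2 + d n) \<le> 1"
      unfolding \<theta>_def by (auto intro: power_le_one simp del: power_Suc)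
  qed
  \<comment> \<open>Bounds for \<open>A\<close> and \<open>B\<close> plus the approximation errors,
    which are at most 2 (l + 1) since \<open>d n \<le> 1\<close>.\<close>
  define M where "M = K + K' + 2 * real (l + 1) * K + 2 * real (l + 1)"
  have Ab: "\<bar>A n r\<bar> \<le> K" if "0 < r" "r < 1" for n r
    using mult_mono[OF \<theta>(2)[of n r] K(1)[of r]] that \<theta>[of n r] by (simp add: A_def abs_mult)
  have Bb: "\<bar>B n r\<bar> \<le> K' + 2 * real (l + 1) * K" if r: "0 < r" "r < 1" for n r
  proof -
    have "\<bar>r * V' r\<bar> \<le> 1 * K'" unfolding abs_mult using K(2)[of r] r by (intro mult_mono) auto
    moreover have "\<bar>2 * real (l + 1) * V r * (d n / (r\<^sup>2 + d n))\<bar> \<le> 2 * real (l + 1) * K * 1"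
    proof -
      have "\<bar>d n / (r\<^sup>2 + d n)\<bar> \<le> 1" unfolding abs_of_nonneg[OF dq(1)] by (rule dq(2))
      moreover have "\<bar>2 * real (l + 1) * V r\<bar> \<le> 2 * real (l + 1) * K"
        using K(1)[of r] r by (simp add: abs_mult)
      ultimately show ?thesis unfolding abs_mult[of _ "d n / (r\<^sup>2 + d n)"] using K0 by (intro mult_mono) auto
    qed
    ultimately have "\<bar>r * V' r + 2 * real (l + 1) * V r * (d n / (r\<^sup>2 + d n))\<bar> \<le> K' + 2 * real (l + 1) * K" by linarith
    then have "\<theta> n r * \<bar>r * V' r + 2 * real (l + 1) * V r * (d n / (r\<^sup>2 + d n))\<bar> \<le> 1 * (K' + 2 * real (l + 1) * K)"
      using \<theta>[of n r] by (intro mult_mono) auto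
    then show ?thesis using \<theta>[of n r] by (simp add: B_def abs_mult)
  qed
  show thesis
  proof (rule that[of s M])
    show "poly (s n) 1 = 0" for n by (rule s)
    fix r :: real assume r: "0 < r" "r < 1"
    have lK: "0 \<le> 2 * real (l + 1) * K" using K0 by simp
    have l2: "2 * d n \<le> 2 * real (l + 1)" "2 * d n * real (l + 1) \<le> 2 * real (l + 1)" for n
      using d[of n] mult_right_mono[OF d(2)[of n], of "2 * real (l + 1)"] by (auto simp: mult_ac)
    show "\<bar>profile (s n) r\<bar> \<le> M" for n
      using s(2)[OF r, of n] Ab[OF r, of n] l2(1)[of n] K0 lK unfolding M_def by linarith
    show "\<bar>profile_slope (s n) r\<bar> \<le> M" for n
      using s(3)[OF r, of n] Bb[OF r, of n] l2(2)[of n] K0 lK unfolding M_def by linarith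
    have r2: "r\<^sup>2 + 0 \<noteq> 0" using r by simp
    have "(\<lambda>n. \<theta> n r) \<longlonglongrightarrow> (r\<^sup>2 / (r\<^sup>2 + 0)) ^ (l + 1)"
      unfolding \<theta>_def by (intro tendsto_intros d0 r2)
    then have \<theta>1: "(\<lambda>n. \<theta> n r) \<longlonglongrightarrow> 1" using r by simp
    have "(\<lambda>n. A n r) \<longlonglongrightarrow> 1 * V r" unfolding A_def by (intro tendsto_intros \<theta>1)
    then have A: "(\<lambda>n. A n r) \<longlonglongrightarrow> V r" by simp
    have "(\<lambda>n. B n r) \<longlonglongrightarrow> 1 * (r * V' r + 2 * real (l + 1) * V r * (0 / (r\<^sup>2 + 0)))"
      unfolding B_def by (intro tendsto_intros \<theta>1 d0 r2)
    then have B: "(\<lambda>n. B n r) \<longlonglongrightarrow> r * V' r" by simp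
    have "(\<lambda>n. 2 * d n) \<longlonglongrightarrow> 0" "(\<lambda>n. 2 * d n * real (l + 1)) \<longlonglongrightarrow> 0"
      using d0 by (auto intro!: tendsto_eq_intros)
    note null = this
    have "(\<lambda>n. profile (s n) r - A n r) \<longlonglongrightarrow> 0"
      by (rule Lim_null_comparison[OF _ null(1)]) (simp add: s(2)[OF r])
    moreover have "(\<lambda>n. profile_slope (s n) r - B n r) \<longlonglongrightarrow> 0"
      by (rule Lim_null_comparison[OF _ null(2)]) (use s(3)[OF r] in simp)
    ultimately have "(\<lambda>n. profile (s n) r - A n r) \<longlonglongrightarrow> 0" "(\<lambda>n. profile_slope (s n) r - B n r) \<longlonglongrightarrow> 0" .
    from tendsto_add[OF this(1) A] tendsto_add[OF this(2) B]
    show "(\<lambda>n. profile (s n) r) \<longlonglongrightarrow> V r" "(\<lambda>n. profile_slope (s n) r) \<longlonglongrightarrow> r * V' r" by simp_all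
  qed
qed

section \<open>The one-dimensional quadratic form\<close>

context radial_conductivity
begin

abbreviation sphere_ev :: real where "sphere_ev \<equiv> real (l * (l + 1))"

lemma g_abs: "\<bar>g r\<bar> \<le> C" and g_pos: "g r > 0"
  using g_bounds[of r] positive_imp_inverse_positive[OF C_pos] by linarith+

lemma g_weighted_integrable:
  fixes f :: "real \<Rightarrow> 'b::euclidean_space"
  assumes f: "continuous_on {0..1} f"
  shows "integrable unit_interval (\<lambda>r. g r *\<^sub>R f r)"
proof -
  note i = continuous_integrable_unit_interval(1)[OF f]
  have gm: "g \<in> borel_measurable unit_interval" by (intro measurable_restrict_space1) simp
  show ?thesis
    by (rule Bochner_Integration.integrable_bound[OF integrable_mult_right[OF integrable_norm[OF i], of C]])
       (use g_abs C_pos borel_measurable_integrable[OF i] gm in \<open>auto simp: abs_mult intro!: AE_I2 mult_mono borel_measurable_scaleR\<close>)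
qed

text \<open>Here \<open>b\<close> and \<open>w\<close> stand for \<open>r\<close> times the derivatives of \<open>a\<close> and \<open>v\<close>.\<close>
definition radial_form :: "(real \<Rightarrow> real) \<Rightarrow> (real \<Rightarrow> real) \<Rightarrow> (real \<Rightarrow> real) \<Rightarrow> (real \<Rightarrow> real) \<Rightarrow> real" where
  "radial_form a b v w = (\<integral>r. g r * (b r * w r + sphere_ev * (a r * v r)) \<partial>unit_interval)"

abbreviation poly_form :: "real poly \<Rightarrow> real poly \<Rightarrow> real" where
  "poly_form s t \<equiv> radial_form (profile s) (profile_slope s) (profile t) (profile_slope t)"

lemma radial_form_integrable:
  assumes "continuous_on {0..1} a" "continuous_on {0..1} b" "continuous_on {0..1} v" "continuous_on {0..1} w"
  shows "integrable unit_interval (\<lambda>r. g r * (b r * w r + sphere_ev * (a r * v r)))"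
  using g_weighted_integrable[of "\<lambda>r. b r * w r + sphere_ev * (a r * v r)"] assms by (simp add: continuous_intros)

text \<open>A weighted Cauchy-Schwarz inequality for a positive form; the free weight
  \<open>e\<close> lets a merely bounded energy be multiplied by something small while a small
  energy absorbs the factor 1 / e.\<close>

lemma radial_form_bound:
  assumes c: "continuous_on {0..1} a" "continuous_on {0..1} b" "continuous_on {0..1} v" "continuous_on {0..1} w" and e: "e > 0"
  shows "\<bar>radial_form a b v w\<bar> \<le> e * radial_form a b a b + radial_form v w v w / e"
proof -
  have amgm: "\<bar>x * y\<bar> \<le> e * (x * x) + y * y / e" for x y :: real
  proof -
    have "0 \<le> (e * \<bar>x\<bar> - \<bar>y\<bar>)\<^sup>2 / e + e * (x * x) + y * y / e" using e by simp
    also have "\<dots> = 2 * (e * (x * x) + y * y / e) - 2 * \<bar>x * y\<bar>"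
      using e by (simp add: power2_eq_square abs_mult field_simps abs_mult_self_eq)
    finally show ?thesis by simp
  qed
  note i = radial_form_integrable[OF c] radial_form_integrable[OF c(1,2,1,2)] radial_form_integrable[OF c(3,4,3,4)]
  have "\<bar>radial_form a b v w\<bar> \<le> (\<integral>r. e * (g r * (b r * b r + sphere_ev * (a r * a r))) + g r * (w r * w r + sphere_ev * (v r * v r)) / e \<partial>unit_interval)"
    unfolding radial_form_def
  proof (rule order_trans[OF integral_abs_bound integral_mono])
    fix r
    have "\<bar>b r * w r + sphere_ev * (a r * v r)\<bar> \<le> \<bar>b r * w r\<bar> + sphere_ev * \<bar>a r * v r\<bar>"
      using abs_triangle_ineq[of "b r * w r" "sphere_ev * (a r * v r)"] by (simp add: abs_mult)
    also have "\<dots> \<le> (e * (b r * b r) + w r * w r / e) + sphere_ev * (e * (a r * a r) + v r * v r / e)"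
      by (intro add_mono mult_left_mono amgm) auto
    finally have "g r * \<bar>b r * w r + sphere_ev * (a r * v r)\<bar> \<le> g r * ((e * (b r * b r) + w r * w r / e) + sphere_ev * (e * (a r * a r) + v r * v r / e))"
      using g_pos[of r] by (intro mult_left_mono) auto
    then show "\<bar>g r * (b r * w r + sphere_ev * (a r * v r))\<bar>
        \<le> e * (g r * (b r * b r + sphere_ev * (a r * a r))) + g r * (w r * w r + sphere_ev * (v r * v r)) / e"
    proof -
      have "e * (g r * (b r * b r + sphere_ev * (a r * a r))) + g r * (w r * w r + sphere_ev * (v r * v r)) / e
        = g r * ((e * (b r * b r) + w r * w r / e) + sphere_ev * (e * (a r * a r) + v r * v r / e))"
        by (simp add: algebra_simps add_divide_distrib del: of_nat_mult of_nat_add)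
      moreover have "\<bar>g r * x\<bar> = g r * \<bar>x\<bar>" for x using g_pos[of r] by (simp add: abs_mult)
      ultimately show ?thesis
        using \<open>g r * \<bar>b r * w r + sphere_ev * (a r * v r)\<bar> \<le> _\<close> by presburger
    qed
  qed (use i in auto)
  also have "\<dots> = e * radial_form a b a b + radial_form v w v w / e"
    unfolding radial_form_def using i by simp
  finally show ?thesis .
qed

lemma poly_form_linear:
  "poly_form s t = poly_form t s" "poly_form (s + t) u = poly_form s u + poly_form t u"
  "poly_form (smult c s) t = c * poly_form s t" "poly_form s s \<ge> 0"
proof -
  note i = radial_form_integrable[OF profile_continuous profile_continuous]
  show "poly_form s t = poly_form t s" unfolding radial_form_def by (simp add: mult.commute)
  show "poly_form (s + t) u = poly_form s u + poly_form t u"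
    unfolding radial_form_def using i
    by (subst Bochner_Integration.integral_add[symmetric]) (auto simp: profile_linear algebra_simps)
  show "poly_form (smult c s) t = c * poly_form s t"
    unfolding radial_form_def
    by (subst integral_mult_right_zero[symmetric]) (auto simp: profile_linear algebra_simps)
  show "poly_form s s \<ge> 0"
    unfolding radial_form_def using g_pos by (intro Bochner_Integration.integral_nonneg) (simp add: less_imp_le)
qed

lemma radial_form_diff:
  assumes "continuous_on {0..1} a" "continuous_on {0..1} b" "continuous_on {0..1} v" "continuous_on {0..1} w"
    "continuous_on {0..1} v'" "continuous_on {0..1} w'"
  shows "radial_form a b (\<lambda>r. v r - v' r) (\<lambda>r. w r - w' r) = radial_form a b v w - radial_form a b v' w'"
  unfolding radial_form_def using radial_form_integrable[OF assms(1-4)] radial_form_integrable[OF assms(1,2,5,6)]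
  by (subst Bochner_Integration.integral_diff[symmetric]) (auto simp: algebra_simps)

text \<open>\<open>V\<close> is approximated by polynomial profiles in the energy of the form. Since
  the energies of \<open>s n\<close> are bounded by \<open>M\<close>, the error is uniform in
  \<open>n\<close>, and the equation for polynomials carries over.\<close>

lemma weak_equation_C1:
  assumes s: "\<And>n. poly_form (s n) (s n) \<le> M" "\<And>t. poly t 1 = 0 \<Longrightarrow> (\<lambda>n. poly_form (s n) t) \<longlonglongrightarrow> 0"
    and V: "\<And>r. r \<in> {0..1} \<Longrightarrow> (V has_real_derivative V' r) (at r within {0..1})"
    and V': "continuous_on {0..1} V'" and V1: "V 1 = 0"
  shows "(\<lambda>n. radial_form (profile (s n)) (profile_slope (s n)) V (\<lambda>r. r * V' r)) \<longlonglongrightarrow> 0"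
proof -
  let ?w = "\<lambda>r. r * V' r"
  have cV: "continuous_on {0..1} V" using V by (rule DERIV_continuous_on)
  have cw: "continuous_on {0..1} ?w" by (intro continuous_intros V')
  obtain t :: "nat \<Rightarrow> real poly" and K where t: "\<And>n. poly (t n) 1 = 0"
    "\<And>n r. 0 < r \<Longrightarrow> r < 1 \<Longrightarrow> \<bar>profile (t n) r\<bar> \<le> K" "\<And>n r. 0 < r \<Longrightarrow> r < 1 \<Longrightarrow> \<bar>profile_slope (t n) r\<bar> \<le> K"
    "\<And>r. 0 < r \<Longrightarrow> r < 1 \<Longrightarrow> (\<lambda>n. profile (t n) r) \<longlonglongrightarrow> V r"
    "\<And>r. 0 < r \<Longrightarrow> r < 1 \<Longrightarrow> (\<lambda>n. profile_slope (t n) r) \<longlonglongrightarrow> ?w r"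
    using profile_dense[OF V V' V1] by blast
  \<comment> \<open>The energy of the approximation error; it tends to zero by dominated
    convergence, with the pointwise bounds from \<open>profile_dense\<close>.\<close>
  define Q where "Q k = radial_form (\<lambda>r. V r - profile (t k) r) (\<lambda>r. ?w r - profile_slope (t k) r)
     (\<lambda>r. V r - profile (t k) r) (\<lambda>r. ?w r - profile_slope (t k) r)" for k
  have cd: "continuous_on {0..1} (\<lambda>r. V r - profile (t k) r)" "continuous_on {0..1} (\<lambda>r. ?w r - profile_slope (t k) r)" for k
    by (intro continuous_intros cV V' profile_continuous)+
  have bdd: "\<exists>K. \<forall>r\<in>{0..1}. \<bar>f r\<bar> \<le> K" if "continuous_on {0..1} f" for f :: "real \<Rightarrow> real"
    using compact_imp_bounded[OF compact_continuous_image[OF that compact_Icc]] by (simp add: bounded_iff)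
  obtain K1 K2 where K12: "\<And>r. r \<in> {0..1} \<Longrightarrow> \<bar>V r\<bar> \<le> K1" "\<And>r. r \<in> {0..1} \<Longrightarrow> \<bar>?w r\<bar> \<le> K2"
    using bdd[OF cV] bdd[OF cw] by blast
  let ?q = "\<lambda>k r. g r * ((?w r - profile_slope (t k) r) * (?w r - profile_slope (t k) r)
        + sphere_ev * ((V r - profile (t k) r) * (V r - profile (t k) r)))"
  let ?bd = "C * ((K2 + K) * (K2 + K) + sphere_ev * ((K1 + K) * (K1 + K)))"
  have "Q \<longlonglongrightarrow> (\<integral>r. 0 \<partial>unit_interval)"
    unfolding Q_def radial_form_def
  proof (rule integral_dominated_convergence[where w = "\<lambda>r. ?bd"])
    show "integrable unit_interval (\<lambda>r. ?bd)"
      by (rule continuous_integrable_unit_interval(1)) simp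
    show "AE r in unit_interval. (\<lambda>k. ?q k r) \<longlonglongrightarrow> 0"
    proof (rule AE_I2)
      fix r assume "r \<in> space unit_interval"
      then have r: "0 < r" "r < 1" by (auto simp: space_restrict_space)
      have "(\<lambda>k. ?q k r) \<longlonglongrightarrow>
        g r * ((?w r - ?w r) * (?w r - ?w r) + sphere_ev * ((V r - V r) * (V r - V r)))"
        by (intro tendsto_intros t r)
      then show "(\<lambda>k. ?q k r) \<longlonglongrightarrow> 0" by simp
    qed
    show "AE r in unit_interval. norm (?q k r) \<le> ?bd" for k
    proof (rule AE_I2)
      fix r assume "r \<in> space unit_interval"
      then have r: "0 < r" "r < 1" by (auto simp: space_restrict_space)
      have 1: "\<bar>?w r - profile_slope (t k) r\<bar> \<le> K2 + K" "\<bar>V r - profile (t k) r\<bar> \<le> K1 + K"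
        using K12(1)[of r] K12(2)[of r] t(2)[OF r, of k] t(3)[OF r, of k] r by auto
      have sq: "x * x \<le> y * y" if "\<bar>x\<bar> \<le> y" for x y :: real
        using mult_mono[OF that that] that by (simp add: abs_mult_self_eq)
      have "(?w r - profile_slope (t k) r) * (?w r - profile_slope (t k) r)
        + sphere_ev * ((V r - profile (t k) r) * (V r - profile (t k) r)) \<le> (K2 + K) * (K2 + K) + sphere_ev * ((K1 + K) * (K1 + K))"
        by (intro add_mono mult_left_mono sq 1) simp
      then show "norm (?q k r) \<le> ?bd"
        unfolding real_norm_def abs_mult[of "g r"] using g_abs[of r] C_pos by (intro mult_mono) auto
    qed
  qed (use radial_form_integrable[OF cd cd] in auto)
  then have Q0: "Q \<longlonglongrightarrow> 0" by simp
  have M: "M \<ge> 0" using s(1)[of 0] poly_form_linear(4)[of "s 0"] by linarith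
  show ?thesis
  proof (rule LIMSEQ_I)
    fix \<epsilon> :: real assume \<epsilon>: "\<epsilon> > 0"
    \<comment> \<open>First \<open>e\<close> makes \<open>e * M\<close> small, then \<open>k\<close>
      makes \<open>Q k\<close> small relative to \<open>e\<close>, and last \<open>N\<close> is
      taken for that fixed \<open>t k\<close>. The \<open>+ 1\<close> covers
      \<open>M = 0\<close>.\<close>
    define e where "e = \<epsilon> / (4 * (M + 1))"
    have e: "e > 0" "e * M \<le> \<epsilon> / 4" using \<epsilon> M by (auto simp: e_def field_simps)
    obtain k where k: "Q k < e * \<epsilon> / 4"
      using order_tendstoD(2)[OF Q0, of "e * \<epsilon> / 4"] e \<epsilon> by (auto simp: eventually_sequentially)
    obtain N where N: "\<And>n. n \<ge> N \<Longrightarrow> \<bar>poly_form (s n) (t k)\<bar> < \<epsilon> / 4"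
      using LIMSEQ_D[OF s(2)[OF t(1)[of k]], of "\<epsilon> / 4"] \<epsilon> by auto
    show "\<exists>N. \<forall>n\<ge>N. norm (radial_form (profile (s n)) (profile_slope (s n)) V ?w - 0) < \<epsilon>"
    proof (intro exI[of _ N] allI impI)
      fix n assume n: "n \<ge> N"
      note c = profile_continuous[of "{0..1}" "s n"]
      have "radial_form (profile (s n)) (profile_slope (s n)) V ?w
        = radial_form (profile (s n)) (profile_slope (s n)) (\<lambda>r. V r - profile (t k) r) (\<lambda>r. ?w r - profile_slope (t k) r)
          + poly_form (s n) (t k)"
        using radial_form_diff[OF c cV cw profile_continuous] by simp
      moreover have "\<bar>radial_form (profile (s n)) (profile_slope (s n)) (\<lambda>r. V r - profile (t k) r) (\<lambda>r. ?w r - profile_slope (t k) r)\<bar>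
          \<le> e * poly_form (s n) (s n) + Q k / e"
        unfolding Q_def by (rule radial_form_bound[OF c cd e(1)])
      moreover have "e * poly_form (s n) (s n) \<le> e * M" using s(1)[of n] e by (intro mult_left_mono) auto
      moreover have "Q k / e < \<epsilon> / 4" using k e by (simp add: field_simps)
      ultimately show "norm (radial_form (profile (s n)) (profile_slope (s n)) V ?w - 0) < \<epsilon>"
        using N[OF n] e(2) \<epsilon> unfolding real_norm_def diff_zero by linarith
    qed
  qed
qed

end

section \<open>Existence of the solution\<close>

lemma open_not_AE_avoided:
  fixes U :: "'a::euclidean_space set"
  assumes "open U" "U \<noteq> {}" shows "\<not> (AE x in lborel. x \<notin> U)"
proof
  assume "AE x in lborel. x \<notin> U"
  then have "AE x in lebesgue. x \<notin> U" by (rule AE_completion)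
  then have "U \<in> null_sets lebesgue" using assms(1) by (subst AE_iff_null_sets) auto
  then show False using open_not_negligible[OF assms] negligible_iff_null_sets by blast
qed

text \<open>The cone over a null set of directions is Lebesgue null and cannot contain a nonempty
  open set. Positivity of the area and of \<open>mass\<close> both rest on this.\<close>

lemma AE_surface_meets_cone:
  assumes ae: "AE \<omega> in surface_measure. P \<omega>" and U: "open U" "U \<subseteq> unit_ball - {0}" "U \<noteq> {}"
  shows "\<exists>x\<in>U. P (x /\<^sub>R norm x)"
proof (rule ccontr)
  assume no: "\<not> ?thesis"
  have "AE x in lborel. x \<notin> U"
    using AE_surface_imp_AE_ball[OF ae] by eventually_elim (use no U(2) in blast)
  then show False using open_not_AE_avoided[OF U(1,3)] by blast
qed

lemma total_area_pos: "total_area > 0"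
proof (rule ccontr)
  interpret finite_measure surface_measure by (rule finite_surface_measure)
  assume "\<not> total_area > 0"
  then have "measure surface_measure (space surface_measure) = 0"
    unfolding total_area_def by (meson measure_nonneg not_less order_antisym)
  then have "space surface_measure \<in> null_sets surface_measure"
    by (auto simp: null_sets_def emeasure_eq_measure)
  then have "AE \<omega> in surface_measure. False" by (rule AE_I') auto
  moreover have "(1/2) *\<^sub>R axis 1 1 \<in> unit_ball - {0 :: real^3}" by (auto simp: axis_eq_0_iff)
  ultimately show False using AE_surface_meets_cone[of "\<lambda>_. False" "unit_ball - {0}"] by blast
qed

text \<open>The profile \<open>g0\<close> need not be measurable; averaging \<open>\<gamma>\<close> over spheres gives a measurable one.\<close>
lemma radial_profile_exists:
  fixes \<gamma> :: "real^3 \<Rightarrow> real"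
  assumes C: "C > 0" and \<gamma>: "\<gamma> \<in> borel_measurable ball_measure"
    and bounds: "AE x in ball_measure. inverse C \<le> \<gamma> x \<and> \<gamma> x \<le> C"
    and radial: "AE x in ball_measure. \<gamma> x = g0 (norm x)"
  obtains g :: "real \<Rightarrow> real" where "g \<in> borel_measurable borel" "\<And>r. inverse C \<le> g r"
    "\<And>r. g r \<le> C" "AE x in ball_measure. \<gamma> x = g (norm x)"
proof -
  interpret pair_sigma_finite radial_measure surface_measure by (rule pair_sigma_finite_polar)
  have AEb: "(AE x in ball_measure. P x) \<longleftrightarrow> (AE x in lborel. x \<in> unit_ball \<longrightarrow> P x)" for P
    by (subst AE_restrict_space_iff) (auto simp: AE_completion_iff)
  \<comment> \<open>The bounds are compatible because they hold somewhere in the ball, which is not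
    null; this lets clamping between \<open>inverse C\<close> and \<open>C\<close> respect
    both.\<close>
  have "inverse C \<le> C"
  proof (rule ccontr)
    assume "\<not> inverse C \<le> C"
    then have "AE x in lborel. x \<notin> (unit_ball :: (real^3) set)"
      by (intro eventually_mono[OF bounds[unfolded AEb]]) auto
    then show False using open_not_AE_avoided[of "unit_ball :: (real^3) set"] by simp
  qed
  have "(\<lambda>x. if x \<in> unit_ball then \<gamma> x else 0) \<in> borel_measurable lebesgue"
    using \<gamma> borel_measurable_if[of unit_ball \<gamma>] by (simp del: mem_ball_0)
  then obtain \<gamma>' where \<gamma>': "\<gamma>' \<in> borel_measurable lborel" "AE x in lborel. (if x \<in> unit_ball then \<gamma> x else 0) = \<gamma>' x"
    using completion_ex_borel_measurable_real by blast
  then have [measurable]: "\<gamma>' \<in> borel_measurable borel" by simp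
  have "AE x in lborel. x \<in> unit_ball \<longrightarrow> \<gamma>' x = g0 (norm x)"
    using radial[unfolded AEb] \<gamma>'(2) by eventually_elim auto
  then obtain N where N: "{x. \<not> (x \<in> unit_ball \<longrightarrow> \<gamma>' x = g0 (norm x))} \<subseteq> N" "N \<in> null_sets lborel"
    by (auto elim!: AE_E simp: null_sets_def)
  \<comment> \<open>By Fubini almost every sphere meets \<open>N\<close> in a null set. On such a
    sphere the Borel representative is almost everywhere the constant \<open>g0 r\<close>, so its
    average is \<open>g0 r\<close> even if \<open>g0\<close> is not measurable.\<close>
  have "AE r in radial_measure. AE \<omega> in surface_measure. r *\<^sub>R \<omega> \<notin> N"
  proof (rule AE_polar)
    show "Measurable.pred borel (\<lambda>x. x \<notin> N)" using N(2) by (auto simp: null_sets_def)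
    show "AE x in lborel. x \<in> unit_ball \<longrightarrow> x \<notin> N" using AE_not_in[OF N(2)] by eventually_elim simp
  qed
  then have sph: "AE x in lborel. x \<in> unit_ball - {0::real^3} \<longrightarrow> (AE \<omega> in surface_measure. norm x *\<^sub>R \<omega> \<notin> N)"
    by (rule AE_radial_imp_AE_ball)
  define a where "a r = (\<integral>\<omega>. \<gamma>' (r *\<^sub>R \<omega>) \<partial>surface_measure) / total_area" for r
  have pm: "(\<lambda>(r, \<omega>). \<gamma>' (r *\<^sub>R \<omega>)) \<in> borel_measurable (radial_measure \<Otimes>\<^sub>M surface_measure)"
    using measurable_compose[OF measurable_polar_coordinates, of \<gamma>'] by (simp add: case_prod_beta)
  have "(\<lambda>r. \<integral>\<omega>. \<gamma>' (r *\<^sub>R \<omega>) \<partial>surface_measure) \<in> borel_measurable radial_measure"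
    by (rule M2.borel_measurable_lebesgue_integral[OF pm])
  then have [measurable]: "a \<in> borel_measurable borel"
    unfolding a_def by (simp add: measurable_cong_sets[OF sets_radial_measure refl])
  have average: "a r = g0 r" if r: "0 < r" "r < 1" and ae: "AE \<omega> in surface_measure. r *\<^sub>R \<omega> \<notin> N" for r
  proof -
    have "(\<integral>\<omega>. \<gamma>' (r *\<^sub>R \<omega>) \<partial>surface_measure) = (\<integral>\<omega>. g0 r \<partial>surface_measure)"
    proof (rule integral_cong_AE)
      have "(\<lambda>\<omega>. \<omega>) \<in> surface_measure \<rightarrow>\<^sub>M (borel :: (real^3) measure)"
        by (simp add: measurable_cong_sets[OF sets_surface_measure refl] measurable_restrict_space1)
      then show "(\<lambda>\<omega>. \<gamma>' (r *\<^sub>R \<omega>)) \<in> borel_measurable surface_measure" by measurable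
      show "AE \<omega> in surface_measure. \<gamma>' (r *\<^sub>R \<omega>) = g0 r"
        using ae AE_space
      proof eventually_elim
        case (elim \<omega>)
        then have "norm (r *\<^sub>R \<omega>) = r" using r by (simp add: space_surface_measure)
        moreover from this have "r *\<^sub>R \<omega> \<in> unit_ball" using r by simp
        ultimately show ?case using elim(1) N(1) by force
      qed
    qed simp
    then show ?thesis using total_area_pos by (simp add: a_def total_area_def)
  qed
  show thesis
  \<comment> \<open>Clamping gives the bounds at every radius, not only almost everywhere, and
    leaves the average unchanged where it equals a value of \<gamma> within the bounds.\<close>
  proof (rule that[of "\<lambda>r. max (inverse C) (min C (a r))"])
    show "(\<lambda>r. max (inverse C) (min C (a r))) \<in> borel_measurable borel" by measurable
    show "max (inverse C) (min C (a r)) \<le> C" for r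
      using \<open>inverse C \<le> C\<close> by simp
    have "AE x in lborel. x \<in> unit_ball \<longrightarrow> \<gamma> x = max (inverse C) (min C (a (norm x)))"
      using AE_lborel_singleton[of "0::real^3"] sph bounds[unfolded AEb] radial[unfolded AEb]
      by eventually_elim (auto simp: average)
    then show "AE x in ball_measure. \<gamma> x = max (inverse C) (min C (a (norm x)))" by (simp only: AEb)
  qed simp
qed

text \<open>If \<open>p\<close> vanished almost everywhere on the sphere, homogeneity would make it
  vanish somewhere in the open set where it is nonzero, which contains y / 2.\<close>

lemma (in solid) mass_pos:
  assumes "p y \<noteq> 0" "norm y = 1"
  shows "mass > 0"
proof -
  have i: "integrable surface_measure (\<lambda>x. (norm (p x))\<^sup>2)"
    by (intro continuous_integrable_surface continuous_intros continuous_p)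
  have "mass \<ge> 0" by (simp add: mass_def)
  moreover have "mass \<noteq> 0"
  proof
    assume "mass = 0"
    then have ae: "AE x in surface_measure. p x = 0"
      using integral_nonneg_eq_0_iff_AE[OF i] by (simp add: mass_def)
    let ?U = "(unit_ball - {0}) \<inter> {x. p x \<noteq> 0}"
    have "open {x. p x \<noteq> 0}" by (intro open_Collect_neq continuous_p continuous_on_const)
    then have "open ?U" by (intro open_Int open_delete) auto
    moreover have "(1/2) *\<^sub>R y \<in> ?U" using assms by (auto simp: scale)
    ultimately obtain x where x: "x \<in> ?U" "p (x /\<^sub>R norm x) = 0"
      using AE_surface_meets_cone[OF ae] by (metis (no_types, lifting) Int_lower1 empty_iff)
    then have "p (norm x *\<^sub>R (x /\<^sub>R norm x)) = 0" unfolding scale by simp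
    then show False using x by simp
  qed
  ultimately show ?thesis by simp
qed

section \<open>From the radial form to the solution in the ball\<close>

context radial_conductivity
begin

lemma grad_cnj_ansatz: "grad (\<lambda>x. cnj (ansatz s x)) x = (\<chi> i. cnj (grad (ansatz s) x $ i))"
  by (simp add: vec_eq_iff partial_deriv_linear[OF bounded_linear_cnj] smooth_differentiable[OF smooth_ansatz])

text \<open>This identity makes a sequence that is Cauchy for \<open>poly_form\<close> Cauchy for
  gradients in the ball, and through \<open>t = 1\<close> it identifies the eigenvalue.\<close>

lemma energy_cnj_ansatz:
  "energy \<gamma> (grad (ansatz s)) (grad (\<lambda>x. cnj (ansatz t x))) = of_real (mass * poly_form s t)"
proof -
  have "energy \<gamma> (grad (ansatz s)) (grad (\<lambda>x. cnj (ansatz t x)))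
      = (\<integral>r. of_real (mass * (g r * (profile_slope s r * profile_slope t r + sphere_ev * (profile s r * profile t r)))) \<partial>unit_interval)"
    unfolding energy_ansatz[OF smooth_cnj_ansatz]
  proof (rule Bochner_Integration.integral_cong[OF refl])
    fix r assume "r \<in> space unit_interval"
    then have "r \<noteq> 0" by (auto simp: space_restrict_space)
    then show "g r *\<^sub>R (profile_slope s r *\<^sub>R (r *\<^sub>R amplitude_deriv (\<lambda>x. cnj (ansatz t x)) r)
          + (sphere_ev * profile s r) *\<^sub>R amplitude (\<lambda>x. cnj (ansatz t x)) r)
        = of_real (mass * (g r * (profile_slope s r * profile_slope t r + sphere_ev * (profile s r * profile t r))))"
      unfolding amplitude_deriv_cnj_ansatz[OF \<open>r \<noteq> 0\<close>] amplitude_cnj_ansatz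
      by (simp add: scaleR_conv_of_real algebra_simps)
  qed
  also have "\<dots> = of_real (mass * poly_form s t)"
    unfolding radial_form_def integral_complex_of_real by simp
  finally show ?thesis .
qed

text \<open>Integrate 1 \<le> C \<gamma> against \<open>k\<close>. The weighted integral is
  complex-valued because it is read off from \<open>energy\<close>.\<close>

lemma ball_integral_le_weighted:
  fixes k :: "real^3 \<Rightarrow> real"
  assumes k: "continuous_on UNIV k" and nonneg: "\<And>x. k x \<ge> 0"
    and X: "(\<integral>x. \<gamma> x *\<^sub>R of_real (k x) \<partial>ball_measure) = (of_real X :: complex)"
  shows "(\<integral>x. k x \<partial>ball_measure) \<le> C * X"
proof -
  note ik = continuous_integrable_ball[OF k]
  have i: "integrable ball_measure (\<lambda>x. \<gamma> x * k x)"
    by (rule Bochner_Integration.integrable_bound[OF integrable_mult_right[OF ik, of C]])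
       (use \<gamma>_abs_bound nonneg C_pos borel_measurable_integrable[OF ik] in
         \<open>auto simp: abs_mult elim!: eventually_mono intro!: mult_right_mono\<close>)
  have "(\<integral>x. k x \<partial>ball_measure) \<le> (\<integral>x. C * (\<gamma> x * k x) \<partial>ball_measure)"
  proof (rule integral_mono_AE[OF ik integrable_mult_right[OF i]])
    show "AE x in ball_measure. k x \<le> C * (\<gamma> x * k x)"
      using \<gamma>_bounds
    proof eventually_elim
      case (elim x)
      then have "1 \<le> C * \<gamma> x" using C_pos by (simp add: field_simps)
      from mult_right_mono[OF this nonneg[of x]] show ?case by simp
    qed
  qed
  also have "\<dots> = C * X"
  proof -
    have "complex_of_real (\<integral>x. \<gamma> x * k x \<partial>ball_measure) = of_real X"
      unfolding X[symmetric] integral_complex_of_real[symmetric] by (simp add: scaleR_conv_of_real)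
    then show ?thesis by simp
  qed
  finally show ?thesis .
qed

lemma grad_ansatz_L2_bound: "(\<integral>x. (norm (grad (ansatz s) x))\<^sup>2 \<partial>ball_measure) \<le> C * (mass * poly_form s s)"
proof (rule ball_integral_le_weighted)
  show "continuous_on UNIV (\<lambda>x. (norm (grad (ansatz s) x))\<^sup>2)"
    by (intro continuous_intros smooth_continuous_grad smooth_ansatz)
  show "(\<integral>x. \<gamma> x *\<^sub>R of_real ((norm (grad (ansatz s) x))\<^sup>2) \<partial>ball_measure) = complex_of_real (mass * poly_form s s)"
    unfolding energy_cnj_ansatz[symmetric] energy_def grad_cnj_ansatz by (simp only: dot_cnj[symmetric] vec_lambda_beta)
qed simp

text \<open>For \<open>l > 0\<close> the coefficient l (l + 1) is at least 1, so the zero-order term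
  of the form dominates r^2 R^2. For \<open>l = 0\<close> a constant profile has zero energy, so no
  such estimate can hold for nonzero \<open>p\<close>.\<close>

lemma ansatz_L2_bound:
  assumes "l > 0"
  shows "(\<integral>x. (norm (ansatz s x))\<^sup>2 \<partial>ball_measure) \<le> C * (mass * poly_form s s)"
proof -
  have mass: "mass \<ge> 0" by (simp add: mass_def)
  have c: "continuous_on UNIV (\<lambda>x. (norm (ansatz s x))\<^sup>2)" by (intro continuous_intros smooth_continuous smooth_ansatz)
  then have c': "continuous_on UNIV (\<lambda>x. complex_of_real ((norm (ansatz s x))\<^sup>2))" by (rule continuous_on_of_real)
  let ?X = "\<integral>r. mass * (g r * (r\<^sup>2 * (profile s r)\<^sup>2)) \<partial>unit_interval"
  have i: "integrable unit_interval (\<lambda>r. g r * (r\<^sup>2 * (profile s r)\<^sup>2))"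
    using g_weighted_integrable[of "\<lambda>r. r\<^sup>2 * (profile s r)\<^sup>2"] by (simp add: continuous_intros profile_continuous)
  have sph: "(\<integral>x. complex_of_real ((norm (ansatz s (r *\<^sub>R x)))\<^sup>2) \<partial>surface_measure) = of_real (mass * (profile s r)\<^sup>2)" for r
  proof -
    have "(\<integral>x. complex_of_real ((norm (ansatz s (r *\<^sub>R x)))\<^sup>2) \<partial>surface_measure)
        = (\<integral>x. complex_of_real ((profile s r)\<^sup>2 * (norm (p x))\<^sup>2) \<partial>surface_measure)"
    proof (rule sphere_integral_cong)
      fix x :: "real^3" assume "norm x = 1"
      then have "(norm (ansatz s (r *\<^sub>R x)))\<^sup>2 = (profile s r)\<^sup>2 * (norm (p x))\<^sup>2"
        by (simp add: ansatz_def scale profile_def norm_mult norm_power power_mult_distrib flip: power_abs)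
      then show "complex_of_real ((norm (ansatz s (r *\<^sub>R x)))\<^sup>2) = of_real ((profile s r)\<^sup>2 * (norm (p x))\<^sup>2)"
        by (rule arg_cong)
    qed
    also have "\<dots> = of_real (mass * (profile s r)\<^sup>2)" unfolding integral_complex_of_real mass_def by simp
    finally show ?thesis .
  qed
  have "(\<integral>x. (norm (ansatz s x))\<^sup>2 \<partial>ball_measure) \<le> C * ?X"
  proof (rule ball_integral_le_weighted[OF c])
    have "(\<integral>x. \<gamma> x *\<^sub>R complex_of_real ((norm (ansatz s x))\<^sup>2) \<partial>ball_measure)
        = (\<integral>r. complex_of_real (mass * (g r * (r\<^sup>2 * (profile s r)\<^sup>2))) \<partial>unit_interval)"
      unfolding polar_energy[OF c'] sph
      by (rule Bochner_Integration.integral_cong[OF refl]) (simp add: scaleR_conv_of_real mult_ac)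
    also have "\<dots> = of_real ?X" by (rule integral_complex_of_real)
    finally show "(\<integral>x. \<gamma> x *\<^sub>R complex_of_real ((norm (ansatz s x))\<^sup>2) \<partial>ball_measure) = of_real ?X" .
  qed simp
  also have "?X = mass * (\<integral>r. g r * (r\<^sup>2 * (profile s r)\<^sup>2) \<partial>unit_interval)" by simp
  also have "C * \<dots> \<le> C * (mass * poly_form s s)"
    unfolding radial_form_def
  proof (intro mult_left_mono integral_mono i radial_form_integrable profile_continuous)
    fix r assume "r \<in> space unit_interval"
    then have r: "0 < r" "r < 1" by (auto simp: space_restrict_space)
    have "1 \<le> l * (l + 1)" using assms by (cases l) auto
    then have "1 \<le> sphere_ev" by (metis of_nat_1 of_nat_le_iff)
    moreover have "r\<^sup>2 \<le> 1" using r by (simp add: power_le_one)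
    ultimately have "r\<^sup>2 * (profile s r)\<^sup>2 \<le> sphere_ev * (profile s r)\<^sup>2" by (intro mult_right_mono) auto
    also have "\<dots> \<le> profile_slope s r * profile_slope s r + sphere_ev * (profile s r * profile s r)"
      by (simp add: power2_eq_square)
    finally show "r\<^sup>2 * (profile s r)\<^sup>2 \<le> profile_slope s r * profile_slope s r + sphere_ev * (profile s r * profile s r)" .
  qed (use mass C_pos g_pos in \<open>auto intro: less_imp_le\<close>)
  finally show ?thesis .
qed

text \<open>Subtracting V(1) r^l, a multiple of the profile of the polynomial 1, removes the
  boundary value and reduces to \<open>weak_equation_C1\<close>.\<close>

lemma weak_equation_boundary:
  assumes s: "\<And>n. poly_form (s n) (s n) \<le> M" "\<And>t. poly t 1 = 0 \<Longrightarrow> (\<lambda>n. poly_form (s n) t) \<longlonglongrightarrow> 0"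
    and V: "\<And>r. r \<in> {0..1} \<Longrightarrow> (V has_real_derivative V' r) (at r within {0..1})"
    and V': "continuous_on {0..1} V'"
  shows "(\<lambda>n. radial_form (profile (s n)) (profile_slope (s n)) V (\<lambda>r. r * V' r) - V 1 * poly_form (s n) 1) \<longlonglongrightarrow> 0"
proof -
  define U where "U r = V r - V 1 * profile 1 r" for r
  \<comment> \<open>At \<open>l = 0\<close> the truncated exponent \<open>l - 1\<close> is
    multiplied by the factor \<open>l\<close>, which is zero.\<close>
  define U' where "U' r = V' r - V 1 * (real l * r ^ (l - 1))" for r
  have cV: "continuous_on {0..1} V" using V by (rule DERIV_continuous_on)
  have p1: "profile 1 r = r ^ l" "profile_slope 1 r = real l * r ^ l" for r
    by (simp_all add: profile_def profile_slope_def pderiv_1)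
  have U'r: "(\<lambda>r. r * U' r) = (\<lambda>r. r * V' r - V 1 * profile_slope 1 r)"
    unfolding U'_def p1 by (cases l) (simp_all add: algebra_simps)
  have "(\<lambda>n. radial_form (profile (s n)) (profile_slope (s n)) U (\<lambda>r. r * U' r)) \<longlonglongrightarrow> 0"
  proof (rule weak_equation_C1[OF s])
    show "(U has_real_derivative U' r) (at r within {0..1})" if "r \<in> {0..1}" for r
      unfolding U_def[abs_def] U'_def p1 using DERIV_pow[of l r "{0..1}"] by (intro DERIV_diff V that DERIV_cmult) simp
    show "continuous_on {0..1} U'" unfolding U'_def[abs_def] by (intro continuous_intros V')
    show "U 1 = 0" by (simp add: U_def p1)
  qed
  moreover have "radial_form (profile (s n)) (profile_slope (s n)) U (\<lambda>r. r * U' r)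
      = radial_form (profile (s n)) (profile_slope (s n)) V (\<lambda>r. r * V' r) - V 1 * poly_form (s n) 1" for n
  proof -
    have "radial_form (profile (s n)) (profile_slope (s n)) U (\<lambda>r. r * U' r)
        = radial_form (profile (s n)) (profile_slope (s n)) V (\<lambda>r. r * V' r)
          - radial_form (profile (s n)) (profile_slope (s n)) (\<lambda>r. V 1 * profile 1 r) (\<lambda>r. V 1 * profile_slope 1 r)"
      unfolding U'r U_def[abs_def] by (intro radial_form_diff continuous_intros profile_continuous cV V')
    also have "radial_form (profile (s n)) (profile_slope (s n)) (\<lambda>r. V 1 * profile 1 r) (\<lambda>r. V 1 * profile_slope 1 r)
        = V 1 * poly_form (s n) 1"
      unfolding radial_form_def by (subst integral_mult_right_zero[symmetric]) (simp add: algebra_simps)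
    finally show ?thesis .
  qed
  ultimately show ?thesis by simp
qed

text \<open>The radial form is real while the amplitude of \<open>F\<close> is complex, so limits
  are taken in both parts separately.\<close>

lemma energy_ansatz_parts:
  assumes F: "smooth F"
  shows "Re (energy \<gamma> (grad (ansatz s)) (grad F))
      = radial_form (profile s) (profile_slope s) (\<lambda>r. Re (amplitude F r)) (\<lambda>r. r * Re (amplitude_deriv F r))" (is ?re)
    and "Im (energy \<gamma> (grad (ansatz s)) (grad F))
      = radial_form (profile s) (profile_slope s) (\<lambda>r. Im (amplitude F r)) (\<lambda>r. r * Im (amplitude_deriv F r))" (is ?im)
proof -
  have i: "integrable unit_interval (\<lambda>r. g r *\<^sub>R (profile_slope s r *\<^sub>R (r *\<^sub>R amplitude_deriv F r)
        + (sphere_ev * profile s r) *\<^sub>R amplitude F r))"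
    by (intro g_weighted_integrable continuous_intros profile_continuous amplitude_continuous F)
  show ?re ?im
    unfolding energy_ansatz[OF F] radial_form_def integral_Re[OF i, symmetric] integral_Im[OF i, symmetric]
    by (auto intro!: Bochner_Integration.integral_cong simp: algebra_simps)
qed

lemma solution_exists:
  assumes l: "l > 0" and mass: "mass > 0"
  shows "\<exists>u G ev. has_trace u G p \<and> (\<forall>F. smooth F \<longrightarrow> energy \<gamma> G (grad F) = ev * (\<integral>x. p x * F x \<partial>surface_measure))"
proof -
  obtain s M where s1: "\<And>n. poly (s n) 1 = 1" and sM: "\<And>n::nat. poly_form (s n) (s n) \<le> M"
    and sC: "\<And>e. e > 0 \<Longrightarrow> \<exists>N. \<forall>m\<ge>N. \<forall>n\<ge>N. poly_form (s m - s n) (s m - s n) < e"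
    and s0: "\<And>t. poly t 1 = 0 \<Longrightarrow> (\<lambda>n. poly_form (s n) t) \<longlonglongrightarrow> 0"
    using minimizing_sequence[of poly_form, OF poly_form_linear] by blast
  note cf = smooth_continuous[OF smooth_ansatz] smooth_continuous_grad[OF smooth_ansatz]
  have small: "\<exists>N. \<forall>m\<ge>N. \<forall>n\<ge>N. C * (mass * poly_form (s m - s n) (s m - s n)) < e" if "e > 0" for e
  proof -
    have "e / (C * mass) > 0" using that C_pos mass by simp
    from sC[OF this] obtain N where "\<forall>m\<ge>N. \<forall>n\<ge>N. poly_form (s m - s n) (s m - s n) < e / (C * mass)" by blast
    then show ?thesis using C_pos mass by (intro exI[of _ N]) (simp add: pos_less_divide_eq mult_ac)
  qed
  have "\<exists>u. L2 ball_measure u \<and> L2_converges ball_measure (\<lambda>n. ansatz (s n)) u"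
  proof (rule L2_Cauchy_convergent)
    show "L2 ball_measure (ansatz (s n))" for n by (intro continuous_L2_ball cf)
    show "\<exists>N. \<forall>m\<ge>N. \<forall>n\<ge>N. (\<integral>x. (norm (ansatz (s m) x - ansatz (s n) x))\<^sup>2 \<partial>ball_measure) < e" if "e > 0" for e
      using small[OF that] ansatz_L2_bound[OF l] unfolding ansatz_diff by (meson le_less_trans)
  qed
  then obtain u where u: "L2_converges ball_measure (\<lambda>n. ansatz (s n)) u" by blast
  have "\<exists>G. L2 ball_measure G \<and> L2_converges ball_measure (\<lambda>n. grad (ansatz (s n))) G"
  proof (rule L2_Cauchy_convergent)
    show "L2 ball_measure (grad (ansatz (s n)))" for n by (intro continuous_L2_ball cf)
    show "\<exists>N. \<forall>m\<ge>N. \<forall>n\<ge>N. (\<integral>x. (norm (grad (ansatz (s m)) x - grad (ansatz (s n)) x))\<^sup>2 \<partial>ball_measure) < e" if "e > 0" for e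
      using small[OF that] grad_ansatz_L2_bound unfolding grad_ansatz_diff by (meson le_less_trans)
  qed
  then obtain G where G: "L2 ball_measure G" "L2_converges ball_measure (\<lambda>n. grad (ansatz (s n))) G" by blast
  \<comment> \<open>\<open>s n\<close> equals 1 at 1, so every approximant already has the boundary
    values \<open>p\<close> and the convergence on the sphere is trivial.\<close>
  have "L2_converges surface_measure (\<lambda>n. ansatz (s n)) p"
    unfolding L2_converges_def
  proof (intro conjI allI)
    show "L2 surface_measure (\<lambda>x. ansatz (s n) x - p x)" for n
      by (intro continuous_L2_surface continuous_intros cf continuous_p)
    have "(\<integral>x. (norm (ansatz (s n) x - p x))\<^sup>2 \<partial>surface_measure) = (\<integral>x. 0 \<partial>surface_measure)" for n
      by (rule sphere_integral_cong) (simp add: ansatz_sphere s1)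
    then show "(\<lambda>n. \<integral>x. (norm (ansatz (s n) x - p x))\<^sup>2 \<partial>surface_measure) \<longlonglongrightarrow> 0" by simp
  qed
  from has_traceI[OF smooth_ansatz u G(2) this] have trace: "has_trace u G p" .
  have lim: "(\<lambda>n. energy \<gamma> (grad (ansatz (s n))) (grad F)) \<longlonglongrightarrow> energy \<gamma> G (grad F)" if "smooth F" for F
    by (rule energy_tendsto[OF G(2,1)]) (intro continuous_L2_ball smooth_continuous_grad that)
  \<comment> \<open>The eigenvalue: the limit of the form against the polynomial 1, which exists
    because the gradients converge against one fixed smooth function.\<close>
  define b where "b = Re (energy \<gamma> G (grad (\<lambda>x. cnj (ansatz 1 x)))) / mass"
  have "(\<lambda>n. Re (energy \<gamma> (grad (ansatz (s n))) (grad (\<lambda>x. cnj (ansatz 1 x)))) / mass) \<longlonglongrightarrow> b"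
    unfolding b_def using mass by (intro tendsto_intros lim smooth_cnj_ansatz) simp
  then have b: "(\<lambda>n. poly_form (s n) 1) \<longlonglongrightarrow> b" using mass by (simp add: energy_cnj_ansatz)
  have "energy \<gamma> G (grad F) = of_real b * (\<integral>x. p x * F x \<partial>surface_measure)" if F: "smooth F" for F
  proof -
    let ?W = "amplitude F" and ?W' = "amplitude_deriv F"
    \<comment> \<open>\<open>L\<close> will be the real or the imaginary part.\<close>
    have parts: "(\<lambda>n. radial_form (profile (s n)) (profile_slope (s n)) (\<lambda>r. L (?W r)) (\<lambda>r. r * L (?W' r))) \<longlonglongrightarrow> L (?W 1) * b"
      if L: "bounded_linear L" for L :: "complex \<Rightarrow> real"
    proof -
      have "((\<lambda>r. L (?W r)) has_real_derivative L (?W' r)) (at r within {0..1})" for r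
        using bounded_linear.has_vector_derivative[OF L has_vector_derivative_at_within[OF amplitude_has_derivative[OF F]]]
        by (simp add: has_real_derivative_iff_has_vector_derivative)
      moreover have "continuous_on {0..1} (\<lambda>r. L (?W' r))"
        by (rule bounded_linear.continuous_on[OF L amplitude_continuous(2)[OF F]])
      ultimately have "(\<lambda>n. radial_form (profile (s n)) (profile_slope (s n)) (\<lambda>r. L (?W r)) (\<lambda>r. r * L (?W' r))
          - L (?W 1) * poly_form (s n) 1) \<longlonglongrightarrow> 0"
        by (intro weak_equation_boundary[OF sM s0])
      from tendsto_add[OF this tendsto_mult_left[OF b, of "L (?W 1)"]] show ?thesis by simp
    qed
    have "Re (energy \<gamma> G (grad F)) = Re (?W 1) * b"
      by (rule LIMSEQ_unique[OF tendsto_Re[OF lim[OF F]]])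
         (simp only: energy_ansatz_parts[OF F] parts[OF bounded_linear_Re])
    moreover have "Im (energy \<gamma> G (grad F)) = Im (?W 1) * b"
      by (rule LIMSEQ_unique[OF tendsto_Im[OF lim[OF F]]])
         (simp only: energy_ansatz_parts[OF F] parts[OF bounded_linear_Im])
    moreover have "?W 1 = (\<integral>x. p x * F x \<partial>surface_measure)" by (simp add: amplitude_def)
    ultimately show ?thesis by (simp add: complex_eq_iff mult.commute)
  qed
  then show ?thesis using trace by blast
qed

end

section \<open>Passage from the solid to the spherical harmonic\<close>

lemma L2_cong:
  assumes "\<And>x. x \<in> space M \<Longrightarrow> f x = g x"
  shows "L2 M f \<longleftrightarrow> L2 M g"
proof -
  have "f \<in> borel_measurable M \<longleftrightarrow> g \<in> borel_measurable M" by (rule measurable_cong) fact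
  moreover have "integrable M (\<lambda>x. (norm (f x))\<^sup>2) \<longleftrightarrow> integrable M (\<lambda>x. (norm (g x))\<^sup>2)"
    by (rule Bochner_Integration.integrable_cong) (simp_all add: assms)
  ultimately show ?thesis by (simp only: L2_def)
qed

text \<open>\<open>sph_harm\<close> is known to coincide with the solid harmonic on the unit sphere,
  and the surface measure sees nothing else.\<close>

lemma has_trace_cong_sphere:
  assumes t: "has_trace u G f" and eq: "\<And>x. norm x = 1 \<Longrightarrow> f x = h x"
  shows "has_trace u G h"
proof -
  obtain F where F: "\<And>n. smooth (F n)" "L2_converges ball_measure F u"
    "L2_converges ball_measure (\<lambda>n. grad (F n)) G" "L2_converges surface_measure F f"
    using has_traceE[OF t] by blast
  have d: "F n x - f x = F n x - h x" if "x \<in> space surface_measure" for n x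
    using that eq by (simp add: space_surface_measure)
  have "L2 surface_measure (\<lambda>x. F n x - h x) \<longleftrightarrow> L2 surface_measure (\<lambda>x. F n x - f x)" for n
    by (rule L2_cong) (simp add: d)
  moreover have "(\<integral>x. (norm (F n x - h x))\<^sup>2 \<partial>surface_measure) = (\<integral>x. (norm (F n x - f x))\<^sup>2 \<partial>surface_measure)" for n
    by (rule Bochner_Integration.integral_cong[OF refl]) (simp add: d)
  ultimately have "L2_converges surface_measure F h"
    using F(4) by (simp add: L2_converges_def)
  from has_traceI[OF F(1-3) this] show ?thesis .
qed

theorem proposition3p4:
  fixes \<gamma> :: "real^3 \<Rightarrow> real" and C :: real
  assumes "C > 0"
    and "\<gamma> \<in> borel_measurable (lebesgue_on (ball 0 1))"
    and "AE x in lebesgue_on (ball 0 1). inverse C \<le> \<gamma> x \<and> \<gamma> x \<le> C"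
    and "\<exists>g :: real \<Rightarrow> real. AE x in lebesgue_on (ball 0 1). \<gamma> x = g (norm x)"
  shows "\<forall>(l::nat) (m::int). - int l \<le> m \<and> m \<le> int l \<longrightarrow> dn_eigenfunction \<gamma> (sph_harm l m)"
proof (intro allI impI)
  fix l :: nat and m :: int
  assume "- int l \<le> m \<and> m \<le> int l"
  then have "- int l \<le> m" "m \<le> int l" by auto
  then obtain c s k where c: "c \<noteq> 0" and s: "s\<^sup>2 = -1" and k: "k \<le> l"
    and Y: "\<And>x. norm x = 1 \<Longrightarrow> sph_harm l m x = of_real c * solid_harmonic s l k x"
    by (rule sph_harm_sphere) (rule that)
  \<comment> \<open>The constant is absorbed so that \<open>p\<close> restricts to the spherical
    harmonic itself.\<close>
  define p where "p x = of_real c * solid_harmonic s l k x" for x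
  obtain g0 where g0: "AE x in ball_measure. \<gamma> x = g0 (norm x)" using assms(4) by blast
  obtain g where g: "g \<in> borel_measurable borel" "\<And>r. inverse C \<le> g r" "\<And>r. g r \<le> C"
    "AE x in ball_measure. \<gamma> x = g (norm x)"
    using radial_profile_exists[OF assms(1,2,3) g0] by blast
  interpret radial_conductivity \<gamma> C p l g
  proof unfold_locales
    show "poly3 p" unfolding p_def[abs_def] by (intro poly3.intros poly3_solid_harmonic)
    show "laplacian p x = 0" for x
      unfolding p_def[abs_def] by (simp add: laplacian_cmult poly3_solid_harmonic laplacian_solid_harmonic[OF s k])
    show "euler_deriv p x = of_nat l * p x" for x
      unfolding p_def[abs_def] by (simp add: euler_deriv_cmult poly3_solid_harmonic euler_deriv_solid_harmonic[OF k])
    show "p (r *\<^sub>R x) = of_real r ^ l * p x" for r x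
      by (simp add: p_def solid_harmonic_scale[OF k])
  qed (use assms g in auto)
  have sphere: "norm x = 1 \<Longrightarrow> p x = sph_harm l m x" for x by (simp add: Y p_def)
  obtain y where y: "norm y = 1" "p y \<noteq> 0"
    using solid_harmonic_nonzero[OF k, of s] c by (auto simp: p_def)
  have mass: "mass > 0" by (rule mass_pos[OF y(2,1)])
  have "\<exists>u G ev. has_trace u G p \<and> (\<forall>F. smooth F \<longrightarrow> energy \<gamma> G (grad F) = ev * (\<integral>x. p x * F x \<partial>surface_measure))"
  proof (cases "l = 0")
    case True
    \<comment> \<open>Scaling by 0 with \<open>0 ^ 0 = 1\<close> shows that \<open>p\<close> is
      constant; its gradient vanishes and the eigenvalue is 0.\<close>
    have "p x = p 0" for x using scale[of 0 x] True by simp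
    then have "p = (\<lambda>_. p 0)" by blast
    then have "partial_deriv i p = (\<lambda>_. 0)" for i
      using arg_cong[of p "\<lambda>_. p 0" "partial_deriv i"] unfolding partial_deriv_const by blast
    then have "energy \<gamma> (grad p) (grad F) = 0" for F by (simp add: energy_def)
    then show ?thesis
      using has_trace_smooth[OF poly3_smooth[OF poly3]]
      by (intro exI[of _ p] exI[of _ "grad p"] exI[of _ 0]) simp
  next
    case False
    then show ?thesis using solution_exists mass by simp
  qed
  then obtain u G ev where u: "has_trace u G p"
    and ev: "\<And>F. smooth F \<Longrightarrow> energy \<gamma> G (grad F) = ev * (\<integral>x. p x * F x \<partial>surface_measure)" by blast
  show "dn_eigenfunction \<gamma> (sph_harm l m)"
  proof (rule dn_eigenfunctionI)
    show "has_trace u G (sph_harm l m)" by (rule has_trace_cong_sphere[OF u sphere])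
    show "\<not> (AE x in surface_measure. sph_harm l m x = 0)"
    proof
      assume "AE x in surface_measure. sph_harm l m x = 0"
      then have "AE x in surface_measure. (norm (p x))\<^sup>2 = 0"
        using AE_space by eventually_elim (simp add: sphere space_surface_measure)
      then have "mass = 0" unfolding mass_def by (rule integral_eq_zero_AE)
      then show False using mass by simp
    qed
    fix F :: "real^3 \<Rightarrow> complex" assume F: "smooth F"
    have "(\<integral>x. p x * F x \<partial>surface_measure) = (\<integral>x. sph_harm l m x * F x \<partial>surface_measure)"
      by (rule sphere_integral_cong) (simp add: sphere)
    then show "energy \<gamma> G (grad F) = ev * (\<integral>x. sph_harm l m x * F x \<partial>surface_measure)"
      using ev[OF F] by simp
  qed
qed

end
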